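(* Let $\mathbb{F}$ be an algebraically closed field of characteristic $p>2$. Let $n$, $r$ be integers such that $n>0$ and $0\leq 2r\leq n$. Then the Specht module $S^{(n-r,r)}$ of $\mathbb{F}\mathfrak{S}_n$ is a trivial source module if and only if $(n-r,r)\in JM(n)_p$.
   Context: All modules are finitely generated left modules. For a finite group $G$, a trivial source $\mathbb{F}G$-module is an indecomposable $\mathbb{F}G$-module whose sources (with respect to its vertices) are trivial modules. $\mathfrak{S}_n$ is the symmetric group on $\{1,\dots,n\}$. For a partition $\lambda$ of $n$, $M^\lambda$ is the Young permutation module over $\mathbb{F}$ with basis the $\lambda$-tabloids, and the Specht module $S^\lambda$ is the $\mathbb{F}\mathfrak{S}_n$-submodule of $M^\lambda$ generated by all $\lambda$-polytabloids (James' convention; $S^{(n)}$ is trivial). When $r=0$, $(n-r,r)$ means $(n)$. $JM(n)_p$ denotes the set of partitions $\lambda$ of $n$ such that the Specht module $S^\lambda$ over $\mathbb{F}$ is simple. *)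

theory Defs
  imports
    "HOL-Algebra.Sym_Groups"
    "HOL-Combinatorics.Permutations"
    "HOL-Computational_Algebra.Computational_Algebra"
    "HOL-Library.Function_Algebras"
begin

section \<open>Finitely generated modules over the group algebra of a finite group\<close>

text \<open>
  The vector spaces are subspaces of coordinate spaces \<open>'i \<Rightarrow> 'k\<close> over a field \<open>'k\<close>.
  Every finite-dimensional space is isomorphic to a subspace of \<open>nat \<Rightarrow> 'k\<close>.
\<close>

definition fscale :: "'k::field \<Rightarrow> ('i \<Rightarrow> 'k) \<Rightarrow> 'i \<Rightarrow> 'k" where
  "fscale c f = (\<lambda>i. c * f i)"

global_interpretation fvs: vector_space "fscale :: 'k::field \<Rightarrow> ('i \<Rightarrow> 'k) \<Rightarrow> 'i \<Rightarrow> 'k"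
  by standard (simp_all add: fscale_def fun_eq_iff algebra_simps)

text \<open>
  A finitely generated left module over the group algebra of a finite group \<open>G\<close> is a
  finite-dimensional vector space on which \<open>G\<close> acts by linear maps.
\<close>

record ('g, 'i, 'k) gmod =
  vecs :: "('i \<Rightarrow> 'k) set"
  act :: "'g \<Rightarrow> ('i \<Rightarrow> 'k) \<Rightarrow> ('i \<Rightarrow> 'k)"

locale fg_module = group G
  for G (structure) and M :: "('g, 'i, 'k::field) gmod" +
  assumes finite_group: "finite (carrier G)"
    and subspace_vecs: "fvs.subspace (vecs M)"
    and finite_dim: "\<exists>B. finite B \<and> vecs M = fvs.span B"
    and act_closed: "\<lbrakk>g \<in> carrier G; v \<in> vecs M\<rbrakk> \<Longrightarrow> act M g v \<in> vecs M"
    and act_add: "\<lbrakk>g \<in> carrier G; v \<in> vecs M; w \<in> vecs M\<rbrakk> \<Longrightarrow>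
      act M g (v + w) = act M g v + act M g w"
    and act_scale: "\<lbrakk>g \<in> carrier G; v \<in> vecs M\<rbrakk> \<Longrightarrow>
      act M g (fscale c v) = fscale c (act M g v)"
    and act_one: "v \<in> vecs M \<Longrightarrow> act M \<one> v = v"
    and act_mult: "\<lbrakk>g \<in> carrier G; h \<in> carrier G; v \<in> vecs M\<rbrakk> \<Longrightarrow>
      act M (g \<otimes> h) v = act M g (act M h v)"

definition submodule :: "('g, 'x) monoid_scheme \<Rightarrow> ('g, 'i, 'k::field) gmod \<Rightarrow> ('i \<Rightarrow> 'k) set \<Rightarrow> bool"
  where "submodule G M W \<longleftrightarrow>
    fvs.subspace W \<and> W \<subseteq> vecs M \<and> (\<forall>g\<in>carrier G. \<forall>w\<in>W. act M g w \<in> W)"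

definition submodule_generated ::
    "('g, 'x) monoid_scheme \<Rightarrow> ('g, 'i, 'k::field) gmod \<Rightarrow> ('i \<Rightarrow> 'k) set \<Rightarrow> ('i \<Rightarrow> 'k) set"
  where "submodule_generated G M X = \<Inter> {W. submodule G M W \<and> X \<subseteq> W}"

definition is_direct_sum ::
    "('g, 'x) monoid_scheme \<Rightarrow> ('g, 'i, 'k::field) gmod \<Rightarrow> ('i \<Rightarrow> 'k) set \<Rightarrow> ('i \<Rightarrow> 'k) set \<Rightarrow> bool"
  where "is_direct_sum G M A B \<longleftrightarrow>
    submodule G M A \<and> submodule G M B \<and> A \<inter> B = {0} \<and> vecs M = {a + b | a b. a \<in> A \<and> b \<in> B}"

definition gmod_iso ::
    "('g, 'x) monoid_scheme \<Rightarrow> ('g, 'i, 'k::field) gmod \<Rightarrow> ('g, 'j, 'k) gmod \<Rightarrow> bool"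
  where "gmod_iso G M N \<longleftrightarrow> (\<exists>\<phi>. bij_betw \<phi> (vecs M) (vecs N) \<and>
    (\<forall>v\<in>vecs M. \<forall>w\<in>vecs M. \<phi> (v + w) = \<phi> v + \<phi> w) \<and>
    (\<forall>c. \<forall>v\<in>vecs M. \<phi> (fscale c v) = fscale c (\<phi> v)) \<and>
    (\<forall>g\<in>carrier G. \<forall>v\<in>vecs M. \<phi> (act M g v) = act N g (\<phi> v)))"

definition iso_to_direct_summand ::
    "('g, 'x) monoid_scheme \<Rightarrow> ('g, 'i, 'k::field) gmod \<Rightarrow> ('g, 'j, 'k) gmod \<Rightarrow> bool"
  where "iso_to_direct_summand G M N \<longleftrightarrow>
    (\<exists>A B. is_direct_sum G N A B \<and> gmod_iso G M (N\<lparr>vecs := A\<rparr>))"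

definition indecomposable_module ::
    "('g, 'x) monoid_scheme \<Rightarrow> ('g, 'i, 'k::field) gmod \<Rightarrow> bool"
  where "indecomposable_module G M \<longleftrightarrow> fg_module G M \<and> vecs M \<noteq> {0} \<and>
    (\<forall>A B. is_direct_sum G M A B \<longrightarrow> A = {0} \<or> B = {0})"

definition simple_module ::
    "('g, 'x) monoid_scheme \<Rightarrow> ('g, 'i, 'k::field) gmod \<Rightarrow> bool"
  where "simple_module G M \<longleftrightarrow> fg_module G M \<and> vecs M \<noteq> {0} \<and>
    (\<forall>W. submodule G M W \<longrightarrow> W = {0} \<or> W = vecs M)"

definition trivial_module ::
    "('g, 'x) monoid_scheme \<Rightarrow> ('g, 'i, 'k::field) gmod \<Rightarrow> bool"
  where "trivial_module G M \<longleftrightarrow> fg_module G M \<and> fvs.dim (vecs M) = 1 \<and>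
    (\<forall>g\<in>carrier G. \<forall>v\<in>vecs M. act M g v = v)"

section \<open>Induction, vertices and sources\<close>

text \<open>
  The induced module \<open>kG \<otimes>\<^bsub>kH\<^esub> U\<close>, realised as the space of functions \<open>f : G \<Rightarrow> U\<close> with
  \<open>f (g h) = h\<inverse> f g\<close> for \<open>h \<in> H\<close>, on which \<open>x \<in> G\<close> acts by \<open>(x f) g = f (x\<inverse> g)\<close>.  The tensor
  \<open>x \<otimes> u\<close> corresponds to the function supported on the coset \<open>x H\<close> with value \<open>h\<inverse> u\<close> at \<open>x h\<close>.
  Functions are extended by zero outside the carrier of \<open>G\<close>, and stored in uncurried form.
\<close>

definition induced_module ::
    "('g, 'x) monoid_scheme \<Rightarrow> 'g set \<Rightarrow> ('g, 'i, 'k::field) gmod \<Rightarrow> ('g, 'g \<times> 'i, 'k) gmod"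
  where "induced_module G H U = \<lparr>
    vecs = {f. (\<forall>g. g \<notin> carrier G \<longrightarrow> curry f g = 0) \<and>
               (\<forall>g\<in>carrier G. curry f g \<in> vecs U) \<and>
               (\<forall>g\<in>carrier G. \<forall>h\<in>H. curry f (g \<otimes>\<^bsub>G\<^esub> h) = act U (inv\<^bsub>G\<^esub> h) (curry f g))},
    act = (\<lambda>x f (g, i). if g \<in> carrier G then f (inv\<^bsub>G\<^esub> x \<otimes>\<^bsub>G\<^esub> g, i) else 0)\<rparr>"

definition relatively_projective ::
    "('g, 'x) monoid_scheme \<Rightarrow> 'g set \<Rightarrow> ('g, 'i, 'k::field) gmod \<Rightarrow> bool"
  where "relatively_projective G H M \<longleftrightarrow>
    (\<exists>U :: ('g, nat, 'k) gmod. fg_module (G\<lparr>carrier := H\<rparr>) U \<and>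
      iso_to_direct_summand G M (induced_module G H U))"

definition is_vertex ::
    "('g, 'x) monoid_scheme \<Rightarrow> ('g, 'i, 'k::field) gmod \<Rightarrow> 'g set \<Rightarrow> bool"
  where "is_vertex G M Q \<longleftrightarrow> subgroup Q G \<and> relatively_projective G Q M \<and>
    (\<forall>R. subgroup R G \<and> R \<subset> Q \<longrightarrow> \<not> relatively_projective G R M)"

definition is_source ::
    "('g, 'x) monoid_scheme \<Rightarrow> ('g, 'i, 'k::field) gmod \<Rightarrow> 'g set \<Rightarrow> ('g, nat, 'k) gmod \<Rightarrow> bool"
  where "is_source G M Q U \<longleftrightarrow>
    indecomposable_module (G\<lparr>carrier := Q\<rparr>) U \<and>
    iso_to_direct_summand G M (induced_module G Q U)"

definition trivial_source_module ::
    "('g, 'x) monoid_scheme \<Rightarrow> ('g, 'i, 'k::field) gmod \<Rightarrow> bool"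
  where "trivial_source_module G M \<longleftrightarrow> indecomposable_module G M \<and>
    (\<forall>Q U. is_vertex G M Q \<and> is_source G M Q U \<longrightarrow> trivial_module (G\<lparr>carrier := Q\<rparr>) U)"

section \<open>Young permutation modules and Specht modules\<close>

definition is_partition :: "nat \<Rightarrow> nat list \<Rightarrow> bool" where
  "is_partition n \<mu> \<longleftrightarrow> sorted_wrt (\<ge>) \<mu> \<and> 0 \<notin> set \<mu> \<and> sum_list \<mu> = n"

text \<open>The boxes are numbered from 0, as (row, column).\<close>

definition young_diagram :: "nat list \<Rightarrow> (nat \<times> nat) set" where
  "young_diagram \<mu> = {(i, j). i < length \<mu> \<and> j < \<mu> ! i}"

definition tableau :: "nat list \<Rightarrow> (nat \<times> nat \<Rightarrow> nat) \<Rightarrow> bool" where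
  "tableau \<mu> t \<longleftrightarrow> bij_betw t (young_diagram \<mu>) {1..sum_list \<mu>}"

text \<open>
  A tabloid is a row equivalence class of tableaux; it is represented by the list of the sets
  of entries of the rows.
\<close>

definition tabloid_of :: "nat list \<Rightarrow> (nat \<times> nat \<Rightarrow> nat) \<Rightarrow> nat set list" where
  "tabloid_of \<mu> t = map (\<lambda>i. (\<lambda>j. t (i, j)) ` {..<\<mu> ! i}) [0..<length \<mu>]"

definition tabloids :: "nat list \<Rightarrow> nat set list set" where
  "tabloids \<mu> = tabloid_of \<mu> ` {t. tableau \<mu> t}"

definition basis_vec :: "'i \<Rightarrow> 'i \<Rightarrow> 'k::field" where
  "basis_vec T = (\<lambda>T'. if T' = T then 1 else 0)"

text \<open>
  The action is \<open>(\<sigma> f) T = f (\<sigma>\<inverse> T)\<close>, where \<open>\<sigma>\<inverse> T\<close> is computed by preimages; it satisfies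
  \<open>\<sigma> e\<^bsub>T\<^esub> = e\<^bsub>\<sigma> T\<^esub>\<close> for the basis vectors (lemma \<open>act_basis_vec\<close> below).
\<close>

definition young_perm_module :: "nat list \<Rightarrow> (nat \<Rightarrow> nat, nat set list, 'k::field) gmod" where
  "young_perm_module \<mu> = \<lparr>
    vecs = fvs.span (basis_vec ` tabloids \<mu>),
    act = (\<lambda>\<sigma> f T. f (map (vimage \<sigma>) T))\<rparr>"

definition column_stabilizer :: "nat list \<Rightarrow> (nat \<times> nat \<Rightarrow> nat) \<Rightarrow> (nat \<Rightarrow> nat) set" where
  "column_stabilizer \<mu> t = {\<pi>. \<pi> permutes {1..sum_list \<mu>} \<and>
    (\<forall>j. \<pi> ` {t (i, j) | i. (i, j) \<in> young_diagram \<mu>} = {t (i, j) | i. (i, j) \<in> young_diagram \<mu>})}"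

definition polytabloid :: "nat list \<Rightarrow> (nat \<times> nat \<Rightarrow> nat) \<Rightarrow> nat set list \<Rightarrow> 'k::field" where
  "polytabloid \<mu> t =
    (\<Sum>\<pi>\<in>column_stabilizer \<mu> t. fscale (of_int (sign \<pi>)) (basis_vec (tabloid_of \<mu> (\<pi> \<circ> t))))"

definition specht_module :: "nat list \<Rightarrow> (nat \<Rightarrow> nat, nat set list, 'k::field) gmod" where
  "specht_module \<mu> = (young_perm_module \<mu>)\<lparr>vecs :=
    submodule_generated (sym_group (sum_list \<mu>)) (young_perm_module \<mu>)
      (polytabloid \<mu> ` {t. tableau \<mu> t})\<rparr>"

definition JM :: "'k::field itself \<Rightarrow> nat \<Rightarrow> nat list set" where
  "JM _ n = {\<mu>. is_partition n \<mu> \<and>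
    simple_module (sym_group n) (specht_module \<mu> :: (nat \<Rightarrow> nat, nat set list, 'k) gmod)}"

definition two_part :: "nat \<Rightarrow> nat \<Rightarrow> nat list" where
  "two_part n r = (if r = 0 then [n] else [n - r, r])"

lemma act_basis_vec:
  assumes "\<sigma> permutes S"
  shows "act (young_perm_module \<mu>) \<sigma> (basis_vec T) = basis_vec (map (image \<sigma>) T)"
proof -
  have "map (vimage \<sigma>) T' = T \<longleftrightarrow> T' = map (image \<sigma>) T" for T'
  proof -
    have "bij \<sigma>" using assms by (rule permutes_bij)
    then have 1: "\<sigma> -` \<sigma> ` A = A" and 2: "\<sigma> ` \<sigma> -` A = A" for A
      by (simp_all add: bij_def inj_vimage_image_eq surj_image_vimage_eq)
    then have "map (image \<sigma>) (map (vimage \<sigma>) T') = T'" "map (vimage \<sigma>) (map (image \<sigma>) T) = T"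
      by (simp_all add: map_idI)
    then show ?thesis by metis
  qed
  then show ?thesis by (simp add: young_perm_module_def basis_vec_def fun_eq_iff)
qed

section \<open>Well-formedness\<close>

lemma act_young_linear:
  "act (young_perm_module \<mu>) \<sigma> (v + w) = act (young_perm_module \<mu>) \<sigma> v + act (young_perm_module \<mu>) \<sigma> w"
  "act (young_perm_module \<mu>) \<sigma> (fscale c v) = fscale c (act (young_perm_module \<mu>) \<sigma> v)"
  by (simp_all add: young_perm_module_def fscale_def fun_eq_iff)

lemma tableau_comp:
  assumes "\<sigma> permutes {1..sum_list \<mu>}" "tableau \<mu> t"
  shows "tableau \<mu> (\<sigma> \<circ> t)"
  using assms unfolding tableau_def by (meson bij_betw_trans permutes_imp_bij)

lemma tabloid_of_comp: "tabloid_of \<mu> (\<sigma> \<circ> t) = map (image \<sigma>) (tabloid_of \<mu> t)"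
  by (simp add: tabloid_of_def image_image)

lemma finite_tabloids: "finite (tabloids \<mu>)"
proof (rule finite_subset)
  show "finite {xs. set xs \<subseteq> Pow {1..sum_list \<mu>} \<and> length xs = length \<mu>}"
    by (rule finite_lists_length_eq) simp
  show "tabloids \<mu> \<subseteq> {xs. set xs \<subseteq> Pow {1..sum_list \<mu>} \<and> length xs = length \<mu>}"
  proof
    fix T assume "T \<in> tabloids \<mu>"
    then obtain t where t: "tableau \<mu> t" "T = tabloid_of \<mu> t" by (auto simp: tabloids_def)
    have "t (i, j) \<in> {1..sum_list \<mu>}" if "i < length \<mu>" "j < \<mu> ! i" for i j
    proof -
      have "bij_betw t (young_diagram \<mu>) {1..sum_list \<mu>}" using t(1) by (simp add: tableau_def)
      moreover have "(i, j) \<in> young_diagram \<mu>" using that by (simp add: young_diagram_def)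
      ultimately show ?thesis by (metis bij_betwE)
    qed
    then have "(\<lambda>j. t (i, j)) ` {..<\<mu> ! i} \<subseteq> {1..sum_list \<mu>}" if "i < length \<mu>" for i
      using that by blast
    then show "T \<in> {xs. set xs \<subseteq> Pow {1..sum_list \<mu>} \<and> length xs = length \<mu>}"
      unfolding t(2) tabloid_of_def by fastforce
  qed
qed

lemma sym_group_simps: "carrier (sym_group n) = {p. p permutes {1..n}}"
  "x \<otimes>\<^bsub>sym_group n\<^esub> y = x \<circ> y" "\<one>\<^bsub>sym_group n\<^esub> = id"
  by (simp_all add: sym_group_def)

lemma fg_module_young_perm_module:
  "fg_module (sym_group (sum_list \<mu>)) (young_perm_module \<mu> :: (_, _, 'k::field) gmod)"
proof -
  interpret group "sym_group (sum_list \<mu>)" by (rule sym_group_is_group)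
  let ?M = "young_perm_module \<mu> :: (_, _, 'k) gmod"
  have V: "vecs ?M = fvs.span (basis_vec ` tabloids \<mu>)" by (simp add: young_perm_module_def)
  show ?thesis
  proof
    show "finite (carrier (sym_group (sum_list \<mu>)))"
      by (simp add: sym_group_simps finite_permutations)
    show "fvs.subspace (vecs ?M)" unfolding V by (rule fvs.subspace_span)
    show "\<exists>B. finite B \<and> vecs ?M = fvs.span B" unfolding V using finite_tabloids by blast
  next
    fix g v assume g: "g \<in> carrier (sym_group (sum_list \<mu>))" and v: "v \<in> vecs ?M"
    have g': "g permutes {1..sum_list \<mu>}" using g by (simp add: sym_group_simps)
    show "act ?M g v \<in> vecs ?M" using v unfolding V
    proof (induction rule: fvs.span_induct_alt)
      case base
      have "act ?M g 0 = 0" by (simp add: young_perm_module_def fun_eq_iff)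
      then show ?case by (simp only: fvs.span_zero)
    next
      case (step c x y)
      then obtain t where t: "tableau \<mu> t" "x = basis_vec (tabloid_of \<mu> t)" by (auto simp: tabloids_def)
      have "act ?M g x = basis_vec (tabloid_of \<mu> (g \<circ> t))"
        unfolding t by (simp only: act_basis_vec[OF g'] tabloid_of_comp)
      moreover have "tabloid_of \<mu> (g \<circ> t) \<in> tabloids \<mu>" using tableau_comp[OF g' t(1)] by (auto simp: tabloids_def)
      ultimately have "act ?M g x \<in> fvs.span (basis_vec ` tabloids \<mu>)" by (metis fvs.span_base imageI)
      then show ?case using step unfolding act_young_linear by (intro fvs.span_add fvs.span_scale)
    qed
  next
    fix v show "act ?M \<one>\<^bsub>sym_group (sum_list \<mu>)\<^esub> v = v"
      by (simp add: young_perm_module_def sym_group_simps fun_eq_iff map_idI)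
  next
    fix g h v
    show "act ?M (g \<otimes>\<^bsub>sym_group (sum_list \<mu>)\<^esub> h) v = act ?M g (act ?M h v)"
      by (simp add: young_perm_module_def sym_group_simps fun_eq_iff vimage_comp comp_def)
  qed (simp_all only: act_young_linear)
qed

lemma finite_span_subspace:
  assumes "finite B" "fvs.subspace W" "W \<subseteq> fvs.span B"
  shows "\<exists>C. finite C \<and> W = fvs.span C"
proof -
  obtain C where C: "C \<subseteq> W" "fvs.independent C" "W \<subseteq> fvs.span C"
    using fvs.maximal_independent_subset by blast
  have "finite C" using fvs.independent_span_bound[OF assms(1) C(2)] C(1) assms(3) by auto
  moreover have "W = fvs.span C" using C assms(2) by (metis fvs.span_minimal subset_antisym)
  ultimately show ?thesis by blast
qed

lemma (in fg_module) fg_submodule: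
  assumes "submodule G M W"
  shows "fg_module G (M\<lparr>vecs := W\<rparr>)"
proof -
  have W: "fvs.subspace W" "W \<subseteq> vecs M" "\<And>g w. g \<in> carrier G \<Longrightarrow> w \<in> W \<Longrightarrow> act M g w \<in> W"
    using assms by (auto simp: submodule_def)
  obtain B where B: "finite B" "vecs M = fvs.span B" using finite_dim by blast
  have fin: "\<exists>C. finite C \<and> W = fvs.span C"
    using finite_span_subspace[OF B(1) W(1)] W(2) B(2) by simp
  have WM: "w \<in> vecs M" if "w \<in> W" for w using W(2) that by blast
  show ?thesis
    by unfold_locales
      (simp_all add: finite_group W(1) fin W(3) act_add act_scale act_one act_mult WM)
qed

lemma (in fg_module) submodule_submodule_generated:
  assumes "X \<subseteq> vecs M"
  shows "submodule G M (submodule_generated G M X)"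
proof -
  let ?S = "{W. submodule G M W \<and> X \<subseteq> W}"
  have "vecs M \<in> ?S" using subspace_vecs act_closed assms by (simp add: submodule_def)
  then have "\<Inter> ?S \<subseteq> vecs M" by (rule Inter_lower)
  moreover have "fvs.subspace (\<Inter> ?S)" by (rule fvs.subspace_Inter) (simp add: submodule_def)
  moreover have "act M g w \<in> \<Inter> ?S" if "g \<in> carrier G" "w \<in> \<Inter> ?S" for g w
    using that by (simp add: submodule_def)
  ultimately show ?thesis unfolding submodule_generated_def by (simp add: submodule_def)
qed

lemma polytabloid_in_young_perm_module:
  assumes "tableau \<mu> t"
  shows "polytabloid \<mu> t \<in> vecs (young_perm_module \<mu>)"
proof -
  have "basis_vec (tabloid_of \<mu> (\<pi> \<circ> t)) \<in> fvs.span (basis_vec ` tabloids \<mu>)"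
    if "\<pi> \<in> column_stabilizer \<mu> t" for \<pi>
    using that tableau_comp[OF _ assms] unfolding column_stabilizer_def tabloids_def
    by (intro fvs.span_base) blast
  then show ?thesis
    unfolding polytabloid_def young_perm_module_def gmod.simps
    by (intro fvs.span_sum fvs.span_scale)
qed

lemma fg_module_specht_module:
  "fg_module (sym_group (sum_list \<mu>)) (specht_module \<mu>)"
proof -
  interpret fg_module "sym_group (sum_list \<mu>)" "young_perm_module \<mu>"
    by (rule fg_module_young_perm_module)
  show ?thesis
    unfolding specht_module_def
    by (rule fg_submodule, rule submodule_submodule_generated)
      (use polytabloid_in_young_perm_module in blast)
qed

lemma sum_apply_fun: "(sum F A) x = (\<Sum>a\<in>A. F a x)" for F :: "'a \<Rightarrow> 'b \<Rightarrow> 'c::comm_monoid_add"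
  by (induction A rule: infinite_finite_induct) auto

lemma fg_module_induced:
  fixes U :: "('g,'i,'k::field) gmod"
  assumes G: "group G" "finite (carrier G)" and H: "subgroup H G" and U: "fg_module (G\<lparr>carrier := H\<rparr>) U"
  shows "fg_module G (induced_module G H U)"
proof -
  interpret group G by fact
  interpret U: fg_module "G\<lparr>carrier := H\<rparr>" U by fact
  interpret H: subgroup H G by fact
  let ?I = "induced_module G H U"
  have sub: "fvs.subspace (vecs ?I)"
    using U.subspace_vecs U.act_add U.act_scale unfolding fvs.subspace_def induced_module_def
  proof (auto simp: curry_def fscale_def fun_eq_iff plus_fun_def zero_fun_def, goal_cases)
    case (1 h g0 x)
    have z: "fscale 0 0 = (0::'i\<Rightarrow>'k)" by (simp add: fscale_def fun_eq_iff)
    from 1 have hH: "inv\<^bsub>G\<^esub> h \<in> H" by auto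
    then have "act U (inv\<^bsub>G\<^esub> h) (fscale 0 0) = fscale 0 (act U (inv\<^bsub>G\<^esub> h) 0)" 
      using U.act_scale[of "inv\<^bsub>G\<^esub> h" 0 0] U.subspace_vecs by (simp add: fvs.subspace_def)
    then show ?case by (simp add: fun_eq_iff fscale_def zero_fun_def)
  qed
  obtain B where B: "finite B" "vecs U = fvs.span B" using U.finite_dim by blast
  define D where "D = (\<lambda>(g,b) (g',i). if g' = g then b i else 0) ` (carrier G \<times> B)"
  have fD: "finite D" unfolding D_def using B G by auto
  have DD: "(\<lambda>(g',i). if g' = g then u i else 0) \<in> fvs.span D" if "g \<in> carrier G" "u \<in> fvs.span B" for g u
    using that(2)
  proof (induction rule: fvs.span_induct_alt)
    case base
    have "(\<lambda>(g',i). if g' = g then (0::'i\<Rightarrow>'k) i else 0) = 0" by (auto simp: fun_eq_iff)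
    then show ?case by (simp only: fvs.span_zero)
  next
    case (step c x y)
    have "(\<lambda>(g',i). if g' = g then (fscale c x + y) i else 0) = fscale c (\<lambda>(g',i). if g' = g then x i else 0) + (\<lambda>(g',i). if g' = g then y i else 0)"
      by (auto simp: fun_eq_iff fscale_def)
    moreover have "(\<lambda>(g',i). if g' = g then x i else 0) \<in> fvs.span D"
      using step that(1) by (intro fvs.span_base) (auto simp: D_def)
    ultimately show ?case using step by (simp only: fvs.span_add fvs.span_scale)
  qed
  have "vecs ?I \<subseteq> fvs.span D"
  proof
    fix f assume f: "f \<in> vecs ?I"
    have "f = (\<Sum>g\<in>carrier G. (\<lambda>(g',i). if g' = g then curry f g i else 0))"
    proof
      fix x :: "'g \<times> 'i"
      obtain a i where x: "x = (a,i)" by (cases x)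
      have "(\<Sum>g\<in>carrier G. (\<lambda>(g',i). if g' = g then curry f g i else 0)) x = (\<Sum>g\<in>carrier G. if a = g then f (g,i) else 0)"
        unfolding x sum_apply_fun by (auto intro: sum.cong)
      also have "\<dots> = f x" using f G(2) unfolding x by (auto simp: induced_module_def curry_def fun_eq_iff)
      finally show "f x = (\<Sum>g\<in>carrier G. (\<lambda>(g',i). if g' = g then curry f g i else 0)) x" ..
    qed
    moreover have "\<dots> \<in> fvs.span D"
    proof (intro fvs.span_sum DD)
      fix g assume "g \<in> carrier G" then show "curry f g \<in> fvs.span B" using f B by (simp add: induced_module_def)
    qed
    ultimately show "f \<in> fvs.span D" by simp
  qed
  then have fin: "\<exists>B. finite B \<and> vecs ?I = fvs.span B"
    using finite_span_subspace[OF fD sub] by blast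
  show ?thesis
  proof
    fix g v assume g: "g \<in> carrier G" and v: "v \<in> vecs ?I"
    have m: "x \<otimes>\<^bsub>G\<^esub> (y \<otimes>\<^bsub>G\<^esub> z) = (x \<otimes>\<^bsub>G\<^esub> y) \<otimes>\<^bsub>G\<^esub> z"
      if "x \<in> carrier G" "y \<in> carrier G" "z \<in> carrier G" for x y z
      using m_assoc that by simp
    have "curry (act ?I g v) x = (if x \<in> carrier G then curry v (inv\<^bsub>G\<^esub> g \<otimes>\<^bsub>G\<^esub> x) else 0)" for x
      by (simp add: induced_module_def fun_eq_iff)
    then show "act ?I g v \<in> vecs ?I"
      using g v by (simp add: induced_module_def m)
  next
    fix g v w
    show "act ?I g (v + w) = act ?I g v + act ?I g w"
      by (simp add: induced_module_def fun_eq_iff)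
  next
    fix g c v
    show "act ?I g (fscale c v) = fscale c (act ?I g v)"
      by (simp add: induced_module_def fun_eq_iff fscale_def)
  next
    fix v assume "v \<in> vecs ?I"
    then have "curry v x = 0" if "x \<notin> carrier G" for x
      using that by (simp add: induced_module_def)
    then have "v (x, i) = 0" if "x \<notin> carrier G" for x i
      using that by (metis curry_conv zero_fun_apply)
    then show "act ?I \<one>\<^bsub>G\<^esub> v = v"
      by (simp add: induced_module_def fun_eq_iff)
  next
    fix g h v assume "g \<in> carrier G" "h \<in> carrier G"
    then show "act ?I (g \<otimes>\<^bsub>G\<^esub> h) v = act ?I g (act ?I h v)"
      by (simp add: induced_module_def fun_eq_iff inv_mult_group m_assoc)
  qed (rule G(2) sub fin)+
qed

end

theory Submission
  imports Defs
begin

text \<open>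
  By Frobenius reciprocity, \<open>M\<close> is a summand of \<open>kG \<otimes>\<^bsub>kQ\<^esub> U\<close> iff \<open>id\<^sub>M\<close> is a relative trace
  \<open>\<Sum>\<^bsub>gQ\<^esub> g \<beta> \<alpha> g\<inverse>\<close> with \<open>Q\<close>-maps \<open>\<alpha> : M \<rightarrow> U\<close> and \<open>\<beta> : U \<rightarrow> M\<close>.  For a module \<open>M\<close> all of whose
  endomorphisms are scalars this shows that \<open>M\<close> is a trivial source module iff it is a summand
  of a permutation module, that is, \<open>id\<^sub>M = \<Sum>\<^bsub>y\<in>Y\<^esub> f\<^sub>y(-) v\<^sub>y\<close> for a finite \<open>G\<close>-set \<open>Y\<close> and
  equivariant families \<open>v\<^sub>y \<in> M\<close>, \<open>f\<^sub>y \<in> M\<^sup>*\<close>.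

  In the coordinates given by the second rows \<open>x\<close> of tabloids, a two-part polytabloid is the
  product of the functions \<open>x \<mapsto> [b \<in> x] - [a \<in> x]\<close> over its \<open>r\<close> columns \<open>(a, b)\<close>.  Antisymmetrising a
  function in as many disjoint pairs of points as possible shows that every nonzero submodule
  of \<open>S\<close> contains such a product \<open>w\<close> over \<open>j \<le> r\<close> disjoint pairs, and \<open>j < r\<close> if the submodule is
  proper.

  If \<open>S\<close> is simple, the standard form is nondegenerate on \<open>S\<close>, since \<open>2 \<noteq> 0\<close>, and \<open>S\<close> is a summand of the
  Young permutation module.  If \<open>S\<close> is not simple, it contains some \<open>w\<close> as above with \<open>j < r\<close>.  The
  part \<open>\<epsilon>S\<close> of \<open>S\<close> antisymmetric in the \<open>j\<close> pairs then has the nonzero vector \<open>w\<close> fixed by the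
  symmetric group \<open>H\<close> on the remaining points, but no nonzero \<open>H\<close>-invariant functional, because
  \<open>\<epsilon>S\<close> is spanned by products with a further column inside the remaining points.  This cannot
  happen for a summand of a permutation module.
\<close>

section \<open>Homomorphisms and direct summands\<close>

text \<open>The definition of a trivial source module quantifies over all vertices and all sources.
  From a permutation summand every source has to be shown trivial, while the converse needs at least
  one vertex with a source. Scalar endomorphisms settle both without any uniqueness theorem: a
  relative trace is a scalar, and if traces add up to the identity, one of them is invertible and
  can be normalised.

  The final contradiction is delicate because orbit sizes may vanish in the field, so invariant
  functionals and fixed vectors cannot be matched by averaging. With c(y) = f_y(w) and F(x, y) =
  f_x(\<epsilon> v_y) one has F c = c, and the column sums of F over H-orbits vanish, being values
  of H-invariant functionals on \<epsilon>S. The equation F c = c involves row sums instead; the two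
  kinds of sums are compared by counting in the natural numbers.

  Besides making the normalised antisymmetrisation \<epsilon> idempotent, 2 \<noteq> 0 forces a
  function alternating in a list of pairs to vanish on every tabloid that does not separate each
  pair.\<close>

lemma fscale_apply: "fscale c f i = c * f i"
  by (simp add: fscale_def)

definition gmod_hom ::
    "('g, 'x) monoid_scheme \<Rightarrow> ('g, 'i, 'k::field) gmod \<Rightarrow> ('g, 'j, 'k) gmod \<Rightarrow> (('i \<Rightarrow> 'k) \<Rightarrow> 'j \<Rightarrow> 'k) \<Rightarrow> bool"
  where "gmod_hom G M N \<phi> \<longleftrightarrow> (\<forall>v\<in>vecs M. \<phi> v \<in> vecs N) \<and>
    (\<forall>v\<in>vecs M. \<forall>w\<in>vecs M. \<phi> (v + w) = \<phi> v + \<phi> w) \<and>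
    (\<forall>c. \<forall>v\<in>vecs M. \<phi> (fscale c v) = fscale c (\<phi> v)) \<and>
    (\<forall>g\<in>carrier G. \<forall>v\<in>vecs M. \<phi> (act M g v) = act N g (\<phi> v))"

lemma gmod_homI:
  assumes "\<And>v. v \<in> vecs M \<Longrightarrow> \<phi> v \<in> vecs N"
    "\<And>v w. v \<in> vecs M \<Longrightarrow> w \<in> vecs M \<Longrightarrow> \<phi> (v + w) = \<phi> v + \<phi> w"
    "\<And>c v. v \<in> vecs M \<Longrightarrow> \<phi> (fscale c v) = fscale c (\<phi> v)"
    "\<And>g v. g \<in> carrier G \<Longrightarrow> v \<in> vecs M \<Longrightarrow> \<phi> (act M g v) = act N g (\<phi> v)"
  shows "gmod_hom G M N \<phi>"
  using assms by (simp add: gmod_hom_def)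

lemma gmod_homD:
  assumes "gmod_hom G M N \<phi>"
  shows "v \<in> vecs M \<Longrightarrow> \<phi> v \<in> vecs N"
    "v \<in> vecs M \<Longrightarrow> w \<in> vecs M \<Longrightarrow> \<phi> (v + w) = \<phi> v + \<phi> w"
    "v \<in> vecs M \<Longrightarrow> \<phi> (fscale c v) = fscale c (\<phi> v)"
    "g \<in> carrier G \<Longrightarrow> v \<in> vecs M \<Longrightarrow> \<phi> (act M g v) = act N g (\<phi> v)"
  using assms by (simp_all add: gmod_hom_def)

lemma gmod_hom_zero:
  assumes "gmod_hom G M N \<phi>" "0 \<in> vecs M"
  shows "\<phi> 0 = 0"
  using gmod_homD(3)[OF assms, of 0] by (simp add: fscale_def zero_fun_def)

lemma gmod_hom_comp:
  assumes "gmod_hom G M N \<phi>" "gmod_hom G N P \<psi>"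
  shows "gmod_hom G M P (\<lambda>v. \<psi> (\<phi> v))"
  by (rule gmod_homI) (simp_all add: gmod_homD[OF assms(1)] gmod_homD[OF assms(2)])

lemma gmod_hom_carrier_mono:
  assumes "gmod_hom G M N \<phi>" "Q \<subseteq> carrier G"
  shows "gmod_hom (G\<lparr>carrier := Q\<rparr>) M N \<phi>"
  using assms by (auto simp: gmod_hom_def)

definition scalar_endomorphisms :: "('g, 'x) monoid_scheme \<Rightarrow> ('g, 'i, 'k::field) gmod \<Rightarrow> bool"
  where "scalar_endomorphisms G M \<longleftrightarrow>
    (\<forall>\<phi>. gmod_hom G M M \<phi> \<longrightarrow> (\<exists>c. \<forall>v\<in>vecs M. \<phi> v = fscale c v))"

context fg_module begin

lemma zero_vecs: "0 \<in> vecs M"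
  using subspace_vecs by (rule fvs.subspace_0)

lemma add_vecs: "v \<in> vecs M \<Longrightarrow> w \<in> vecs M \<Longrightarrow> v + w \<in> vecs M"
  using subspace_vecs by (rule fvs.subspace_add)

lemma diff_vecs: "v \<in> vecs M \<Longrightarrow> w \<in> vecs M \<Longrightarrow> v - w \<in> vecs M"
  using subspace_vecs by (rule fvs.subspace_diff)

lemma scale_vecs: "v \<in> vecs M \<Longrightarrow> fscale c v \<in> vecs M"
  using subspace_vecs by (rule fvs.subspace_scale)

lemma sum_vecs: "(\<And>i. i \<in> I \<Longrightarrow> F i \<in> vecs M) \<Longrightarrow> (\<Sum>i\<in>I. F i) \<in> vecs M"
  using subspace_vecs by (rule fvs.subspace_sum)

lemma hom_sum:
  assumes "gmod_hom H M N \<phi>" "\<And>i. i \<in> I \<Longrightarrow> F i \<in> vecs M"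
  shows "\<phi> (\<Sum>i\<in>I. F i) = (\<Sum>i\<in>I. \<phi> (F i))"
  using assms(2)
proof (induction I rule: infinite_finite_induct)
  case (insert x I)
  then have "F x \<in> vecs M" "sum F I \<in> vecs M" by (auto intro: sum_vecs)
  then have "\<phi> (F x + sum F I) = \<phi> (F x) + \<phi> (sum F I)" by (rule gmod_homD(2)[OF assms(1)])
  moreover have "\<phi> (sum F I) = (\<Sum>i\<in>I. \<phi> (F i))" using insert by simp
  moreover note sum.insert[OF insert.hyps, of F] sum.insert[OF insert.hyps, of "\<lambda>i. \<phi> (F i)"]
  ultimately show ?case by (simp only:)
qed (simp_all add: gmod_hom_zero[OF assms(1) zero_vecs])

lemma hom_diff:
  assumes "gmod_hom H M N \<phi>" "v \<in> vecs M" "w \<in> vecs M"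
  shows "\<phi> (v - w) = \<phi> v - \<phi> w"
  using gmod_homD(2)[OF assms(1) diff_vecs[OF assms(2,3)] assms(3)] by simp

text \<open>Over the empty carrier the equivariance condition is void, so \<open>gmod_hom\<close>
  reduces to linearity and the lemmas on homomorphisms apply to the action of a single
  element.\<close>

lemma hom_act:
  assumes "g \<in> carrier G"
  shows "gmod_hom (G\<lparr>carrier := {}\<rparr>) M M (act M g)"
  by (rule gmod_homI) (simp_all add: assms act_closed act_add act_scale)

lemmas act_sum = hom_sum[OF hom_act]
lemmas act_diff = hom_diff[OF hom_act]

lemma act_zero: "g \<in> carrier G \<Longrightarrow> act M g 0 = 0"
  by (rule gmod_hom_zero[OF hom_act zero_vecs])

lemma act_inv_act:
  assumes "g \<in> carrier G" "v \<in> vecs M"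
  shows "act M (inv g) (act M g v) = v" "act M g (act M (inv g) v) = v"
  using assms by (simp_all add: act_mult[symmetric] act_one)

lemma direct_sum_projection:
  assumes "is_direct_sum G M A B"
  obtains \<pi> where "gmod_hom G M M \<pi>" "\<And>v. v \<in> vecs M \<Longrightarrow> \<pi> v \<in> A" "\<And>v. v \<in> vecs M \<Longrightarrow> v - \<pi> v \<in> B"
    "\<And>v. v \<in> A \<Longrightarrow> \<pi> v = v" "\<And>v. v \<in> B \<Longrightarrow> \<pi> v = 0"
proof -
  have A: "fvs.subspace A" "A \<subseteq> vecs M" "\<And>g w. g \<in> carrier G \<Longrightarrow> w \<in> A \<Longrightarrow> act M g w \<in> A"
    and B: "fvs.subspace B" "B \<subseteq> vecs M" "\<And>g w. g \<in> carrier G \<Longrightarrow> w \<in> B \<Longrightarrow> act M g w \<in> B"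
    and AB: "A \<inter> B = {0}" "vecs M = {a + b | a b. a \<in> A \<and> b \<in> B}"
    using assms by (auto simp: is_direct_sum_def submodule_def)
  have uniq: "a = a'" if "a \<in> A" "a' \<in> A" "v - a \<in> B" "v - a' \<in> B" for a a' v
  proof -
    have "a - a' \<in> A" using that A(1) by (simp add: fvs.subspace_diff)
    moreover have "(v - a') - (v - a) \<in> B" using fvs.subspace_diff[OF B(1) that(4,3)] .
    moreover have "(v - a') - (v - a) = a - a'" by simp
    ultimately have "a - a' \<in> A \<inter> B" by auto
    then show ?thesis using AB(1) by simp
  qed
  have ex: "\<exists>a. a \<in> A \<and> v - a \<in> B" if "v \<in> vecs M" for v
  proof -
    have "v \<in> {a + b | a b. a \<in> A \<and> b \<in> B}" using that by (simp only: AB(2))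
    then obtain a b where "a \<in> A" "b \<in> B" "v = a + b" by blast
    then show ?thesis by (intro exI[of _ a]) simp
  qed
  define \<pi> where "\<pi> v = (SOME a. a \<in> A \<and> v - a \<in> B)" for v
  have \<pi>: "\<pi> v \<in> A" "v - \<pi> v \<in> B" if "v \<in> vecs M" for v
    using someI_ex[OF ex[OF that]] by (simp_all add: \<pi>_def)
  have \<pi>_eq: "\<pi> v = a" if "a \<in> A" "v - a \<in> B" "v \<in> vecs M" for v a
    using uniq[OF \<pi>(1) that(1) \<pi>(2) that(2)] that(3) by blast
  have "gmod_hom G M M \<pi>"
  proof (rule gmod_homI)
    fix v w assume v: "v \<in> vecs M" and w: "w \<in> vecs M"
    show "\<pi> (v + w) = \<pi> v + \<pi> w"
    proof (rule \<pi>_eq)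
      have "v + w - (\<pi> v + \<pi> w) = (v - \<pi> v) + (w - \<pi> w)" by simp
      also have "\<dots> \<in> B" using \<pi>(2)[OF v] \<pi>(2)[OF w] B(1) by (intro fvs.subspace_add)
      finally show "v + w - (\<pi> v + \<pi> w) \<in> B" .
    qed (use v w \<pi>(1) A(1) add_vecs in \<open>auto intro: fvs.subspace_add\<close>)
  next
    fix c v assume v: "v \<in> vecs M"
    show "\<pi> (fscale c v) = fscale c (\<pi> v)"
    proof (rule \<pi>_eq)
      have "fscale c v - fscale c (\<pi> v) = fscale c (v - \<pi> v)"
        by (simp add: fvs.scale_right_diff_distrib)
      also have "\<dots> \<in> B" using \<pi>(2)[OF v] B(1) by (intro fvs.subspace_scale)
      finally show "fscale c v - fscale c (\<pi> v) \<in> B" .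
    qed (use v \<pi>(1) A(1) scale_vecs in \<open>auto intro: fvs.subspace_scale\<close>)
  next
    fix g v assume g: "g \<in> carrier G" and v: "v \<in> vecs M"
    show "\<pi> (act M g v) = act M g (\<pi> v)"
    proof (rule \<pi>_eq)
      have "act M g v - act M g (\<pi> v) = act M g (v - \<pi> v)"
        using g v \<pi>(1)[OF v] A(2) by (simp add: act_diff subset_iff)
      also have "\<dots> \<in> B" using \<pi>(2)[OF v] B(3) g by simp
      finally show "act M g v - act M g (\<pi> v) \<in> B" .
    qed (use g v \<pi>(1) A(3) act_closed in auto)
  qed (use \<pi>(1) A(2) in auto)
  moreover have "\<pi> v = v" if "v \<in> A" for v
    by (rule \<pi>_eq) (use that A(2) B(1) in \<open>auto simp: fvs.subspace_0\<close>)
  moreover have "\<pi> v = 0" if "v \<in> B" for v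
    by (rule \<pi>_eq) (use that A(1) B(2) in \<open>auto simp: fvs.subspace_0\<close>)
  ultimately show ?thesis using that \<pi> by blast
qed

text \<open>The projection onto \<open>A\<close> along \<open>B\<close> is an endomorphism, hence a
  scalar. It is the identity on \<open>A\<close> and zero on \<open>B\<close>, so \<open>A\<close>
  vanishes if the scalar is zero and \<open>B\<close> vanishes otherwise.\<close>

lemma scalar_endomorphisms_indecomposable:
  assumes "scalar_endomorphisms G M" "vecs M \<noteq> {0}"
  shows "indecomposable_module G M"
  unfolding indecomposable_module_def
proof (intro conjI allI impI)
  fix A B assume AB: "is_direct_sum G M A B"
  obtain \<pi> where \<pi>: "gmod_hom G M M \<pi>" "\<And>v. v \<in> A \<Longrightarrow> \<pi> v = v" "\<And>v. v \<in> B \<Longrightarrow> \<pi> v = 0"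
    using direct_sum_projection[OF AB] by metis
  obtain c where c: "\<And>v. v \<in> vecs M \<Longrightarrow> \<pi> v = fscale c v"
    using assms(1) \<pi>(1) unfolding scalar_endomorphisms_def by blast
  have sub: "A \<subseteq> vecs M" "B \<subseteq> vecs M" "0 \<in> A" "0 \<in> B"
    using AB by (auto simp: is_direct_sum_def submodule_def fvs.subspace_0)
  show "A = {0} \<or> B = {0}"
  proof (cases "c = 0")
    case True
    then have "v = 0" if "v \<in> A" for v
      using that \<pi>(2) c[of v] sub(1) by (simp add: subset_iff)
    then show ?thesis using sub by blast
  next
    case False
    then have "v = 0" if "v \<in> B" for v
      using that \<pi>(3) c[of v] sub(2) by (simp add: subset_iff)
    then show ?thesis using sub by blast
  qed
qed (use assms fg_module_axioms in auto)

text \<open>Replaces summands by split homomorphisms, so that only maps have to be constructed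
  later. From a summand, \<open>\<psi>\<close> is the projection followed by the inverse of the
  isomorphism; conversely the kernel of \<open>\<psi>\<close> is a complement of the image of
  \<open>\<phi>\<close>.\<close>

lemma iso_to_direct_summand_iff:
  assumes N: "fg_module G N"
  shows "iso_to_direct_summand G M N \<longleftrightarrow>
    (\<exists>\<phi> \<psi>. gmod_hom G M N \<phi> \<and> gmod_hom G N M \<psi> \<and> (\<forall>v\<in>vecs M. \<psi> (\<phi> v) = v))"
proof
  interpret N: fg_module G N by (rule N)
  assume "iso_to_direct_summand G M N"
  then obtain A B \<phi> where AB: "is_direct_sum G N A B" and bij: "bij_betw \<phi> (vecs M) A"
    and \<phi>: "\<And>v w. v\<in>vecs M \<Longrightarrow> w\<in>vecs M \<Longrightarrow> \<phi> (v + w) = \<phi> v + \<phi> w"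
    "\<And>c v. v\<in>vecs M \<Longrightarrow> \<phi> (fscale c v) = fscale c (\<phi> v)"
    "\<And>g v. g\<in>carrier G \<Longrightarrow> v\<in>vecs M \<Longrightarrow> \<phi> (act M g v) = act N g (\<phi> v)"
    by (auto simp: iso_to_direct_summand_def gmod_iso_def)
  obtain \<pi> where \<pi>: "gmod_hom G N N \<pi>" "\<And>v. v \<in> vecs N \<Longrightarrow> \<pi> v \<in> A" "\<And>v. v \<in> A \<Longrightarrow> \<pi> v = v"
    using N.direct_sum_projection[OF AB] by metis
  have sub: "A \<subseteq> vecs N" using AB unfolding is_direct_sum_def submodule_def by blast
  have h\<phi>: "gmod_hom G M N \<phi>"
  proof (rule gmod_homI)
    show "\<phi> v \<in> vecs N" if "v \<in> vecs M" for v using bij_betwE[OF bij] that sub by blast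
  qed (simp_all add: \<phi>)
  define \<psi> where "\<psi> v = inv_into (vecs M) \<phi> (\<pi> v)" for v
  have \<psi>: "\<psi> v \<in> vecs M" "\<phi> (\<psi> v) = \<pi> v" if "v \<in> vecs N" for v
  proof -
    have "\<pi> v \<in> \<phi> ` vecs M" using \<pi>(2)[OF that] bij by (simp add: bij_betw_def)
    then show "\<psi> v \<in> vecs M" "\<phi> (\<psi> v) = \<pi> v"
      by (simp_all add: \<psi>_def inv_into_into f_inv_into_f)
  qed
  have inj: "v = w" if "\<phi> v = \<phi> w" "v \<in> vecs M" "w \<in> vecs M" for v w
    using that bij by (meson bij_betw_def inj_onD)
  have "gmod_hom G N M \<psi>"
    by (rule gmod_homI; (rule inj)?)
      (simp_all add: \<psi> \<phi> gmod_homD[OF \<pi>(1)] N.add_vecs N.scale_vecs N.act_closed add_vecs scale_vecs act_closed)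
  moreover have "\<psi> (\<phi> v) = v" if "v \<in> vecs M" for v
  proof (rule inj)
    have "\<phi> v \<in> A" using bij that by (auto dest: bij_betwE)
    then show "\<phi> (\<psi> (\<phi> v)) = \<phi> v" using \<psi>(2) sub \<pi>(3) by auto
  qed (use that \<psi>(1) gmod_homD(1)[OF h\<phi>] in auto)
  ultimately show "\<exists>\<phi> \<psi>. gmod_hom G M N \<phi> \<and> gmod_hom G N M \<psi> \<and> (\<forall>v\<in>vecs M. \<psi> (\<phi> v) = v)"
    using h\<phi> by blast
next
  interpret N: fg_module G N by (rule N)
  assume "\<exists>\<phi> \<psi>. gmod_hom G M N \<phi> \<and> gmod_hom G N M \<psi> \<and> (\<forall>v\<in>vecs M. \<psi> (\<phi> v) = v)"
  then obtain \<phi> \<psi> where \<phi>: "gmod_hom G M N \<phi>" and \<psi>: "gmod_hom G N M \<psi>"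
    and inv: "\<And>v. v\<in>vecs M \<Longrightarrow> \<psi> (\<phi> v) = v" by blast
  note \<phi>D = gmod_homD[OF \<phi>] and \<psi>D = gmod_homD[OF \<psi>]
  let ?A = "\<phi> ` vecs M" and ?B = "{v \<in> vecs N. \<psi> v = 0}"
  have "fvs.subspace ?A"
  proof (rule fvs.subspaceI)
    show "0 \<in> ?A" using gmod_hom_zero[OF \<phi> zero_vecs] zero_vecs by (metis imageI)
    show "x + y \<in> ?A" if "x \<in> ?A" "y \<in> ?A" for x y
      using that by (auto simp: \<phi>D(2)[symmetric] add_vecs)
    show "fscale c x \<in> ?A" if "x \<in> ?A" for c x
      using that by (auto simp: \<phi>D(3)[symmetric] scale_vecs)
  qed
  then have "submodule G N ?A"
    by (auto simp: submodule_def \<phi>D(1) \<phi>D(4)[symmetric] act_closed)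
  moreover have "fvs.subspace ?B"
    by (rule fvs.subspaceI)
      (auto simp: gmod_hom_zero[OF \<psi> N.zero_vecs] N.zero_vecs N.add_vecs N.scale_vecs \<psi>D(2,3))
  then have "submodule G N ?B"
    by (auto simp: submodule_def N.act_closed \<psi>D(4) act_zero)
  moreover have "?A \<inter> ?B = {0}"
  proof
    show "?A \<inter> ?B \<subseteq> {0}"
    proof
    fix x assume "x \<in> ?A \<inter> ?B"
    then obtain v where v: "v \<in> vecs M" "x = \<phi> v" "\<psi> x = 0" by blast
    then have "v = 0" using inv by simp
    then show "x \<in> {0}" using v(2) gmod_hom_zero[OF \<phi> zero_vecs] by simp
    qed
    have "\<phi> 0 \<in> ?A" using zero_vecs by blast
    then show "{0} \<subseteq> ?A \<inter> ?B"
      using gmod_hom_zero[OF \<phi> zero_vecs] gmod_hom_zero[OF \<psi> N.zero_vecs] N.zero_vecs by simp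
  qed
  moreover have "vecs N = {a + b | a b. a \<in> ?A \<and> b \<in> ?B}"
  proof
    show "vecs N \<subseteq> {a + b | a b. a \<in> ?A \<and> b \<in> ?B}"
    proof
      fix v assume v: "v \<in> vecs N"
      have "v - \<phi> (\<psi> v) \<in> ?B"
        using v by (simp add: \<phi>D(1) \<psi>D(1) N.diff_vecs N.hom_diff[OF \<psi>] inv)
      moreover have "\<phi> (\<psi> v) \<in> ?A" using v \<psi>D(1) by blast
      moreover have "v = \<phi> (\<psi> v) + (v - \<phi> (\<psi> v))" by simp
      ultimately show "v \<in> {a + b | a b. a \<in> ?A \<and> b \<in> ?B}" by blast
    qed
  qed (use \<phi>D(1) N.add_vecs in auto)
  ultimately have "is_direct_sum G N ?A ?B" by (simp add: is_direct_sum_def)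
  moreover have "gmod_iso G M (N\<lparr>vecs := ?A\<rparr>)"
    unfolding gmod_iso_def
    by (intro exI[of _ \<phi>]) (auto simp: bij_betw_def \<phi>D intro!: inj_on_inverseI[of _ \<psi>] inv)
  ultimately show "iso_to_direct_summand G M N" unfolding iso_to_direct_summand_def by blast
qed

end

section \<open>Sums over cosets and Frobenius reciprocity\<close>

definition left_cosets :: "('g, 'x) monoid_scheme \<Rightarrow> 'g set \<Rightarrow> 'g set set" where
  "left_cosets G Q = (\<lambda>g. g <#\<^bsub>G\<^esub> Q) ` carrier G"

definition coset_rep :: "'g set \<Rightarrow> 'g" where
  "coset_rep c = (SOME g. g \<in> c)"

text \<open>The representatives are chosen arbitrarily; the value is independent of the choice when
  \<open>F\<close> is constant on left cosets. Relative traces are sums of this form.\<close>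

definition coset_sum :: "('g, 'x) monoid_scheme \<Rightarrow> 'g set \<Rightarrow> ('g \<Rightarrow> 'a::comm_monoid_add) \<Rightarrow> 'a" where
  "coset_sum G Q F = (\<Sum>c\<in>left_cosets G Q. F (coset_rep c))"

lemma coset_sum_add: "coset_sum G Q (\<lambda>g. F g + F' g) = coset_sum G Q F + coset_sum G Q F'"
  unfolding coset_sum_def by (rule sum.distrib)

lemma coset_sum_fscale: "coset_sum G Q (\<lambda>g. fscale c (F g)) = fscale c (coset_sum G Q F)"
  unfolding coset_sum_def by (rule fvs.scale_sum_right[symmetric])

context group begin

lemma coset_rep:
  assumes "subgroup Q G" "c \<in> left_cosets G Q"
  shows "coset_rep c \<in> carrier G" "coset_rep c <#\<^bsub>G\<^esub> Q = c"
proof -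
  obtain g where g: "g \<in> carrier G" "c = g <#\<^bsub>G\<^esub> Q" using assms(2) by (auto simp: left_cosets_def)
  have "\<one> \<in> Q" using assms(1) by (rule subgroup.one_closed)
  then have "g \<otimes> \<one> \<in> c" unfolding g(2) l_coset_def by blast
  then have r: "coset_rep c \<in> g <#\<^bsub>G\<^esub> Q" unfolding coset_rep_def g(2) by (rule someI)
  then obtain q where "q \<in> Q" "coset_rep c = g \<otimes> q" unfolding l_coset_def by blast
  then show "coset_rep c \<in> carrier G" using g(1) subgroup.mem_carrier[OF assms(1)] by simp
  show "coset_rep c <#\<^bsub>G\<^esub> Q = c" using l_repr_independence[OF r g(1) assms(1)] g(2) by simp
qed

lemma l_coset_eq_iff:
  assumes "subgroup Q G" "x \<in> carrier G" "y \<in> carrier G"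
  shows "x <#\<^bsub>G\<^esub> Q = y <#\<^bsub>G\<^esub> Q \<longleftrightarrow> inv x \<otimes> y \<in> Q"
proof
  assume "x <#\<^bsub>G\<^esub> Q = y <#\<^bsub>G\<^esub> Q"
  moreover have "y \<otimes> \<one> \<in> y <#\<^bsub>G\<^esub> Q" using subgroup.one_closed[OF assms(1)] unfolding l_coset_def by blast
  ultimately obtain q where q: "q \<in> Q" "y = x \<otimes> q" using assms unfolding l_coset_def by auto
  then show "inv x \<otimes> y \<in> Q"
    using assms(2) subgroup.mem_carrier[OF assms(1)] by (simp add: m_assoc[symmetric])
next
  assume q: "inv x \<otimes> y \<in> Q"
  have "x \<otimes> (inv x \<otimes> y) \<in> x <#\<^bsub>G\<^esub> Q" using q unfolding l_coset_def by blast
  then have "y \<in> x <#\<^bsub>G\<^esub> Q" using assms by (simp add: m_assoc[symmetric])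
  then show "x <#\<^bsub>G\<^esub> Q = y <#\<^bsub>G\<^esub> Q" using assms by (intro l_repr_independence)
qed

text \<open>The chosen representative of the coset of \<open>g\<close> is
  \<open>g \<otimes> q\<close> for some \<open>q\<close> in \<open>Q\<close>, so right invariance of
  \<open>F\<close> removes the choice.\<close>

lemma coset_rep_l_coset:
  assumes "subgroup Q G" "g \<in> carrier G" "\<And>g q. g \<in> carrier G \<Longrightarrow> q \<in> Q \<Longrightarrow> F (g \<otimes> q) = F g"
  shows "F (coset_rep (g <#\<^bsub>G\<^esub> Q)) = F g"
proof -
  have c: "g <#\<^bsub>G\<^esub> Q \<in> left_cosets G Q" using assms(2) by (auto simp: left_cosets_def)
  note r = coset_rep[OF assms(1) c]
  have q: "inv g \<otimes> coset_rep (g <#\<^bsub>G\<^esub> Q) \<in> Q"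
    using l_coset_eq_iff[OF assms(1,2) r(1)] r(2) by simp
  have "g \<otimes> (inv g \<otimes> coset_rep (g <#\<^bsub>G\<^esub> Q)) = coset_rep (g <#\<^bsub>G\<^esub> Q)"
    using assms(2) r(1) by (simp add: m_assoc[symmetric])
  then show ?thesis using assms(3)[OF assms(2) q] by simp
qed

lemma coset_sum_cong:
  assumes "subgroup Q G" "\<And>g. g \<in> carrier G \<Longrightarrow> F g = F' g"
  shows "coset_sum G Q F = coset_sum G Q F'"
  unfolding coset_sum_def by (intro sum.cong refl assms(2) coset_rep(1)[OF assms(1)])

text \<open>Left multiplication by \<open>x\<close> permutes the left cosets; this is what makes a
  relative trace commute with the group.\<close>

lemma coset_sum_translate:
  assumes Q: "subgroup Q G" and x: "x \<in> carrier G"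
    and F: "\<And>g q. g \<in> carrier G \<Longrightarrow> q \<in> Q \<Longrightarrow> F (g \<otimes> q) = F g"
  shows "coset_sum G Q (\<lambda>g. F (x \<otimes> g)) = coset_sum G Q F"
proof -
  have QG: "Q \<subseteq> carrier G" using Q by (rule subgroup.subset)
  have cl: "y <#\<^bsub>G\<^esub> c \<in> left_cosets G Q" if "c \<in> left_cosets G Q" "y \<in> carrier G" for c y
    using that QG by (auto simp: left_cosets_def lcos_m_assoc)
  have sub: "c \<subseteq> carrier G" if "c \<in> left_cosets G Q" for c
    using that QG by (auto simp: left_cosets_def l_coset_def)
  have bij: "bij_betw (\<lambda>c. x <#\<^bsub>G\<^esub> c) (left_cosets G Q) (left_cosets G Q)"
    by (rule bij_betw_byWitness[where f' = "\<lambda>c. inv x <#\<^bsub>G\<^esub> c"])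
      (use x cl sub in \<open>auto simp: lcos_m_assoc lcos_mult_one\<close>)
  have "F (x \<otimes> coset_rep c) = F (coset_rep (x <#\<^bsub>G\<^esub> c))" if "c \<in> left_cosets G Q" for c
  proof -
    note r = coset_rep[OF Q that]
    have "(x \<otimes> coset_rep c) <#\<^bsub>G\<^esub> Q = x <#\<^bsub>G\<^esub> c" using r x QG by (metis lcos_m_assoc)
    then show ?thesis using coset_rep_l_coset[OF Q _ F, of "x \<otimes> coset_rep c"] x r(1) by simp
  qed
  then have "coset_sum G Q (\<lambda>g. F (x \<otimes> g)) = (\<Sum>c\<in>left_cosets G Q. F (coset_rep (x <#\<^bsub>G\<^esub> c)))"
    by (simp add: coset_sum_def)
  also have "\<dots> = coset_sum G Q F"
    unfolding coset_sum_def by (rule sum.reindex_bij_betw[OF bij])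
  finally show ?thesis .
qed

end

context fg_module begin

lemma coset_sum_vecs:
  assumes "subgroup Q G" "\<And>g. g \<in> carrier G \<Longrightarrow> F g \<in> vecs M"
  shows "coset_sum G Q F \<in> vecs M"
  unfolding coset_sum_def by (intro sum_vecs assms(2) coset_rep(1)[OF assms(1)])

lemma act_coset_sum:
  assumes "subgroup Q G" "x \<in> carrier G" "\<And>g. g \<in> carrier G \<Longrightarrow> F g \<in> vecs M"
  shows "act M x (coset_sum G Q F) = coset_sum G Q (\<lambda>g. act M x (F g))"
  unfolding coset_sum_def by (intro act_sum assms coset_rep(1)[OF assms(1)])

end

lemma curry_add: "curry (f + f') g = curry f g + curry f' g"
  by (simp add: fun_eq_iff)

lemma curry_fscale: "curry (fscale c f) g = fscale c (curry f g)"
  by (simp add: fun_eq_iff fscale_def)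

context fg_module begin

text \<open>Both adjunctions made explicit: a map into the induced module is determined by its value
  at \<open>\<one>\<close>, which gives \<open>\<alpha>\<close>, and a map out of it by its
  restriction to the tensors \<open>1 \<otimes> u\<close>, which gives
  \<open>\<beta>\<close>.\<close>

lemma frobenius_summand_imp:
  fixes U :: "('g, 'j, 'k) gmod"
  assumes Q: "subgroup Q G" and U: "fg_module (G\<lparr>carrier := Q\<rparr>) U"
    and iso: "iso_to_direct_summand G M (induced_module G Q U)"
  obtains \<alpha> \<beta> where "gmod_hom (G\<lparr>carrier := Q\<rparr>) M U \<alpha>" "gmod_hom (G\<lparr>carrier := Q\<rparr>) U M \<beta>"
    "\<And>v. v \<in> vecs M \<Longrightarrow> coset_sum G Q (\<lambda>g. act M g (\<beta> (\<alpha> (act M (inv g) v)))) = v"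
proof -
  interpret U: fg_module "G\<lparr>carrier := Q\<rparr>" U by (rule U)
  interpret Q: subgroup Q G by (rule Q)
  define N where "N = induced_module G Q U"
  have N: "fg_module G N" unfolding N_def using is_group finite_group Q U by (rule fg_module_induced)
  interpret N: fg_module G N by (rule N)
  obtain \<phi> \<psi> where \<phi>: "gmod_hom G M N \<phi>" and \<psi>: "gmod_hom G N M \<psi>"
    and inv: "\<And>v. v\<in>vecs M \<Longrightarrow> \<psi> (\<phi> v) = v"
    using iso unfolding N_def[symmetric] iso_to_direct_summand_iff[OF N] by blast
  note \<phi>D = gmod_homD[OF \<phi>] and \<psi>D = gmod_homD[OF \<psi>]
  have vN: "curry f g = 0" if "f \<in> vecs N" "g \<notin> carrier G" for f g
    using that by (simp add: N_def induced_module_def)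
  have vN1: "curry f g \<in> vecs U" if "f \<in> vecs N" "g \<in> carrier G" for f g
    using that by (simp add: N_def induced_module_def)
  have vN2: "curry f (g \<otimes> h) = act U (inv h) (curry f g)" if "f \<in> vecs N" "g \<in> carrier G" "h \<in> Q" for f g h
    using that by (simp add: N_def induced_module_def)
  have aN: "curry (act N x f) g = (if g \<in> carrier G then curry f (inv x \<otimes> g) else 0)" for x f g
    by (simp add: N_def induced_module_def fun_eq_iff)
  have invQ: "inv\<^bsub>G\<lparr>carrier := Q\<rparr>\<^esub> h = inv h" if "h \<in> Q" for h
    using Q that by (rule m_inv_consistent)
  note Usimps = U.act_closed[simplified] U.act_add[simplified] U.act_scale[simplified]
    U.act_one[simplified] U.act_mult[simplified]
  \<comment> \<open>The embedding \<open>u \<mapsto> 1 \<otimes> u\<close>, whose values are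
    functions supported on the coset \<open>Q\<close>.\<close>
  define \<iota> where "\<iota> u = (\<lambda>(g, i). if g \<in> Q then act U (inv g) u i else 0)" for u :: "'j \<Rightarrow> 'k"
  have c\<iota>: "curry (\<iota> u) g = (if g \<in> Q then act U (inv g) u else 0)" for u g
    by (simp add: \<iota>_def fun_eq_iff)
  have eqI: "f = f'" if "\<And>g. curry f g = curry f' g" for f f' :: "'g \<times> 'j \<Rightarrow> 'k"
    using that by (auto simp: fun_eq_iff)
  have mQ: "g \<otimes> h \<in> Q \<longleftrightarrow> g \<in> Q" if "g \<in> carrier G" "h \<in> Q" for g h
  proof
    assume "g \<otimes> h \<in> Q"
    then have "g \<otimes> h \<otimes> inv h \<in> Q" using that by simp
    then show "g \<in> Q" using that by (simp add: m_assoc)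
  qed (use that in simp)
  have mQ': "h \<otimes> g \<in> Q \<longleftrightarrow> g \<in> Q" if "g \<in> carrier G" "h \<in> Q" for g h
  proof
    assume "h \<otimes> g \<in> Q"
    then have "inv h \<otimes> (h \<otimes> g) \<in> Q" using that by simp
    then show "g \<in> Q" using that by (simp add: m_assoc[symmetric])
  qed (use that in simp)
  have \<iota>: "gmod_hom (G\<lparr>carrier := Q\<rparr>) U N \<iota>"
  proof (rule gmod_homI)
    fix u assume u: "u \<in> vecs U"
    have "curry (\<iota> u) (g \<otimes> h) = act U (inv h) (curry (\<iota> u) g)" if "g \<in> carrier G" "h \<in> Q" for g h
      using that u U.act_zero[simplified] by (simp add: c\<iota> mQ inv_mult_group Usimps)
    then show "\<iota> u \<in> vecs N"
      using u by (auto simp: N_def induced_module_def c\<iota> Usimps U.zero_vecs)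
  next
    fix g u assume g: "g \<in> carrier (G\<lparr>carrier := Q\<rparr>)" and u: "u \<in> vecs U"
    show "\<iota> (act U g u) = act N g (\<iota> u)"
    proof (rule eqI)
      fix x show "curry (\<iota> (act U g u)) x = curry (act N g (\<iota> u)) x"
        using g u by (auto simp: c\<iota> aN mQ' inv_mult_group Usimps)
    qed
  qed (rule eqI; simp add: c\<iota> Usimps curry_add curry_fscale)+
  define \<alpha> where "\<alpha> v = curry (\<phi> v) \<one>" for v
  define \<beta> where "\<beta> u = \<psi> (\<iota> u)" for u
  have \<alpha>: "gmod_hom (G\<lparr>carrier := Q\<rparr>) M U \<alpha>"
  proof (rule gmod_homI)
    fix g v assume g: "g \<in> carrier (G\<lparr>carrier := Q\<rparr>)" and v: "v \<in> vecs M"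
    then have gQ: "g \<in> Q" by simp
    have "\<alpha> (act M g v) = curry (\<phi> v) (\<one> \<otimes> inv g)"
      using gQ v by (simp add: \<alpha>_def \<phi>D(4) aN)
    also have "\<dots> = act U (inv (inv g)) (\<alpha> v)"
      unfolding \<alpha>_def using gQ v \<phi>D(1) by (intro vN2) simp_all
    finally show "\<alpha> (act M g v) = act U g (\<alpha> v)" using gQ by simp
  qed (simp_all add: \<alpha>_def vN1 \<phi>D curry_add curry_fscale)
  have \<beta>: "gmod_hom (G\<lparr>carrier := Q\<rparr>) U M \<beta>"
    unfolding \<beta>_def
    by (rule gmod_hom_comp[OF \<iota> gmod_hom_carrier_mono[OF \<psi> Q.subset]])
  \<comment> \<open>The term of a coset is the restriction of \<open>f\<close> to that coset, so the
    sum reassembles \<open>f\<close>. Applying \<open>\<psi>\<close> to this expansion of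
    \<open>\<phi> v\<close> gives the trace formula.\<close>
  have expand: "f = coset_sum G Q (\<lambda>g. act N g (\<iota> (curry f g)))" if f: "f \<in> vecs N" for f
  proof (rule eqI)
    fix x
    have fin: "finite (left_cosets G Q)" using finite_group by (simp add: left_cosets_def)
    have s: "curry (coset_sum G Q (\<lambda>g. act N g (\<iota> (curry f g)))) x
        = (\<Sum>c\<in>left_cosets G Q. curry (act N (coset_rep c) (\<iota> (curry f (coset_rep c)))) x)"
      by (simp add: coset_sum_def fun_eq_iff sum_apply_fun)
    show "curry f x = curry (coset_sum G Q (\<lambda>g. act N g (\<iota> (curry f g)))) x"
    proof (cases "x \<in> carrier G")
      case True
      have "curry (act N (coset_rep c) (\<iota> (curry f (coset_rep c)))) x
          = (if c = x <#\<^bsub>G\<^esub> Q then curry f x else 0)" if c: "c \<in> left_cosets G Q" for c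
      proof -
        note r = coset_rep[OF Q c]
        let ?g = "coset_rep c"
        have iff: "c = x <#\<^bsub>G\<^esub> Q \<longleftrightarrow> inv ?g \<otimes> x \<in> Q"
          using l_coset_eq_iff[OF Q r(1) True] r(2) by simp
        have "act U (inv (inv ?g \<otimes> x)) (curry f ?g) = curry f x" if "inv ?g \<otimes> x \<in> Q"
          using vN2[OF f r(1) that] r(1) True by (simp add: m_assoc[symmetric])
        then show ?thesis using True by (simp add: aN c\<iota> iff)
      qed
      moreover have "x <#\<^bsub>G\<^esub> Q \<in> left_cosets G Q" using True by (auto simp: left_cosets_def)
      ultimately show ?thesis unfolding s using fin by simp
    next
      case False
      then show ?thesis unfolding s using vN[OF f False] by (simp add: aN)
    qed
  qed
  have "coset_sum G Q (\<lambda>g. act M g (\<beta> (\<alpha> (act M (inv g) v)))) = v" if v: "v \<in> vecs M" for v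
  proof -
    have r: "coset_rep c \<in> carrier G" if "c \<in> left_cosets G Q" for c using coset_rep(1)[OF Q that] .
    have \<alpha>v: "\<alpha> (act M (inv g) v) = curry (\<phi> v) g" if "g \<in> carrier G" for g
      using that v by (simp add: \<alpha>_def \<phi>D(4) aN)
    have "v = \<psi> (coset_sum G Q (\<lambda>g. act N g (\<iota> (curry (\<phi> v) g))))"
      using inv[OF v] expand[OF \<phi>D(1)[OF v]] by simp
    also have "\<dots> = (\<Sum>c\<in>left_cosets G Q. \<psi> (act N (coset_rep c) (\<iota> (curry (\<phi> v) (coset_rep c)))))"
      unfolding coset_sum_def
      by (rule N.hom_sum[OF \<psi>]) (intro N.act_closed r gmod_homD(1)[OF \<iota>] vN1 \<phi>D(1) v)
    also have "\<dots> = coset_sum G Q (\<lambda>g. act M g (\<beta> (\<alpha> (act M (inv g) v))))"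
      unfolding coset_sum_def
    proof (rule sum.cong[OF refl])
      fix c assume c: "c \<in> left_cosets G Q"
      show "\<psi> (act N (coset_rep c) (\<iota> (curry (\<phi> v) (coset_rep c))))
        = act M (coset_rep c) (\<beta> (\<alpha> (act M (inv (coset_rep c)) v)))"
        unfolding \<beta>_def \<alpha>v[OF r[OF c]]
        by (intro \<psi>D(4) r c gmod_homD(1)[OF \<iota>] vN1 \<phi>D(1) v)
    qed
    finally show ?thesis by simp
  qed
  then show ?thesis using that \<alpha> \<beta> by blast
qed

text \<open>The maps are the adjoints of \<open>\<alpha>\<close> and \<open>\<beta>\<close>; then
  \<open>\<psi> \<circ> \<phi>\<close> is the relative trace of
  \<open>\<beta> \<circ> \<alpha>\<close>, which is the identity by assumption.\<close>

lemma frobenius_imp_summand: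
  fixes U :: "('g, 'j, 'k) gmod"
  assumes Q: "subgroup Q G" and U: "fg_module (G\<lparr>carrier := Q\<rparr>) U"
    and \<alpha>: "gmod_hom (G\<lparr>carrier := Q\<rparr>) M U \<alpha>" and \<beta>: "gmod_hom (G\<lparr>carrier := Q\<rparr>) U M \<beta>"
    and tr: "\<And>v. v \<in> vecs M \<Longrightarrow> coset_sum G Q (\<lambda>g. act M g (\<beta> (\<alpha> (act M (inv g) v)))) = v"
  shows "iso_to_direct_summand G M (induced_module G Q U)"
proof -
  interpret U: fg_module "G\<lparr>carrier := Q\<rparr>" U by (rule U)
  interpret Q: subgroup Q G by (rule Q)
  define N where "N = induced_module G Q U"
  have N: "fg_module G N" unfolding N_def using is_group finite_group Q U by (rule fg_module_induced)
  interpret N: fg_module G N by (rule N)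
  have vN1: "curry f g \<in> vecs U" if "f \<in> vecs N" "g \<in> carrier G" for f g
    using that by (simp add: N_def induced_module_def)
  have vN2: "curry f (g \<otimes> h) = act U (inv h) (curry f g)" if "f \<in> vecs N" "g \<in> carrier G" "h \<in> Q" for f g h
    using that by (simp add: N_def induced_module_def)
  have aN: "curry (act N x f) g = (if g \<in> carrier G then curry f (inv x \<otimes> g) else 0)" for x f g
    by (simp add: N_def induced_module_def fun_eq_iff)
  have eqI: "f = f'" if "\<And>g. curry f g = curry f' g" for f f' :: "'g \<times> 'j \<Rightarrow> 'k"
    using that by (auto simp: fun_eq_iff)
  note \<alpha>D = gmod_homD[OF \<alpha>, simplified] and \<beta>D = gmod_homD[OF \<beta>, simplified]
  define \<phi> where "\<phi> v = (\<lambda>(g, i). if g \<in> carrier G then \<alpha> (act M (inv g) v) i else 0)" for v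
  have c\<phi>: "curry (\<phi> v) g = (if g \<in> carrier G then \<alpha> (act M (inv g) v) else 0)" for v g
    by (simp add: \<phi>_def fun_eq_iff)
  have \<phi>: "gmod_hom G M N \<phi>"
  proof (rule gmod_homI)
    fix v assume v: "v \<in> vecs M"
    have "\<alpha> (act M (inv (g \<otimes> h)) v) = act U (inv h) (\<alpha> (act M (inv g) v))" if "g \<in> carrier G" "h \<in> Q" for g h
      using that v by (simp add: inv_mult_group act_mult \<alpha>D(4)[symmetric] act_closed)
    then show "\<phi> v \<in> vecs N"
      using v by (auto simp: N_def induced_module_def c\<phi> \<alpha>D(1) act_closed)
  next
    fix g v assume "g \<in> carrier G" "v \<in> vecs M"
    then show "\<phi> (act M g v) = act N g (\<phi> v)"
      by (intro eqI) (simp add: c\<phi> aN inv_mult_group act_mult)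
  qed (rule eqI; simp add: c\<phi> act_add act_scale \<alpha>D act_closed curry_add curry_fscale)+
  define \<psi> where "\<psi> f = coset_sum G Q (\<lambda>g. act M g (\<beta> (curry f g)))" for f
  have r: "coset_rep c \<in> carrier G" if "c \<in> left_cosets G Q" for c using coset_rep(1)[OF Q that] .
  have tm: "act M g (\<beta> (curry f g)) \<in> vecs M" if "f \<in> vecs N" "g \<in> carrier G" for f g
    using that by (intro act_closed \<beta>D(1) vN1)
  have \<psi>: "gmod_hom G N M \<psi>"
  proof (rule gmod_homI)
    fix f assume f: "f \<in> vecs N"
    show "\<psi> f \<in> vecs M"
      unfolding \<psi>_def by (intro coset_sum_vecs[OF Q] tm f)
  next
    fix f f' assume f: "f \<in> vecs N" and f': "f' \<in> vecs N"
    have "act M g (\<beta> (curry (f + f') g)) = act M g (\<beta> (curry f g)) + act M g (\<beta> (curry f' g))"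
      if "g \<in> carrier G" for g
      using that f f' by (simp only: curry_add \<beta>D(2) vN1 act_add \<beta>D(1))
    then show "\<psi> (f + f') = \<psi> f + \<psi> f'"
      unfolding \<psi>_def by (subst coset_sum_add[symmetric], intro coset_sum_cong[OF Q])
  next
    fix c f assume f: "f \<in> vecs N"
    have "act M g (\<beta> (curry (fscale c f) g)) = fscale c (act M g (\<beta> (curry f g)))"
      if "g \<in> carrier G" for g
      using that f by (simp only: curry_fscale \<beta>D(3) vN1 act_scale \<beta>D(1))
    then show "\<psi> (fscale c f) = fscale c (\<psi> f)"
      unfolding \<psi>_def by (subst coset_sum_fscale[symmetric], intro coset_sum_cong[OF Q])
  next
    fix x f assume x: "x \<in> carrier G" and f: "f \<in> vecs N"
    let ?F = "\<lambda>g. act M g (\<beta> (curry f (inv x \<otimes> g)))"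
    \<comment> \<open>The factor \<open>inv q\<close> that \<open>f\<close> picks up at
      \<open>g \<otimes> q\<close> moves through \<open>\<beta>\<close> and cancels against the
      action of \<open>q\<close>.\<close>
    have inv: "?F (g \<otimes> q) = ?F g" if "g \<in> carrier G" "q \<in> Q" for g q
    proof -
      have "curry f (inv x \<otimes> (g \<otimes> q)) = act U (inv q) (curry f (inv x \<otimes> g))"
        using vN2[OF f, of "inv x \<otimes> g" q] x that by (simp add: m_assoc)
      moreover have "curry f (inv x \<otimes> g) \<in> vecs U" using f x that by (intro vN1) simp_all
      ultimately show ?thesis
        using that by (simp add: \<beta>D act_mult act_closed act_inv_act)
    qed
    have "\<psi> (act N x f) = coset_sum G Q ?F"
      unfolding \<psi>_def coset_sum_def by (intro sum.cong refl) (simp add: aN r)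
    also have "\<dots> = coset_sum G Q (\<lambda>g. ?F (x \<otimes> g))"
      by (rule coset_sum_translate[OF Q x inv, symmetric])
    also have "\<dots> = coset_sum G Q (\<lambda>g. act M x (act M g (\<beta> (curry f g))))"
      using x f by (intro coset_sum_cong[OF Q]) (simp add: m_assoc[symmetric] act_mult \<beta>D(1) vN1)
    also have "\<dots> = act M x (\<psi> f)"
      unfolding \<psi>_def by (intro act_coset_sum[symmetric] Q x tm f)
    finally show "\<psi> (act N x f) = act M x (\<psi> f)" .
  qed
  have "\<psi> (\<phi> v) = v" if "v \<in> vecs M" for v
  proof -
    have "\<psi> (\<phi> v) = coset_sum G Q (\<lambda>g. act M g (\<beta> (\<alpha> (act M (inv g) v))))"
      unfolding \<psi>_def coset_sum_def by (intro sum.cong refl) (simp add: c\<phi> r)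
    then show ?thesis using tr[OF that] by simp
  qed
  then show ?thesis
    unfolding N_def[symmetric] iso_to_direct_summand_iff[OF N] using \<phi> \<psi> by blast
qed

end

section \<open>Summands of permutation modules\<close>

locale finite_gset = group G
  for G (structure) +
  fixes Y :: "'y set" and ac :: "'g \<Rightarrow> 'y \<Rightarrow> 'y"
  assumes finite_Y: "finite Y"
    and ac_closed: "g \<in> carrier G \<Longrightarrow> y \<in> Y \<Longrightarrow> ac g y \<in> Y"
    and ac_one: "y \<in> Y \<Longrightarrow> ac \<one> y = y"
    and ac_mult: "g \<in> carrier G \<Longrightarrow> h \<in> carrier G \<Longrightarrow> y \<in> Y \<Longrightarrow> ac (g \<otimes> h) y = ac g (ac h y)"

text \<open>The families encode homomorphisms from the permutation module on \<open>Y\<close> to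
  \<open>M\<close>, by the images of the basis, and from \<open>M\<close> to it, by coordinates.
  \<open>f_ac\<close> is equivariance for the contragredient action on functionals.\<close>

locale equivariant_family = fg_module G M + finite_gset G Y ac
  for G (structure) and M :: "('g, 'i, 'k::field) gmod" and Y :: "'y set" and ac +
  fixes v :: "'y \<Rightarrow> 'i \<Rightarrow> 'k" and f :: "'y \<Rightarrow> ('i \<Rightarrow> 'k) \<Rightarrow> 'k"
  assumes v_closed: "y \<in> Y \<Longrightarrow> v y \<in> vecs M"
    and v_ac: "g \<in> carrier G \<Longrightarrow> y \<in> Y \<Longrightarrow> v (ac g y) = act M g (v y)"
    and f_add: "y \<in> Y \<Longrightarrow> s \<in> vecs M \<Longrightarrow> s' \<in> vecs M \<Longrightarrow> f y (s + s') = f y s + f y s'"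
    and f_scale: "y \<in> Y \<Longrightarrow> s \<in> vecs M \<Longrightarrow> f y (fscale c s) = c * f y s"
    and f_ac: "g \<in> carrier G \<Longrightarrow> y \<in> Y \<Longrightarrow> s \<in> vecs M \<Longrightarrow> f (ac g y) (act M g s) = f y s"

locale permutation_summand = equivariant_family G M Y ac v f
  for G (structure) and M :: "('g, 'i, 'k::field) gmod" and Y :: "'y set" and ac v f +
  assumes resolution: "s \<in> vecs M \<Longrightarrow> (\<Sum>y\<in>Y. fscale (f y s) (v y)) = s"

text \<open>Lives on coordinate 0 of \<open>nat \<Rightarrow> 'k\<close>, since relative
  projectivity only admits modules with coordinates in \<open>nat\<close>.\<close>

definition trivial_gmod :: "('g, nat, 'k::field) gmod" where
  "trivial_gmod = \<lparr>vecs = {u. \<forall>i. i \<noteq> 0 \<longrightarrow> u i = 0}, act = (\<lambda>g u. u)\<rparr>"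

lemma fg_module_trivial_gmod:
  assumes "group G" "finite (carrier G)"
  shows "fg_module G (trivial_gmod :: ('g, nat, 'k::field) gmod)"
proof -
  interpret group G by fact
  let ?U = "trivial_gmod :: ('g, nat, 'k) gmod"
  have sub: "fvs.subspace (vecs ?U)"
    by (auto simp: trivial_gmod_def fvs.subspace_def fscale_def)
  have "vecs ?U \<subseteq> fvs.span {basis_vec 0}"
  proof
    fix u :: "nat \<Rightarrow> 'k" assume "u \<in> vecs ?U"
    then have "u = fscale (u 0) (basis_vec 0)"
      by (auto simp: trivial_gmod_def fscale_def basis_vec_def fun_eq_iff)
    then show "u \<in> fvs.span {basis_vec 0}" by (metis fvs.span_base fvs.span_scale singletonI)
  qed
  then have "\<exists>B. finite B \<and> vecs ?U = fvs.span B"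
    by (intro finite_span_subspace[OF _ sub]) auto
  then show ?thesis using sub assms(2)
    by unfold_locales (simp_all add: trivial_gmod_def)
qed

context finite_gset begin

definition orb :: "'y \<Rightarrow> 'y set" where "orb z = (\<lambda>g. ac g z) ` carrier G"

definition stab :: "'y \<Rightarrow> 'g set" where "stab z = {g \<in> carrier G. ac g z = z}"

lemma orb_self: "z \<in> Y \<Longrightarrow> z \<in> orb z"
  unfolding orb_def using ac_one by (metis image_eqI one_closed)

lemma orb_subset: "z \<in> Y \<Longrightarrow> orb z \<subseteq> Y"
  by (auto simp: orb_def ac_closed)

lemma orb_eq:
  assumes "z \<in> Y" "y \<in> orb z"
  shows "orb y = orb z"
proof -
  obtain h where h: "h \<in> carrier G" "y = ac h z" using assms(2) by (auto simp: orb_def)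
  have "ac g y \<in> orb z" if "g \<in> carrier G" for g
    using h that assms(1) by (auto simp: orb_def ac_mult[symmetric])
  moreover have "ac g z \<in> orb y" if "g \<in> carrier G" for g
  proof -
    have "ac g z = ac (g \<otimes> inv h) y"
      using h that assms(1) by (simp add: ac_mult[symmetric] m_assoc)
    then show ?thesis using h that by (auto simp: orb_def)
  qed
  ultimately show ?thesis by (auto simp: orb_def)
qed

lemma ac_inv:
  assumes "g \<in> carrier G" "y \<in> Y"
  shows "ac (inv g) (ac g y) = y" "ac g (ac (inv g) y) = y"
  using assms by (simp_all add: ac_mult[symmetric] ac_one)

lemma bij_betw_ac_orb:
  assumes "z \<in> Y" "g \<in> carrier G"
  shows "bij_betw (ac g) (orb z) (orb z)"
proof (rule bij_betw_byWitness[where f' = "ac (inv g)"])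
  have "ac g y \<in> orb z" if "y \<in> orb z" "g \<in> carrier G" for g y
    using that assms(1) by (auto simp: orb_def ac_mult[symmetric])
  then show "ac g ` orb z \<subseteq> orb z" "ac (inv g) ` orb z \<subseteq> orb z" using assms(2) by auto
qed (use assms orb_subset[OF assms(1)] in \<open>auto simp: ac_inv\<close>)

lemma stab_subgroup:
  assumes "z \<in> Y"
  shows "subgroup (stab z) G"
proof (rule subgroupI)
  show "stab z \<noteq> {}" using ac_one[OF assms] by (auto simp: stab_def)
  show "inv a \<in> stab z" if "a \<in> stab z" for a
    using that ac_inv(1)[of a z] assms by (auto simp: stab_def)
qed (use assms in \<open>auto simp: stab_def ac_mult\<close>)

text \<open>Orbit-stabiliser correspondence: a trace from a point stabiliser is a sum over the orbit
  of the point.\<close>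

lemma coset_sum_stab:
  assumes z: "z \<in> Y"
  shows "coset_sum G (stab z) (\<lambda>g. F (ac g z)) = (\<Sum>y\<in>orb z. F y)"
proof -
  note sg = stab_subgroup[OF z]
  note r = coset_rep[OF sg]
  have "bij_betw (\<lambda>c. ac (coset_rep c) z) (left_cosets G (stab z)) (orb z)"
  proof (rule bij_betwI')
    fix c c' assume c: "c \<in> left_cosets G (stab z)" "c' \<in> left_cosets G (stab z)"
    show "ac (coset_rep c) z = ac (coset_rep c') z \<longleftrightarrow> c = c'"
    proof
      assume eq: "ac (coset_rep c) z = ac (coset_rep c') z"
      have "inv (coset_rep c) \<otimes> coset_rep c' \<in> stab z"
        using r(1) c z by (simp add: stab_def ac_mult eq[symmetric] ac_inv)
      then have "coset_rep c <#\<^bsub>G\<^esub> stab z = coset_rep c' <#\<^bsub>G\<^esub> stab z"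
        using l_coset_eq_iff[OF sg] r(1) c by blast
      then show "c = c'" using r(2) c by simp
    qed simp
  next
    fix y assume "y \<in> orb z"
    then obtain g where g: "g \<in> carrier G" "y = ac g z" by (auto simp: orb_def)
    have "ac (coset_rep (g <#\<^bsub>G\<^esub> stab z)) z = ac g z"
      by (rule coset_rep_l_coset[OF sg g(1), where F = "\<lambda>g. ac g z"]) (use z in \<open>simp add: stab_def ac_mult\<close>)
    then show "\<exists>c\<in>left_cosets G (stab z). y = ac (coset_rep c) z"
      using g by (intro bexI[of _ "g <#\<^bsub>G\<^esub> stab z"]) (simp_all add: left_cosets_def)
  qed (use r z in \<open>auto simp: orb_def\<close>)
  then show ?thesis unfolding coset_sum_def by (rule sum.reindex_bij_betw)
qed

lemma nonzero_orbit_sum: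
  assumes "(\<Sum>y\<in>Y. F y) \<noteq> (0 :: 'b::ab_group_add)"
  obtains z where "z \<in> Y" "(\<Sum>y\<in>orb z. F y) \<noteq> 0"
proof -
  have "(\<Sum>O'\<in>orb ` Y. \<Sum>y | y \<in> Y \<and> orb y = O'. F y) = (\<Sum>y\<in>Y. F y)"
    using finite_Y by (intro sum.group) auto
  then have "(\<Sum>O'\<in>orb ` Y. \<Sum>y | y \<in> Y \<and> orb y = O'. F y) \<noteq> 0" using assms by (simp only:) simp
  then obtain O' where O': "O' \<in> orb ` Y" "(\<Sum>y | y \<in> Y \<and> orb y = O'. F y) \<noteq> 0"
    by (meson sum.not_neutral_contains_not_neutral)
  then obtain z where z: "z \<in> Y" "O' = orb z" by blast
  have "{y \<in> Y. orb y = O'} = orb z"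
    using z orb_eq[OF z(1)] orb_subset[OF z(1)] orb_self by blast
  then show ?thesis using that[OF z(1)] O'(2) by simp
qed

end

context equivariant_family begin

lemma f_zero: "y \<in> Y \<Longrightarrow> f y 0 = 0"
  using f_scale[OF _ zero_vecs, of y 0] by simp

lemma f_sum:
  assumes "y \<in> Y" "\<And>i. i \<in> I \<Longrightarrow> F i \<in> vecs M"
  shows "f y (\<Sum>i\<in>I. F i) = (\<Sum>i\<in>I. f y (F i))"
  using assms(2)
proof (induction I rule: infinite_finite_induct)
  case (insert x I)
  then have "F x \<in> vecs M" "sum F I \<in> vecs M" by (auto intro: sum_vecs)
  then have "f y (F x + sum F I) = f y (F x) + f y (sum F I)" by (rule f_add[OF assms(1)])
  moreover have "f y (sum F I) = (\<Sum>i\<in>I. f y (F i))" using insert by simp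
  moreover note sum.insert[OF insert.hyps, of F] sum.insert[OF insert.hyps, of "\<lambda>i. f y (F i)"]
  ultimately show ?case by (simp only:)
qed (simp_all add: f_zero assms(1))

lemma f_ac': "g \<in> carrier G \<Longrightarrow> y \<in> Y \<Longrightarrow> s \<in> vecs M \<Longrightarrow> f (ac g y) s = f y (act M (inv g) s)"
  using f_ac[of g y "act M (inv g) s"] by (simp add: act_closed act_inv_act)

lemma orbit_sum_hom:
  assumes z: "z \<in> Y"
  shows "gmod_hom G M M (\<lambda>s. \<Sum>y\<in>orb z. fscale (f y s) (v y))"
proof -
  have Y: "y \<in> Y" if "y \<in> orb z" for y using that orb_subset[OF z] by blast
  show ?thesis
  proof (rule gmod_homI)
    fix s s' assume "s \<in> vecs M" "s' \<in> vecs M"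
    then show "(\<Sum>y\<in>orb z. fscale (f y (s + s')) (v y))
      = (\<Sum>y\<in>orb z. fscale (f y s) (v y)) + (\<Sum>y\<in>orb z. fscale (f y s') (v y))"
      unfolding sum.distrib[symmetric]
      by (intro sum.cong refl) (simp only: f_add Y fvs.scale_left_distrib)
  next
    fix c s assume "s \<in> vecs M"
    then show "(\<Sum>y\<in>orb z. fscale (f y (fscale c s)) (v y)) = fscale c (\<Sum>y\<in>orb z. fscale (f y s) (v y))"
      unfolding fvs.scale_sum_right
      by (intro sum.cong refl) (simp only: f_scale Y fvs.scale_scale)
  next
    fix g s assume g: "g \<in> carrier G" and s: "s \<in> vecs M"
    have "act M g (\<Sum>y\<in>orb z. fscale (f y s) (v y)) = (\<Sum>y\<in>orb z. act M g (fscale (f y s) (v y)))"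
      by (intro act_sum g scale_vecs v_closed Y)
    also have "\<dots> = (\<Sum>y\<in>orb z. fscale (f (ac g y) (act M g s)) (v (ac g y)))"
      by (intro sum.cong refl) (simp only: act_scale g v_closed Y f_ac s v_ac)
    also have "\<dots> = (\<Sum>y\<in>orb z. fscale (f y (act M g s)) (v y))"
      by (rule sum.reindex_bij_betw[OF bij_betw_ac_orb[OF z g]])
    finally show "(\<Sum>y\<in>orb z. fscale (f y (act M g s)) (v y)) = act M g (\<Sum>y\<in>orb z. fscale (f y s) (v y))"
      by (rule sym)
  qed (intro sum_vecs scale_vecs v_closed Y)
qed

text \<open>The orbit sum is the trace, from the stabiliser of \<open>z\<close>, of the rank one map
  sending \<open>s\<close> to \<open>f z s\<close> times \<open>v z\<close>, which factors through
  the trivial module. As an endomorphism it is a scalar, nonzero by \<open>nz\<close>, and dividing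
  by it produces the identity.\<close>

lemma orbit_sum_relatively_projective:
  assumes scal: "scalar_endomorphisms G M" and z: "z \<in> Y"
    and s0: "s0 \<in> vecs M" and nz: "(\<Sum>y\<in>orb z. fscale (f y s0) (v y)) \<noteq> 0"
  shows "relatively_projective G (stab z) M"
proof -
  let ?T = "\<lambda>s. \<Sum>y\<in>orb z. fscale (f y s) (v y)"
  let ?H = "G\<lparr>carrier := stab z\<rparr>"
  let ?U = "trivial_gmod :: ('g, nat, 'k) gmod"
  obtain c where c: "\<And>s. s \<in> vecs M \<Longrightarrow> ?T s = fscale c s"
    using scal orbit_sum_hom[OF z] unfolding scalar_endomorphisms_def by blast
  have c0: "c \<noteq> 0" using nz c[OF s0] by auto
  note sg = stab_subgroup[OF z]
  have stG: "stab z \<subseteq> carrier G" using sg by (rule subgroup.subset)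
  have U: "fg_module ?H ?U"
    using subgroup.subgroup_is_group[OF sg is_group] finite_subset[OF stG finite_group]
    by (intro fg_module_trivial_gmod) simp_all
  define \<alpha> where "\<alpha> s = (\<lambda>i::nat. if i = 0 then f z s else 0)" for s
  define \<beta> where "\<beta> u = fscale (u 0 / c) (v z)" for u :: "nat \<Rightarrow> 'k"
  have "gmod_hom ?H M ?U \<alpha>"
  proof (rule gmod_homI)
    fix g s assume "g \<in> carrier ?H" "s \<in> vecs M"
    then show "\<alpha> (act M g s) = act ?U g (\<alpha> s)"
      using f_ac[of g z s] z by (simp add: \<alpha>_def trivial_gmod_def stab_def fun_eq_iff)
  next
    fix c s assume "s \<in> vecs M"
    then show "\<alpha> (fscale c s) = fscale c (\<alpha> s)"
      using z by (simp add: \<alpha>_def fun_eq_iff f_scale fscale_apply)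
  qed (simp_all add: \<alpha>_def trivial_gmod_def fun_eq_iff f_add z)
  moreover have "gmod_hom ?H ?U M \<beta>"
  proof (rule gmod_homI)
    fix g u assume g: "g \<in> carrier ?H" and "u \<in> vecs ?U"
    have "act M g (v z) = v z" using v_ac[of g z] g z by (simp add: stab_def)
    then show "\<beta> (act ?U g u) = act M g (\<beta> u)"
      using g stG z by (auto simp: \<beta>_def trivial_gmod_def act_scale v_closed)
  next
    fix u w assume "u \<in> vecs ?U" "w \<in> vecs ?U"
    show "\<beta> (u + w) = \<beta> u + \<beta> w"
      by (simp add: \<beta>_def add_divide_distrib fvs.scale_left_distrib)
  next
    fix a u assume "u \<in> vecs ?U"
    show "\<beta> (fscale a u) = fscale a (\<beta> u)"
      unfolding \<beta>_def fvs.scale_scale by (simp add: fscale_def)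
  qed (simp add: \<beta>_def scale_vecs v_closed z)
  moreover have "coset_sum G (stab z) (\<lambda>g. act M g (\<beta> (\<alpha> (act M (inv g) s)))) = s"
    if s: "s \<in> vecs M" for s
  proof -
    have "act M g (\<beta> (\<alpha> (act M (inv g) s))) = fscale (1/c) (fscale (f (ac g z) s) (v (ac g z)))"
      if g: "g \<in> carrier G" for g
      using f_ac'[OF g z s] g z by (simp add: \<beta>_def \<alpha>_def v_ac act_scale v_closed)
    then have "coset_sum G (stab z) (\<lambda>g. act M g (\<beta> (\<alpha> (act M (inv g) s))))
      = coset_sum G (stab z) (\<lambda>g. fscale (1/c) (fscale (f (ac g z) s) (v (ac g z))))"
      unfolding coset_sum_def by (intro sum.cong refl) (simp only: coset_rep(1)[OF sg])
    also have "\<dots> = (\<Sum>y\<in>orb z. fscale (1/c) (fscale (f y s) (v y)))"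
      by (rule coset_sum_stab[OF z])
    also have "\<dots> = fscale (1/c) (?T s)" by (rule fvs.scale_sum_right[symmetric])
    also have "\<dots> = s" using c[OF s] c0 by simp
    finally show ?thesis .
  qed
  ultimately have "iso_to_direct_summand G M (induced_module G (stab z) ?U)"
    by (intro frobenius_imp_summand[OF sg U]) simp_all
  then show ?thesis unfolding relatively_projective_def using U by blast
qed

end

text \<open>The functional \<open>L\<close> splits the inclusion of the line spanned by
  \<open>w\<close>: its kernel is an invariant complement, so by indecomposability this line is all
  of \<open>U\<close>.\<close>

lemma indecomposable_fixed_vector_trivial:
  assumes ind: "indecomposable_module H U"
    and w: "w \<in> vecs U" "\<And>h. h \<in> carrier H \<Longrightarrow> act U h w = w"
    and L_add: "\<And>u u'. u \<in> vecs U \<Longrightarrow> u' \<in> vecs U \<Longrightarrow> L (u + u') = L u + L u'"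
    and L_scale: "\<And>c u. u \<in> vecs U \<Longrightarrow> L (fscale c u) = c * L u"
    and L_act: "\<And>h u. h \<in> carrier H \<Longrightarrow> u \<in> vecs U \<Longrightarrow> L (act U h u) = L u"
    and Lw: "L w \<noteq> (0 :: 'k::field)"
  shows "trivial_module H U"
proof -
  interpret U: fg_module H U using ind by (simp add: indecomposable_module_def)
  let ?A = "range (\<lambda>c. fscale c w)" and ?B = "{u \<in> vecs U. L u = 0}"
  have L0: "L 0 = 0" using L_scale[OF U.zero_vecs, of 0] by simp
  have "fvs.subspace ?A"
  proof (rule fvs.subspaceI)
    show "0 \<in> ?A" by (rule image_eqI[of _ _ 0]) simp_all
    show "x + y \<in> ?A" if "x \<in> ?A" "y \<in> ?A" for x y
      using that by (auto simp: fvs.scale_left_distrib[symmetric])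
    show "fscale c x \<in> ?A" if "x \<in> ?A" for c x
      using that by auto
  qed
  then have "submodule H U ?A"
    by (auto simp: submodule_def U.scale_vecs w U.act_scale)
  moreover have "fvs.subspace ?B"
    by (rule fvs.subspaceI) (auto simp: U.zero_vecs U.add_vecs U.scale_vecs L0 L_add L_scale)
  then have "submodule H U ?B"
    by (auto simp: submodule_def U.act_closed L_act)
  moreover have "?A \<inter> ?B = {0}"
  proof
    show "?A \<inter> ?B \<subseteq> {0}" using Lw by (auto simp: L_scale w)
    have "fscale 0 w \<in> ?A" by blast
    then show "{0} \<subseteq> ?A \<inter> ?B" using U.zero_vecs L0 by simp
  qed
  moreover have "vecs U = {a + b | a b. a \<in> ?A \<and> b \<in> ?B}"
  proof
    show "{a + b | a b. a \<in> ?A \<and> b \<in> ?B} \<subseteq> vecs U"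
      by (auto intro: U.add_vecs U.scale_vecs w)
    show "vecs U \<subseteq> {a + b | a b. a \<in> ?A \<and> b \<in> ?B}"
    proof
      fix u assume u: "u \<in> vecs U"
      let ?a = "fscale (L u / L w) w"
      have "L u = L ((u - ?a) + ?a)" by simp
      also have "\<dots> = L (u - ?a) + L ?a"
        using u w by (intro L_add U.diff_vecs U.scale_vecs)
      finally have "L (u - ?a) = 0" using Lw by (simp add: L_scale w)
      then have "u - ?a \<in> ?B" using u w by (simp add: U.diff_vecs U.scale_vecs)
      moreover have "?a \<in> ?A" by blast
      moreover have "u = ?a + (u - ?a)" by simp
      ultimately show "u \<in> {a + b | a b. a \<in> ?A \<and> b \<in> ?B}" by blast
    qed
  qed
  ultimately have ds: "is_direct_sum H U ?A ?B" by (simp add: is_direct_sum_def)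
  have w0: "w \<noteq> 0" using Lw L0 by auto
  have "?A \<noteq> {0}"
  proof
    assume "?A = {0}"
    moreover have "fscale 1 w \<in> ?A" by blast
    ultimately show False using w0 by simp
  qed
  then have B: "?B = {0}" using ind ds unfolding indecomposable_module_def by blast
  have A: "vecs U = ?A"
  proof
    show "?A \<subseteq> vecs U" by (auto intro: U.scale_vecs w)
    show "vecs U \<subseteq> ?A"
    proof
      fix u assume "u \<in> vecs U"
      then have "u \<in> {a + b | a b. a \<in> ?A \<and> b \<in> ?B}"
        using ds by (simp only: is_direct_sum_def)
      then obtain a b where ab: "a \<in> ?A" "b \<in> ?B" "u = a + b" by blast
      have "b = 0" using ab(2) unfolding B by (rule singletonD)
      then show "u \<in> ?A" using ab(1,3) by (simp only: add_0_right)
    qed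
  qed
  have sp: "vecs U = fvs.span {w}" unfolding A by (simp add: fvs.span_singleton)
  have "fvs.dim (vecs U) = 1"
    unfolding sp fvs.dim_span
    using fvs.dim_eq_card_independent[of "{w}"] w0 by (simp add: fvs.dependent_single)
  moreover have "act U h u = u" if "h \<in> carrier H" "u \<in> vecs U" for h u
  proof -
    obtain c where "u = fscale c w" using \<open>u \<in> vecs U\<close> unfolding A by blast
    then show ?thesis using w that(1) by (simp add: U.act_scale)
  qed
  ultimately show ?thesis
    using U.fg_module_axioms by (simp add: trivial_module_def)
qed

text \<open>The vertex and the source are arbitrary here. The argument exploits the minimality of
  the subgroup \<open>Q\<close>, the trace formula through \<open>U\<close> and the
  indecomposability of \<open>U\<close>; no two sources are ever compared.\<close>

lemma (in permutation_summand) trivial_source: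
  assumes scal: "scalar_endomorphisms G M" and nontriv: "vecs M \<noteq> {0}"
  shows "trivial_source_module G M"
  unfolding trivial_source_module_def
proof (intro conjI allI impI)
  show "indecomposable_module G M" using scal nontriv by (rule scalar_endomorphisms_indecomposable)
next
  fix Q U assume QU: "is_vertex G M Q \<and> is_source G M Q U"
  then have Q: "subgroup Q G" and Umod: "indecomposable_module (G\<lparr>carrier := Q\<rparr>) U"
    and iso: "iso_to_direct_summand G M (induced_module G Q U)"
    and minimal: "\<And>R. subgroup R G \<Longrightarrow> R \<subset> Q \<Longrightarrow> \<not> relatively_projective G R M"
    by (auto simp: is_vertex_def is_source_def)
  interpret Q: subgroup Q G by (rule Q)
  have U: "fg_module (G\<lparr>carrier := Q\<rparr>) U" using Umod by (simp add: indecomposable_module_def)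
  obtain \<alpha> \<beta> where \<alpha>: "gmod_hom (G\<lparr>carrier := Q\<rparr>) M U \<alpha>" and \<beta>: "gmod_hom (G\<lparr>carrier := Q\<rparr>) U M \<beta>"
    and tr: "\<And>s. s \<in> vecs M \<Longrightarrow> coset_sum G Q (\<lambda>g. act M g (\<beta> (\<alpha> (act M (inv g) s)))) = s"
    using frobenius_summand_imp[OF Q U iso] by blast
  note \<alpha>D = gmod_homD[OF \<alpha>, simplified] and \<beta>D = gmod_homD[OF \<beta>, simplified]
  note r = coset_rep[OF Q]
  \<comment> \<open>The conjugate of \<open>\<beta> \<circ> \<alpha>\<close> by \<open>g\<close>,
    which depends only on the left coset of \<open>g\<close>.\<close>
  define \<Theta> where "\<Theta> g s = act M g (\<beta> (\<alpha> (act M (inv g) s)))" for g s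
  have \<Theta>_closed: "\<Theta> g s \<in> vecs M" if "g \<in> carrier G" "s \<in> vecs M" for g s
    using that by (simp add: \<Theta>_def act_closed \<alpha>D(1) \<beta>D(1))
  have \<Theta>_inv: "\<Theta> (g \<otimes> q) s = \<Theta> g s" if "g \<in> carrier G" "q \<in> Q" "s \<in> vecs M" for g q s
  proof -
    let ?u = "act M (inv g) s"
    have u: "?u \<in> vecs M" using that by (simp add: act_closed)
    have "act M (inv (g \<otimes> q)) s = act M (inv q) ?u"
      using that by (simp add: inv_mult_group act_mult)
    then have "\<Theta> (g \<otimes> q) s = act M (g \<otimes> q) (act M (inv q) (\<beta> (\<alpha> ?u)))"
      using that u by (simp add: \<Theta>_def \<alpha>D \<beta>D)
    also have "\<dots> = \<Theta> g s"
      using that \<beta>D(1)[OF \<alpha>D(1)[OF u]] by (simp add: \<Theta>_def act_mult act_closed act_inv_act)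
    finally show ?thesis .
  qed
  have \<Theta>_mult: "\<Theta> (x \<otimes> g) (act M x s) = act M x (\<Theta> g s)"
    if "g \<in> carrier G" "x \<in> carrier G" "s \<in> vecs M" for g x s
    using that by (simp add: \<Theta>_def act_closed \<alpha>D(1) \<beta>D(1) inv_mult_group act_mult act_inv_act)
  have \<Theta>_hom: "gmod_hom (G\<lparr>carrier := {}\<rparr>) M M (\<Theta> g)" if "g \<in> carrier G" for g
    by (rule gmod_homI)
      (use that in \<open>simp_all add: \<Theta>_def act_closed act_add act_scale \<alpha>D \<beta>D\<close>)
  define \<theta> where "\<theta> c = \<Theta> (coset_rep c)" for c
  have \<theta>: "\<theta> (g <#\<^bsub>G\<^esub> Q) s = \<Theta> g s" if "g \<in> carrier G" "s \<in> vecs M" for g s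
    unfolding \<theta>_def using that
    by (intro coset_rep_l_coset[OF Q, where F = "\<lambda>g. \<Theta> g s"] \<Theta>_inv)
  have \<theta>_closed: "\<theta> c s \<in> vecs M" if "c \<in> left_cosets G Q" "s \<in> vecs M" for c s
    using that by (simp add: \<theta>_def \<Theta>_closed r)
  have \<theta>_mult: "\<theta> (x <#\<^bsub>G\<^esub> c) (act M x s) = act M x (\<theta> c s)"
    if "x \<in> carrier G" "c \<in> left_cosets G Q" "s \<in> vecs M" for x c s
  proof -
    have "x <#\<^bsub>G\<^esub> c = (x \<otimes> coset_rep c) <#\<^bsub>G\<^esub> Q"
      using r[OF that(2)] that(1) Q.subset by (metis lcos_m_assoc)
    then show ?thesis
      using that r(1)[OF that(2)] by (simp add: \<theta> act_closed \<Theta>_mult) (simp add: \<theta>_def)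
  qed
  txt \<open>
    Expanding \<open>id \<circ> Tr (\<beta> \<alpha>) \<circ> id\<close> gives a sum of rank one maps over \<open>Y \<times> G/Q \<times> Y\<close>.  Some orbit has a
    nonzero sum; its stabiliser can be taken inside \<open>Q\<close>, hence equals \<open>Q\<close> by minimality, and the
    corresponding rank one map yields a \<open>Q\<close>-fixed vector of \<open>U\<close> that splits off.
  \<close>
  define Z where "Z = Y \<times> left_cosets G Q \<times> Y"
  define acZ where "acZ g = (\<lambda>(y1, c, y2). (ac g y1, g <#\<^bsub>G\<^esub> c, ac g y2))" for g
  \<comment> \<open>The term at \<open>(y1, c, y2)\<close> sends \<open>s\<close> to
    \<open>f y2 s\<close> times \<open>f y1 (\<theta> c (v y2))\<close> times \<open>v y1\<close>.
    The scalar that does not involve \<open>s\<close> is absorbed into \<open>vZ\<close>.\<close>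
  define vZ where "vZ = (\<lambda>(y1, c, y2). fscale (f y1 (\<theta> c (v y2))) (v y1))"
  define fZ where "fZ = (\<lambda>(y1 :: 'y, c :: 'g set, y2). f y2)"
  have coset: "x <#\<^bsub>G\<^esub> c \<in> left_cosets G Q" "c \<subseteq> carrier G"
    if c: "c \<in> left_cosets G Q" and x: "x \<in> carrier G" for c x
  proof -
    obtain g where g: "g \<in> carrier G" "c = g <#\<^bsub>G\<^esub> Q" using c by (auto simp: left_cosets_def)
    then have "x <#\<^bsub>G\<^esub> c = (x \<otimes> g) <#\<^bsub>G\<^esub> Q" using x Q.subset by (simp add: lcos_m_assoc)
    then show "x <#\<^bsub>G\<^esub> c \<in> left_cosets G Q" using g x by (simp add: left_cosets_def)
    show "c \<subseteq> carrier G" using g Q.subset by (auto simp: l_coset_def)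
  qed
  interpret Z: equivariant_family G M Z acZ vZ fZ
  proof unfold_locales
    show "finite Z" using finite_Y finite_group by (simp add: Z_def left_cosets_def)
  next
    fix g z assume g: "g \<in> carrier G" and z: "z \<in> Z"
    show "acZ g z \<in> Z" using g z coset by (auto simp: Z_def acZ_def ac_closed)
    obtain y1 c y2 where z': "z = (y1, c, y2)" "y1 \<in> Y" "c \<in> left_cosets G Q" "y2 \<in> Y"
      using z by (auto simp: Z_def)
    show "vZ (acZ g z) = act M g (vZ z)"
      unfolding z'(1) vZ_def acZ_def split
      using g z' by (simp add: v_ac \<theta>_mult f_ac v_closed \<theta>_closed act_scale)
    fix s assume "s \<in> vecs M"
    then show "fZ (acZ g z) (act M g s) = fZ z s"
      using g z by (auto simp: Z_def fZ_def acZ_def f_ac)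
  next
    fix z assume "z \<in> Z"
    then show "acZ \<one> z = z"
      using coset(2)[OF _ one_closed] by (auto simp: Z_def acZ_def ac_one lcos_mult_one)
  next
    fix g h z assume "g \<in> carrier G" "h \<in> carrier G" "z \<in> Z"
    then show "acZ (g \<otimes> h) z = acZ g (acZ h z)"
      using coset(2)[OF _ one_closed] by (auto simp: Z_def acZ_def ac_mult lcos_m_assoc)
  qed (auto simp: Z_def vZ_def fZ_def scale_vecs v_closed f_add f_scale)
  have id: "(\<Sum>z\<in>Z. fscale (fZ z s) (vZ z)) = s" if s: "s \<in> vecs M" for s
  proof -
    have inner1: "(\<Sum>y2\<in>Y. fscale (f y2 s) (\<theta> c (v y2))) = \<theta> c s" if c: "c \<in> left_cosets G Q" for c
    proof -
      note h = \<Theta>_hom[OF r(1)[OF c]]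
      have "\<theta> c s = \<theta> c (\<Sum>y2\<in>Y. fscale (f y2 s) (v y2))" using resolution[OF s] by simp
      also have "\<dots> = (\<Sum>y2\<in>Y. \<theta> c (fscale (f y2 s) (v y2)))"
        unfolding \<theta>_def by (rule hom_sum[OF h]) (intro scale_vecs v_closed)
      also have "\<dots> = (\<Sum>y2\<in>Y. fscale (f y2 s) (\<theta> c (v y2)))"
        by (intro sum.cong refl) (simp add: \<theta>_def gmod_homD(3)[OF h] v_closed)
      finally show ?thesis by simp
    qed
    have inner2: "(\<Sum>(c, y2)\<in>left_cosets G Q \<times> Y. f y2 s * f y1 (\<theta> c (v y2))) = f y1 s"
      if y1: "y1 \<in> Y" for y1
    proof -
      have "(\<Sum>(c, y2)\<in>left_cosets G Q \<times> Y. f y2 s * f y1 (\<theta> c (v y2)))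
        = (\<Sum>c\<in>left_cosets G Q. \<Sum>y2\<in>Y. f y1 (fscale (f y2 s) (\<theta> c (v y2))))"
        unfolding sum.cartesian_product[symmetric]
        by (intro sum.cong refl) (simp add: f_scale y1 \<theta>_closed v_closed)
      also have "\<dots> = (\<Sum>c\<in>left_cosets G Q. f y1 (\<Sum>y2\<in>Y. fscale (f y2 s) (\<theta> c (v y2))))"
        by (intro sum.cong refl f_sum[symmetric] y1 scale_vecs \<theta>_closed v_closed)
      also have "\<dots> = (\<Sum>c\<in>left_cosets G Q. f y1 (\<theta> c s))"
        by (intro sum.cong refl) (simp only: inner1)
      also have "\<dots> = f y1 (\<Sum>c\<in>left_cosets G Q. \<theta> c s)"
        by (intro f_sum[symmetric] y1 \<theta>_closed s)
      also have "(\<Sum>c\<in>left_cosets G Q. \<theta> c s) = s"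
        using tr[OF s] unfolding coset_sum_def \<theta>_def \<Theta>_def .
      finally show ?thesis .
    qed
    have "(\<Sum>z\<in>Z. fscale (fZ z s) (vZ z))
      = (\<Sum>y1\<in>Y. \<Sum>(c, y2)\<in>left_cosets G Q \<times> Y. fscale (f y2 s * f y1 (\<theta> c (v y2))) (v y1))"
      unfolding Z_def sum.cartesian_product by (intro sum.cong refl) (auto simp: fZ_def vZ_def)
    also have "\<dots> = (\<Sum>y1\<in>Y. fscale (\<Sum>(c, y2)\<in>left_cosets G Q \<times> Y. f y2 s * f y1 (\<theta> c (v y2))) (v y1))"
      by (intro sum.cong refl) (simp add: fvs.scale_sum_left case_prod_unfold)
    also have "\<dots> = (\<Sum>y1\<in>Y. fscale (f y1 s) (v y1))"
      by (intro sum.cong refl) (simp only: inner2)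
    also have "\<dots> = s" by (rule resolution[OF s])
    finally show ?thesis .
  qed
  obtain s where s: "s \<in> vecs M" "s \<noteq> 0" using nontriv zero_vecs by blast
  then have "(\<Sum>z\<in>Z. fscale (fZ z s) (vZ z)) \<noteq> 0" using id by simp
  then obtain z where z: "z \<in> Z" and nz: "(\<Sum>y\<in>Z.orb z. fscale (fZ y s) (vZ y)) \<noteq> 0"
    by (rule Z.nonzero_orbit_sum)
  obtain z' where z': "z' \<in> Z.orb z" "vZ z' \<noteq> 0"
  proof -
    have "\<exists>z'\<in>Z.orb z. fscale (fZ z' s) (vZ z') \<noteq> 0"
      using nz by (meson sum.not_neutral_contains_not_neutral)
    then show ?thesis using that by (metis fvs.scale_zero_right)
  qed
  have z'Z: "z' \<in> Z" using z' Z.orb_subset[OF z] by blast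
  then obtain y1' c y2' where z'_eq: "z' = (y1', c, y2')" "y1' \<in> Y" "c \<in> left_cosets G Q" "y2' \<in> Y"
    by (auto simp: Z_def)
  \<comment> \<open>Translating inside the orbit makes the middle coordinate the coset
    \<open>Q\<close> itself, so that the stabiliser lies in \<open>Q\<close> and not merely in a
    conjugate of it.\<close>
  define g where "g = inv (coset_rep c)"
  have g: "g \<in> carrier G" using r(1)[OF z'_eq(3)] by (simp add: g_def)
  define z'' where "z'' = acZ g z'"
  have z''Z: "z'' \<in> Z" unfolding z''_def using g z'Z by (rule Z.ac_closed)
  have vz'': "vZ z'' \<noteq> 0"
  proof
    assume "vZ z'' = 0"
    then have "act M (inv g) (act M g (vZ z')) = act M (inv g) 0"
      using Z.v_ac[OF g z'Z] by (simp add: z''_def)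
    then show False
      using z'(2) act_inv_act(1)[OF g Z.v_closed[OF z'Z]] act_zero[OF inv_closed[OF g]] by simp
  qed
  have orb'': "Z.orb z'' = Z.orb z"
  proof -
    have "z'' \<in> Z.orb z'" using g by (auto simp: z''_def Z.orb_def)
    then show ?thesis using Z.orb_eq[OF z'Z] Z.orb_eq[OF z z'(1)] by simp
  qed
  have "g <#\<^bsub>G\<^esub> c = g <#\<^bsub>G\<^esub> (coset_rep c <#\<^bsub>G\<^esub> Q)" using r(2)[OF z'_eq(3)] by simp
  also have "\<dots> = Q"
    using g r(1)[OF z'_eq(3)] Q.subset by (simp add: g_def lcos_m_assoc lcos_mult_one)
  finally have gc: "g <#\<^bsub>G\<^esub> c = Q" .
  define y1 y2 where "y1 = ac g y1'" and "y2 = ac g y2'"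
  have z''_eq: "z'' = (y1, Q, y2)" by (simp add: z''_def z'_eq(1) acZ_def gc y1_def y2_def)
  have Y12: "y1 \<in> Y" "y2 \<in> Y" using g z'_eq by (simp_all add: y1_def y2_def ac_closed)
  have "relatively_projective G (Z.stab z'') M"
    by (rule Z.orbit_sum_relatively_projective[OF scal z''Z s(1)]) (use nz in \<open>simp add: orb''\<close>)
  moreover have "Z.stab z'' \<subseteq> Q"
  proof
    fix h assume "h \<in> Z.stab z''"
    then have h: "h \<in> carrier G" "h <#\<^bsub>G\<^esub> Q = Q" by (auto simp: Z.stab_def z''_eq acZ_def)
    have "h \<otimes> \<one> \<in> h <#\<^bsub>G\<^esub> Q" using Q.one_closed unfolding l_coset_def by blast
    then show "h \<in> Q" using h by simp
  qed
  ultimately have stQ: "Z.stab z'' = Q"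
    using minimal[OF Z.stab_subgroup[OF z''Z]] by blast
  have fix12: "ac h y1 = y1" "ac h y2 = y2" if "h \<in> Q" for h
  proof -
    have "acZ h z'' = z''" using that stQ by (auto simp: Z.stab_def)
    then show "ac h y1 = y1" "ac h y2 = y2" by (simp_all add: z''_eq acZ_def)
  qed
  have "\<theta> Q (v y2) = \<Theta> \<one> (v y2)"
    using \<theta>[OF one_closed v_closed[OF Y12(2)]] Q.subset by (simp add: lcos_mult_one)
  also have "\<dots> = \<beta> (\<alpha> (v y2))"
    using Y12 by (simp add: \<Theta>_def act_one v_closed \<alpha>D(1) \<beta>D(1))
  finally have \<theta>Q: "\<theta> Q (v y2) = \<beta> (\<alpha> (v y2))" .
  \<comment> \<open>\<open>vZ z''\<close> is the multiple of \<open>v y1\<close> by the scalar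
    \<open>f y1 (\<beta> (\<alpha> (v y2)))\<close>, which is therefore nonzero. Since
    \<open>Q\<close> stabilises \<open>y1\<close> and \<open>y2\<close>, the vector is fixed and the
    functional is invariant.\<close>
  show "trivial_module (G\<lparr>carrier := Q\<rparr>) U"
  proof (rule indecomposable_fixed_vector_trivial[OF Umod, where w = "\<alpha> (v y2)" and L = "\<lambda>u. f y1 (\<beta> u)"])
    show "f y1 (\<beta> (\<alpha> (v y2))) \<noteq> 0"
      using vz'' by (auto simp: vZ_def z''_eq \<theta>Q)
  next
    fix h assume "h \<in> carrier (G\<lparr>carrier := Q\<rparr>)"
    then have h: "h \<in> Q" by simp
    then show "act U h (\<alpha> (v y2)) = \<alpha> (v y2)"
      using Y12 fix12(2)[OF h] v_ac[of h y2] by (simp add: \<alpha>D(4)[symmetric] v_closed)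
    fix u assume "u \<in> vecs U"
    then show "f y1 (\<beta> (act U h u)) = f y1 (\<beta> u)"
      using h Y12 fix12(1)[OF h] f_ac[of h y1 "\<beta> u"] by (simp add: \<beta>D)
  qed (use Y12 in \<open>simp_all add: \<alpha>D(1) \<beta>D v_closed f_add f_scale\<close>)
qed

section \<open>Existence of vertices and sources\<close>

lemma is_direct_sum_commute:
  assumes "is_direct_sum G M A B"
  shows "is_direct_sum G M B A"
proof -
  have "{a + b | a b. a \<in> A \<and> b \<in> B} = {b + a | b a. b \<in> B \<and> a \<in> A}"
    by (rule Collect_cong) (metis add.commute)
  then show ?thesis using assms unfolding is_direct_sum_def by (metis Int_commute)
qed

text \<open>Dimension is measured by the size of a finite spanning set. Adjoining a vector outside
  \<open>A\<close> to a basis of \<open>A\<close> keeps it independent, whence the strict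
  inequality.\<close>

lemma subspace_psubset_span:
  assumes "fvs.subspace A" "A \<subset> fvs.span B" "finite B"
  obtains C where "finite C" "A = fvs.span C" "card C < card B"
proof -
  obtain C where C: "C \<subseteq> A" "fvs.independent C" "A \<subseteq> fvs.span C"
    using fvs.maximal_independent_subset by blast
  have AC: "A = fvs.span C" using C assms(1) by (metis fvs.span_minimal subset_antisym)
  obtain x where x: "x \<in> fvs.span B" "x \<notin> A" using assms(2) by blast
  have "fvs.independent (insert x C)" using x C AC by (intro fvs.independent_insertI) auto
  moreover have "insert x C \<subseteq> fvs.span B" using x C assms(2) by auto
  ultimately have "finite (insert x C) \<and> card (insert x C) \<le> card B"
    by (rule fvs.independent_span_bound[OF assms(3)])
  moreover have "x \<notin> C" using x C by blast
  ultimately have "finite C" "card C < card B" by auto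
  then show ?thesis using that AC by blast
qed

context fg_module begin

text \<open>Relative projectivity admits only modules on \<open>nat\<close> coordinates, so
  \<open>M\<close> has to be transported there through a basis before it can itself serve as the
  module that is induced.\<close>

lemma exists_nat_copy:
  obtains U :: "('g, nat, 'k) gmod" and \<alpha> \<beta> where "fg_module G U" "gmod_hom G M U \<alpha>" "gmod_hom G U M \<beta>"
    "\<And>v. v \<in> vecs M \<Longrightarrow> \<beta> (\<alpha> v) = v"
proof -
  obtain B where B: "finite B" "vecs M = fvs.span B" using finite_dim by blast
  obtain C where C: "C \<subseteq> vecs M" "fvs.independent C" "vecs M \<subseteq> fvs.span C"
    using fvs.maximal_independent_subset by blast
  have VC: "vecs M = fvs.span C" using C subspace_vecs by (metis fvs.span_minimal subset_antisym)
  have fC: "finite C" using fvs.independent_span_bound[OF B(1) C(2)] C(1) B(2) by auto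
  define d where "d = card C"
  obtain e where e: "bij_betw e {..<d} C"
    using ex_bij_betw_nat_finite[OF fC] by (auto simp: d_def atLeast0LessThan)
  have eC: "e i \<in> C" if "i < d" for i using e that by (auto dest: bij_betwE)
  define \<alpha> where "\<alpha> v = (\<lambda>i. if i < d then fvs.representation C v (e i) else 0)" for v
  define \<beta> where "\<beta> u = (\<Sum>i<d. fscale (u i) (e i))" for u :: "nat \<Rightarrow> 'k"
  define V where "V = {u :: nat \<Rightarrow> 'k. \<forall>i. \<not> i < d \<longrightarrow> u i = 0}"
  have \<beta>\<alpha>: "\<beta> (\<alpha> v) = v" if "v \<in> vecs M" for v
  proof -
    have "\<beta> (\<alpha> v) = (\<Sum>i<d. fscale (fvs.representation C v (e i)) (e i))"
      by (simp add: \<alpha>_def \<beta>_def)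
    also have "\<dots> = (\<Sum>b\<in>C. fscale (fvs.representation C v b) b)"
      by (rule sum.reindex_bij_betw[OF e])
    also have "\<dots> = v"
      using that C(2) fC unfolding VC by (intro fvs.sum_representation_eq) auto
    finally show ?thesis .
  qed
  have \<beta>_closed: "\<beta> u \<in> vecs M" for u
    unfolding \<beta>_def using eC C(1) by (intro sum_vecs scale_vecs) auto
  have \<alpha>_add: "\<alpha> (v + w) = \<alpha> v + \<alpha> w" if "v \<in> vecs M" "w \<in> vecs M" for v w
    using that C(2) unfolding VC by (simp add: \<alpha>_def fun_eq_iff fvs.representation_add)
  have \<alpha>_scale: "\<alpha> (fscale c v) = fscale c (\<alpha> v)" if "v \<in> vecs M" for c v
    using that C(2) unfolding VC \<alpha>_def fvs.representation_scale[OF C(2) that[unfolded VC]]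
    by (simp add: fscale_def fun_eq_iff)
  have \<beta>_add: "\<beta> (u + w) = \<beta> u + \<beta> w" for u w
    by (simp add: \<beta>_def fvs.scale_left_distrib sum.distrib)
  have \<beta>_scale: "\<beta> (fscale c u) = fscale c (\<beta> u)" for c u
    unfolding \<beta>_def fvs.scale_sum_right fvs.scale_scale by (simp add: fscale_def)
  have \<alpha>_V: "\<alpha> v \<in> V" for v by (simp add: \<alpha>_def V_def)
  have \<alpha>_e: "\<alpha> (e j) = basis_vec j" if "j < d" for j
  proof -
    have "fvs.representation C (e j) (e i) = (if i = j then 1 else 0)" if "i < d" for i
      using fvs.representation_basis[OF C(2) eC[OF \<open>j < d\<close>]] e that \<open>j < d\<close>
      by (auto simp: bij_betw_def inj_on_def)
    then show ?thesis using that by (auto simp: \<alpha>_def basis_vec_def fun_eq_iff)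
  qed
  \<comment> \<open>The action \<open>act undefined\<close> is a dummy: over the empty carrier only
    linearity is asserted, as needed for \<open>hom_sum\<close>.\<close>
  have \<alpha>_hom: "gmod_hom (G\<lparr>carrier := {}\<rparr>) M \<lparr>vecs = V, act = act undefined\<rparr> \<alpha>"
    by (rule gmod_homI) (simp_all add: \<alpha>_V \<alpha>_add \<alpha>_scale)
  have \<alpha>\<beta>: "\<alpha> (\<beta> u) = u" if "u \<in> V" for u
  proof -
    have "\<alpha> (\<beta> u) = (\<Sum>i<d. \<alpha> (fscale (u i) (e i)))"
      unfolding \<beta>_def using eC C(1) by (intro hom_sum[OF \<alpha>_hom] scale_vecs) auto
    also have "\<dots> = (\<Sum>i<d. fscale (u i) (basis_vec i))"
      using eC C(1) by (intro sum.cong refl) (auto simp: \<alpha>_scale \<alpha>_e subset_iff)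
    also have "\<dots> = u"
      using that by (auto simp: fun_eq_iff sum_apply_fun fscale_def basis_vec_def V_def if_distrib sum.delta cong: if_cong)
    finally show ?thesis .
  qed
  define U where "U = \<lparr>vecs = V, act = (\<lambda>g u. \<alpha> (act M g (\<beta> u)))\<rparr>"
  have V: "fvs.subspace V" by (auto simp: V_def fvs.subspace_def fscale_def)
  have "V \<subseteq> fvs.span (basis_vec ` {..<d})"
  proof
    fix u assume "u \<in> V"
    then have "u = (\<Sum>i<d. fscale (u i) (basis_vec i))"
      by (auto simp: fun_eq_iff sum_apply_fun fscale_def basis_vec_def V_def if_distrib sum.delta cong: if_cong)
    also have "\<dots> \<in> fvs.span (basis_vec ` {..<d})"
      by (intro fvs.span_sum fvs.span_scale fvs.span_base) auto
    finally show "u \<in> fvs.span (basis_vec ` {..<d})" .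
  qed
  then have fin: "\<exists>B. finite B \<and> V = fvs.span B"
    using finite_span_subspace[OF _ V] by blast
  have "fg_module G U"
    by unfold_locales
      (simp_all add: U_def finite_group V fin \<alpha>_V \<beta>_add \<beta>_scale \<beta>_closed act_add act_scale \<alpha>_add
        \<alpha>_scale act_closed act_one act_mult \<alpha>\<beta> \<beta>\<alpha>)
  moreover have "gmod_hom G M U \<alpha>"
    by (rule gmod_homI) (simp_all add: U_def \<alpha>_V \<alpha>_add \<alpha>_scale \<beta>\<alpha>)
  moreover have "gmod_hom G U M \<beta>"
    by (rule gmod_homI) (simp_all add: U_def \<beta>_closed \<beta>_add \<beta>_scale \<beta>\<alpha> act_closed)
  ultimately show ?thesis using that \<beta>\<alpha> by blast
qed

text \<open>A module is projective relative to the whole group, because the trace then has a single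
  term; a subgroup of least order with this property is a vertex.\<close>

lemma exists_vertex: "\<exists>Q. is_vertex G M Q"
proof -
  let ?P = "\<lambda>Q. subgroup Q G \<and> relatively_projective G Q M"
  obtain U :: "('g, nat, 'k) gmod" and \<alpha> \<beta> where U: "fg_module G U" and
    \<alpha>: "gmod_hom G M U \<alpha>" and \<beta>: "gmod_hom G U M \<beta>" and \<beta>\<alpha>: "\<And>v. v \<in> vecs M \<Longrightarrow> \<beta> (\<alpha> v) = v"
    using exists_nat_copy by blast
  have sg: "subgroup (carrier G) G" by (rule subgroup_self)
  have lc: "left_cosets G (carrier G) = {carrier G}"
  proof -
    have "g <#\<^bsub>G\<^esub> carrier G = carrier G" if "g \<in> carrier G" for g
      using coset_join3[OF that sg that] .
    then show ?thesis unfolding left_cosets_def using one_closed by auto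
  qed
  have "coset_sum G (carrier G) (\<lambda>g. act M g (\<beta> (\<alpha> (act M (inv g) v)))) = v" if "v \<in> vecs M" for v
    using that coset_rep(1)[OF sg, of "carrier G"]
    by (simp add: coset_sum_def lc \<beta>\<alpha> act_closed act_inv_act)
  then have "iso_to_direct_summand G M (induced_module G (carrier G) U)"
    using U \<alpha> \<beta> by (intro frobenius_imp_summand[OF sg, where \<alpha> = \<alpha> and \<beta> = \<beta>]) simp_all
  then have "relatively_projective G (carrier G) M"
    unfolding relatively_projective_def using U by (intro exI[of _ U]) simp
  then have P: "?P (carrier G)" using sg by blast
  obtain Q where Q: "?P Q" and min: "\<And>R. ?P R \<Longrightarrow> card Q \<le> card R"
    using ex_has_least_nat[of ?P, OF P, of card] by blast
  have "\<not> relatively_projective G R M" if "subgroup R G" "R \<subset> Q" for R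
  proof
    assume "relatively_projective G R M"
    then have "card Q \<le> card R" using that by (intro min) simp
    moreover have "finite Q" using Q finite_group by (meson finite_subset subgroup.subset)
    ultimately show False using psubset_card_mono[OF _ that(2)] by simp
  qed
  then show ?thesis unfolding is_vertex_def using Q by blast
qed

text \<open>If \<open>U\<close> decomposes, the traces through the two parts are scalars with sum 1.
  One of them is nonzero, and the corresponding part alone already induces to a module with summand
  \<open>M\<close>.\<close>

lemma exists_source:
  assumes scal: "scalar_endomorphisms G M" and nontriv: "vecs M \<noteq> {0}"
    and Q: "subgroup Q G" and rp: "relatively_projective G Q M"
  shows "\<exists>U. is_source G M Q U"
proof -
  let ?H = "G\<lparr>carrier := Q\<rparr>"
  txt \<open>A module of minimal dimension inducing to a module with summand \<open>M\<close> is indecomposable.\<close>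
  define P where "P = (\<lambda>(U :: ('g, nat, 'k) gmod, B). fg_module ?H U \<and>
    iso_to_direct_summand G M (induced_module G Q U) \<and> finite B \<and> vecs U = fvs.span B)"
  obtain U0 :: "('g, nat, 'k) gmod" where U0: "fg_module ?H U0"
    "iso_to_direct_summand G M (induced_module G Q U0)"
    using rp by (auto simp: relatively_projective_def)
  obtain B0 where "finite B0" "vecs U0 = fvs.span B0" using fg_module.finite_dim[OF U0(1)] by blast
  then have "P (U0, B0)" using U0 by (simp add: P_def)
  then obtain UB where UB: "P UB" and min: "\<And>UB'. P UB' \<Longrightarrow> card (snd UB) \<le> card (snd UB')"
    using ex_has_least_nat[of P "(U0, B0)" "\<lambda>x. card (snd x)"] by blast
  obtain U B where UB_eq: "UB = (U, B)" by (cases UB)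
  have U: "fg_module ?H U" and iso: "iso_to_direct_summand G M (induced_module G Q U)"
    and B: "finite B" "vecs U = fvs.span B" using UB unfolding UB_eq P_def by auto
  interpret U: fg_module ?H U by (rule U)
  obtain \<alpha> \<beta> where \<alpha>: "gmod_hom ?H M U \<alpha>" and \<beta>: "gmod_hom ?H U M \<beta>"
    and tr: "\<And>s. s \<in> vecs M \<Longrightarrow> coset_sum G Q (\<lambda>g. act M g (\<beta> (\<alpha> (act M (inv g) s)))) = s"
    using frobenius_summand_imp[OF Q U iso] by blast
  note \<alpha>D = gmod_homD[OF \<alpha>, simplified] and \<beta>D = gmod_homD[OF \<beta>, simplified]
  note r = coset_rep(1)[OF Q]
  have QG: "Q \<subseteq> carrier G" using Q by (rule subgroup.subset)
  have zero: "vecs U \<noteq> {0}"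
  proof
    assume U0: "vecs U = {0}"
    have "s = 0" if s: "s \<in> vecs M" for s
    proof -
      have "act M g (\<beta> (\<alpha> (act M (inv g) s))) = 0" if "g \<in> carrier G" for g
        using \<alpha>D(1)[of "act M (inv g) s"] gmod_hom_zero[OF \<beta> U.zero_vecs] that s U0
        by (simp add: act_closed act_zero)
      then show ?thesis using tr[OF s] by (simp add: coset_sum_def r)
    qed
    then show False using nontriv zero_vecs by blast
  qed
  \<comment> \<open>The trace of a \<open>Q\<close>-endomorphism of \<open>M\<close> is a
    \<open>G\<close>-endomorphism, hence a scalar.\<close>
  have summand: "\<exists>c. \<forall>s\<in>vecs M. coset_sum G Q (\<lambda>g. act M g (\<beta> (\<pi> (\<alpha> (act M (inv g) s))))) = fscale c s"
    (is "\<exists>c. \<forall>s\<in>vecs M. ?T s = fscale c s") if \<pi>: "gmod_hom ?H U U \<pi>" for \<pi>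
  proof -
    have h: "gmod_hom ?H M M (\<lambda>s. \<beta> (\<pi> (\<alpha> s)))"
      by (rule gmod_hom_comp[OF \<alpha> gmod_hom_comp[OF \<pi> \<beta>]])
    note hD = gmod_homD[OF h, simplified]
    have tm: "act M g (\<beta> (\<pi> (\<alpha> (act M (inv g) s)))) \<in> vecs M" if "g \<in> carrier G" "s \<in> vecs M" for g s
      using that by (simp add: act_closed hD(1))
    have "gmod_hom G M M ?T"
    proof (rule gmod_homI)
      show "?T s \<in> vecs M" if "s \<in> vecs M" for s
        using that by (intro coset_sum_vecs[OF Q] tm)
    next
      fix s s' assume "s \<in> vecs M" "s' \<in> vecs M"
      then show "?T (s + s') = ?T s + ?T s'"
        by (subst coset_sum_add[symmetric], intro coset_sum_cong[OF Q])
          (simp add: act_add hD(1,2) act_closed)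
    next
      fix c s assume "s \<in> vecs M"
      then show "?T (fscale c s) = fscale c (?T s)"
        by (subst coset_sum_fscale[symmetric], intro coset_sum_cong[OF Q])
          (simp add: act_scale hD(1,3) act_closed)
    next
      fix x s assume x: "x \<in> carrier G" and s: "s \<in> vecs M"
      let ?F = "\<lambda>g. act M g (\<beta> (\<pi> (\<alpha> (act M (inv g) (act M x s)))))"
      have inv: "?F (g \<otimes> q) = ?F g" if g: "g \<in> carrier G" and q: "q \<in> Q" for g q
      proof -
        have q': "q \<in> carrier G" "inv q \<in> Q" using q QG subgroup.m_inv_closed[OF Q] by auto
        let ?u = "act M (inv g) (act M x s)"
        have u: "?u \<in> vecs M" using g x s by (simp add: act_closed)
        have "act M (inv (g \<otimes> q)) (act M x s) = act M (inv q) ?u"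
          using g q' x s by (simp add: inv_mult_group act_mult act_closed)
        then have "?F (g \<otimes> q) = act M (g \<otimes> q) (act M (inv q) (\<beta> (\<pi> (\<alpha> ?u))))"
          using hD(4)[OF q'(2) u] by simp
        also have "\<dots> = act M g (\<beta> (\<pi> (\<alpha> ?u)))"
          using g q' hD(1)[OF u] by (simp add: act_mult act_closed act_inv_act)
        finally show ?thesis .
      qed
      have "?T (act M x s) = coset_sum G Q (\<lambda>g. ?F (x \<otimes> g))"
        by (rule coset_sum_translate[OF Q x inv, symmetric])
      also have "\<dots> = coset_sum G Q (\<lambda>g. act M x (act M g (\<beta> (\<pi> (\<alpha> (act M (inv g) s))))))"
        by (intro coset_sum_cong[OF Q])
          (simp add: x s inv_mult_group act_mult act_closed act_inv_act hD(1))
      also have "\<dots> = act M x (?T s)"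
        by (intro act_coset_sum[symmetric] Q x tm s)
      finally show "?T (act M x s) = act M x (?T s)" .
    qed
    then show ?thesis using scal unfolding scalar_endomorphisms_def by blast
  qed
  \<comment> \<open>A nonzero scalar could be divided out of \<open>\<beta>\<close>, which would
    make \<open>M\<close> a summand of the module induced from \<open>A\<close>. As \<open>A\<close>
    is a proper submodule, this contradicts the minimal dimension of \<open>U\<close>.\<close>
  have nonzero_summand: "c = 0" if ds: "is_direct_sum ?H U A A'" and A': "A' \<noteq> {0}"
    and \<pi>: "gmod_hom ?H U U \<pi>" "\<And>u. u \<in> vecs U \<Longrightarrow> \<pi> u \<in> A"
    and c: "\<forall>s\<in>vecs M. coset_sum G Q (\<lambda>g. act M g (\<beta> (\<pi> (\<alpha> (act M (inv g) s))))) = fscale c s"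
    for A A' \<pi> c
  proof (rule ccontr)
    assume c0: "c \<noteq> 0"
    have A: "submodule ?H U A" using ds by (simp add: is_direct_sum_def)
    then have Asub: "A \<subseteq> vecs U" "fvs.subspace A" by (simp_all add: submodule_def)
    have UA: "fg_module ?H (U\<lparr>vecs := A\<rparr>)" using A by (rule U.fg_submodule)
    have \<alpha>A: "gmod_hom ?H M (U\<lparr>vecs := A\<rparr>) (\<lambda>s. \<pi> (\<alpha> s))"
      using gmod_hom_comp[OF \<alpha> \<pi>(1)] \<pi>(2) \<alpha>D(1) by (simp add: gmod_hom_def)
    have \<beta>A: "gmod_hom ?H (U\<lparr>vecs := A\<rparr>) M (\<lambda>u. fscale (1/c) (\<beta> u))"
    proof (rule gmod_homI)
      fix g u assume "g \<in> carrier ?H" "u \<in> vecs (U\<lparr>vecs := A\<rparr>)"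
      then show "fscale (1/c) (\<beta> (act (U\<lparr>vecs := A\<rparr>) g u)) = act M g (fscale (1/c) (\<beta> u))"
        using Asub QG by (simp add: \<beta>D subset_iff act_scale)
    qed (use Asub in \<open>simp_all add: \<beta>D subset_iff scale_vecs fvs.scale_right_distrib mult.commute\<close>)
    have "coset_sum G Q (\<lambda>g. act M g (fscale (1/c) (\<beta> (\<pi> (\<alpha> (act M (inv g) s)))))) = s"
      if s: "s \<in> vecs M" for s
    proof -
      have "coset_sum G Q (\<lambda>g. act M g (fscale (1/c) (\<beta> (\<pi> (\<alpha> (act M (inv g) s))))))
        = fscale (1/c) (coset_sum G Q (\<lambda>g. act M g (\<beta> (\<pi> (\<alpha> (act M (inv g) s))))))"
        by (subst coset_sum_fscale[symmetric], intro coset_sum_cong[OF Q])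
          (simp add: act_scale s \<beta>D(1) \<alpha>D(1) gmod_homD(1)[OF \<pi>(1)] act_closed)
      then show ?thesis using c s c0 by simp
    qed
    then have iso': "iso_to_direct_summand G M (induced_module G Q (U\<lparr>vecs := A\<rparr>))"
      by (rule frobenius_imp_summand[OF Q UA \<alpha>A \<beta>A])
    have "A \<noteq> vecs U"
    proof
      assume "A = vecs U"
      moreover have "A' \<subseteq> vecs U" "A \<inter> A' = {0}"
        using ds unfolding is_direct_sum_def submodule_def by blast+
      ultimately show False using A' by blast
    qed
    then have "A \<subset> fvs.span B" using Asub B by blast
    then obtain C where C: "finite C" "A = fvs.span C" "card C < card B"
      by (rule subspace_psubset_span[OF Asub(2) _ B(1)])
    have "P (U\<lparr>vecs := A\<rparr>, C)" using UA iso' C by (simp add: P_def)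
    from min[OF this] C(3) show False unfolding UB_eq by simp
  qed
  have "indecomposable_module ?H U"
    unfolding indecomposable_module_def
  proof (intro conjI allI impI U zero)
    fix A A' assume ds: "is_direct_sum ?H U A A'"
    show "A = {0} \<or> A' = {0}"
    proof (rule ccontr)
      assume neg: "\<not> (A = {0} \<or> A' = {0})"
      obtain \<pi> where \<pi>: "gmod_hom ?H U U \<pi>" "\<And>u. u \<in> vecs U \<Longrightarrow> \<pi> u \<in> A" "\<And>u. u \<in> vecs U \<Longrightarrow> u - \<pi> u \<in> A'"
        using U.direct_sum_projection[OF ds] by metis
      have ds': "is_direct_sum ?H U A' A" using ds by (rule is_direct_sum_commute)
      let ?\<pi>' = "\<lambda>u. u - \<pi> u"
      have \<pi>': "gmod_hom ?H U U ?\<pi>'"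
        by (rule gmod_homI)
          (simp_all add: gmod_homD[OF \<pi>(1)] U.diff_vecs U.act_diff fvs.scale_right_diff_distrib)
      obtain c c' where c: "\<forall>s\<in>vecs M. coset_sum G Q (\<lambda>g. act M g (\<beta> (\<pi> (\<alpha> (act M (inv g) s))))) = fscale c s"
        and c': "\<forall>s\<in>vecs M. coset_sum G Q (\<lambda>g. act M g (\<beta> (?\<pi>' (\<alpha> (act M (inv g) s))))) = fscale c' s"
        using summand[OF \<pi>(1)] summand[OF \<pi>'] by blast
      have "c = 0" using nonzero_summand[OF ds _ \<pi>(1,2) c] neg by blast
      moreover have "c' = 0" using nonzero_summand[OF ds' _ \<pi>' \<pi>(3) c'] neg by blast
      moreover have "s = fscale c s + fscale c' s" if s: "s \<in> vecs M" for s
      proof -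
        have "act M g (\<beta> (\<alpha> (act M (inv g) s)))
          = act M g (\<beta> (\<pi> (\<alpha> (act M (inv g) s)))) + act M g (\<beta> (?\<pi>' (\<alpha> (act M (inv g) s))))"
          if g: "g \<in> carrier G" for g
        proof -
          let ?u = "\<alpha> (act M (inv g) s)"
          have u: "?u \<in> vecs U" using g s by (simp add: \<alpha>D(1) act_closed)
          then have "\<beta> ?u = \<beta> (\<pi> ?u) + \<beta> (?\<pi>' ?u)"
            using \<beta>D(2)[of "\<pi> ?u" "?\<pi>' ?u"] gmod_homD(1)[OF \<pi>(1)] gmod_homD(1)[OF \<pi>'] by simp
          then show ?thesis
            using g u by (simp add: act_add \<beta>D(1) gmod_homD(1)[OF \<pi>(1)] gmod_homD(1)[OF \<pi>'])
        qed
        then have "coset_sum G Q (\<lambda>g. act M g (\<beta> (\<alpha> (act M (inv g) s))))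
          = coset_sum G Q (\<lambda>g. act M g (\<beta> (\<pi> (\<alpha> (act M (inv g) s)))))
            + coset_sum G Q (\<lambda>g. act M g (\<beta> (?\<pi>' (\<alpha> (act M (inv g) s)))))"
          by (subst coset_sum_add[symmetric], intro coset_sum_cong[OF Q])
        then show ?thesis using tr[OF s] c c' s by simp
      qed
      ultimately have "s = 0" if "s \<in> vecs M" for s using that by simp
      then show False using nontriv zero_vecs by blast
    qed
  qed
  then show ?thesis unfolding is_source_def using iso by blast
qed

text \<open>Some vertex and source exist, so the hypothesis yields a trivial \<open>U\<close>,
  spanned by one vector \<open>w\<close>. Written in the coordinate along \<open>w\<close>, the
  trace formula is a resolution of the identity indexed by the left cosets of the vertex.\<close>

lemma trivial_source_permutation_summand:
  assumes scal: "scalar_endomorphisms G M" and ts: "trivial_source_module G M"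
  obtains Y :: "'g set set" and ac v f where "permutation_summand G M Y ac v f"
proof -
  have nontriv: "vecs M \<noteq> {0}"
    using ts by (simp add: trivial_source_module_def indecomposable_module_def)
  obtain Q where Q: "is_vertex G M Q" using exists_vertex by blast
  then have sg: "subgroup Q G" and rp: "relatively_projective G Q M" by (simp_all add: is_vertex_def)
  interpret Q: subgroup Q G by (rule sg)
  obtain U where src: "is_source G M Q U" using exists_source[OF scal nontriv sg rp] by blast
  have triv: "trivial_module (G\<lparr>carrier := Q\<rparr>) U"
    using ts Q src by (simp add: trivial_source_module_def)
  then have U: "fg_module (G\<lparr>carrier := Q\<rparr>) U" and dim: "fvs.dim (vecs U) = 1"
    and actU: "\<And>q u. q \<in> Q \<Longrightarrow> u \<in> vecs U \<Longrightarrow> act U q u = u"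
    by (simp_all add: trivial_module_def)
  interpret U: fg_module "G\<lparr>carrier := Q\<rparr>" U by (rule U)
  have iso: "iso_to_direct_summand G M (induced_module G Q U)" using src by (simp add: is_source_def)
  obtain \<alpha> \<beta> where \<alpha>: "gmod_hom (G\<lparr>carrier := Q\<rparr>) M U \<alpha>" and \<beta>: "gmod_hom (G\<lparr>carrier := Q\<rparr>) U M \<beta>"
    and tr: "\<And>s. s \<in> vecs M \<Longrightarrow> coset_sum G Q (\<lambda>g. act M g (\<beta> (\<alpha> (act M (inv g) s)))) = s"
    using frobenius_summand_imp[OF sg U iso] by blast
  note \<alpha>D = gmod_homD[OF \<alpha>, simplified] and \<beta>D = gmod_homD[OF \<beta>, simplified]
  note r = coset_rep[OF sg]
  obtain B where B: "B \<subseteq> vecs U" "fvs.independent B" "vecs U \<subseteq> fvs.span B" "card B = 1"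
    using fvs.basis_exists[of "vecs U"] dim by metis
  then obtain w where Bw: "B = {w}" by (meson card_1_singletonE)
  have w: "w \<in> vecs U" "w \<noteq> 0" using B Bw by (auto simp: fvs.dependent_single)
  \<comment> \<open>A coordinate in which \<open>w\<close> does not vanish serves to read off
    multiples of \<open>w\<close>.\<close>
  obtain i where i: "w i \<noteq> 0" using w(2) by (auto simp: fun_eq_iff)
  define a where "a s = \<alpha> s i / w i" for s
  have \<alpha>a: "\<alpha> s = fscale (a s) w" if "s \<in> vecs M" for s
  proof -
    have "\<alpha> s \<in> range (\<lambda>k. fscale k w)" using B(3) Bw \<alpha>D(1)[OF that] by (auto simp: fvs.span_singleton)
    then show ?thesis using i by (auto simp: a_def fscale_apply)
  qed
  have a_inv: "a (act M q s) = a s" if "q \<in> Q" "s \<in> vecs M" for q s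
    using that by (simp add: a_def \<alpha>D actU)
  define v where "v c = act M (coset_rep c) (\<beta> w)" for c
  define f where "f c s = a (act M (inv (coset_rep c)) s)" for c s
  have \<beta>w: "\<beta> w \<in> vecs M" "\<And>q. q \<in> Q \<Longrightarrow> act M q (\<beta> w) = \<beta> w"
    using w actU by (simp_all add: \<beta>D(1) \<beta>D(4)[symmetric])
  have vg: "v (g <#\<^bsub>G\<^esub> Q) = act M g (\<beta> w)" if "g \<in> carrier G" for g
    unfolding v_def
    by (rule coset_rep_l_coset[OF sg that, where F = "\<lambda>g. act M g (\<beta> w)"]) (simp add: act_mult \<beta>w)
  have fg: "f (g <#\<^bsub>G\<^esub> Q) s = a (act M (inv g) s)" if "g \<in> carrier G" "s \<in> vecs M" for g s
    unfolding f_def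
    by (rule coset_rep_l_coset[OF sg that(1), where F = "\<lambda>g. a (act M (inv g) s)"])
      (simp add: inv_mult_group act_mult that act_closed a_inv)
  have "permutation_summand G M (left_cosets G Q) (\<lambda>g c. g <#\<^bsub>G\<^esub> c) v f"
  proof unfold_locales
    show "finite (left_cosets G Q)" using finite_group by (simp add: left_cosets_def)
  next
    fix g c assume g: "g \<in> carrier G" and "c \<in> left_cosets G Q"
    then obtain x where x: "x \<in> carrier G" "c = x <#\<^bsub>G\<^esub> Q" by (auto simp: left_cosets_def)
    have gc: "g <#\<^bsub>G\<^esub> c = (g \<otimes> x) <#\<^bsub>G\<^esub> Q" using g x Q.subset by (simp add: lcos_m_assoc)
    then show "g <#\<^bsub>G\<^esub> c \<in> left_cosets G Q" using g x by (simp add: left_cosets_def)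
    show "v (g <#\<^bsub>G\<^esub> c) = act M g (v c)"
      unfolding gc using g x by (simp add: vg act_mult \<beta>w)
    fix s assume "s \<in> vecs M"
    then show "f (g <#\<^bsub>G\<^esub> c) (act M g s) = f c s"
      unfolding gc using g x by (simp add: fg inv_mult_group act_mult act_closed act_inv_act)
  next
    fix c assume "c \<in> left_cosets G Q"
    then obtain x where x: "x \<in> carrier G" "c = x <#\<^bsub>G\<^esub> Q" by (auto simp: left_cosets_def)
    then have sub: "c \<subseteq> carrier G" using Q.subset by (auto simp: l_coset_def)
    then show "\<one> <#\<^bsub>G\<^esub> c = c" by (rule lcos_mult_one)
    show "(g \<otimes> h) <#\<^bsub>G\<^esub> c = g <#\<^bsub>G\<^esub> (h <#\<^bsub>G\<^esub> c)" if "g \<in> carrier G" "h \<in> carrier G" for g h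
      using lcos_m_assoc[OF sub that] by simp
    show "v c \<in> vecs M" using x by (simp add: vg act_closed \<beta>w)
    show "f c (s + s') = f c s + f c s'" if "s \<in> vecs M" "s' \<in> vecs M" for s s'
      using x that by (simp add: fg add_vecs act_add act_closed a_def \<alpha>D add_divide_distrib)
    show "f c (fscale k s) = k * f c s" if "s \<in> vecs M" for k s
      using x that by (simp add: fg scale_vecs act_scale act_closed a_def \<alpha>D fscale_apply)
  next
    fix s assume s: "s \<in> vecs M"
    have "(\<Sum>c\<in>left_cosets G Q. fscale (f c s) (v c)) = coset_sum G Q (\<lambda>g. fscale (a (act M (inv g) s)) (act M g (\<beta> w)))"
      by (simp add: coset_sum_def f_def v_def)
    also have "\<dots> = coset_sum G Q (\<lambda>g. act M g (\<beta> (\<alpha> (act M (inv g) s))))"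
      by (intro coset_sum_cong[OF sg]) (simp add: \<alpha>a act_closed s \<beta>D(3) w act_scale \<beta>w)
    also have "\<dots> = s" using s by (rule tr)
    finally show "(\<Sum>c\<in>left_cosets G Q. fscale (f c s) (v c)) = s" .
  qed
  then show ?thesis using that by blast
qed

end

section \<open>Counting over orbits, and invariants in characteristic p\<close>

lemma card_rel_row:
  assumes "finite A" "finite B" "\<And>x. x \<in> A \<Longrightarrow> card {y \<in> B. R x y} = m"
  shows "card {(x, y). x \<in> A \<and> y \<in> B \<and> R x y} = card A * m"
proof -
  have "{(x, y). x \<in> A \<and> y \<in> B \<and> R x y} = Sigma A (\<lambda>x. {y \<in> B. R x y})" by auto
  then show ?thesis using assms by simp
qed

text \<open>A group element carrying \<open>x0\<close> to \<open>x\<close> maps one fibre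
  bijectively onto the other.\<close>

lemma (in finite_gset) card_orbit_fibre:
  assumes R: "\<And>g x y. g \<in> carrier G \<Longrightarrow> x \<in> Y \<Longrightarrow> y \<in> Y \<Longrightarrow> R (ac g x) (ac g y) \<longleftrightarrow> R x y"
    and x0: "x0 \<in> Y" and x: "x \<in> orb x0" and y0: "y0 \<in> Y"
  shows "card {y \<in> orb y0. R x y} = card {y \<in> orb y0. R x0 y}"
proof -
  obtain g where g: "g \<in> carrier G" "x = ac g x0" using x by (auto simp: orb_def)
  note bij = bij_betw_ac_orb[OF y0 g(1)]
  have Rg: "R x (ac g y) \<longleftrightarrow> R x0 y" if "y \<in> orb y0" for y
    unfolding g(2) using that orb_subset[OF y0] by (intro R[OF g(1) x0]) blast
  have "ac g ` {y \<in> orb y0. R x0 y} = {y \<in> orb y0. R x y}"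
  proof
    show "ac g ` {y \<in> orb y0. R x0 y} \<subseteq> {y \<in> orb y0. R x y}"
      using bij_betwE[OF bij] Rg by auto
    show "{y \<in> orb y0. R x y} \<subseteq> ac g ` {y \<in> orb y0. R x0 y}"
    proof clarify
      fix y assume y: "y \<in> orb y0" "R x y"
      then obtain y' where y': "y' \<in> orb y0" "y = ac g y'"
        using bij_betw_imp_surj_on[OF bij] by blast
      show "y \<in> ac g ` {y \<in> orb y0. R x0 y}"
        unfolding y'(2) by (rule imageI) (use y y' Rg in simp)
    qed
  qed
  then have "bij_betw (ac g) {y \<in> orb y0. R x0 y} {y \<in> orb y0. R x y}"
    by (intro bij_betw_subset[OF bij]) auto
  then show ?thesis by (rule bij_betw_same_card[symmetric])
qed

text \<open>Double counting of the pairs with \<open>F x y = z\<close>, separately for every value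
  \<open>z\<close>. The common factor \<open>d\<close> is cancelled among natural numbers, before
  anything is mapped to the field, where \<open>d\<close> may become zero.\<close>

lemma (in finite_gset) orbital_sums:
  fixes F :: "'y \<Rightarrow> 'y \<Rightarrow> 'k::field"
  assumes F: "\<And>g x y. g \<in> carrier G \<Longrightarrow> x \<in> Y \<Longrightarrow> y \<in> Y \<Longrightarrow> F (ac g x) (ac g y) = F x y"
    and x0: "x0 \<in> Y" and y0: "y0 \<in> Y"
    and d: "card (orb x0) = d * u" "card (orb y0) = d * u'" "d \<noteq> 0"
  shows "of_nat u * (\<Sum>y\<in>orb y0. F x0 y) = of_nat u' * (\<Sum>x\<in>orb x0. F x y0)"
proof -
  have fin: "finite (orb x0)" "finite (orb y0)"
    using x0 y0 orb_subset finite_Y by (meson finite_subset)+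
  have Y: "x \<in> Y" if "x \<in> orb x0 \<or> x \<in> orb y0" for x using that x0 y0 orb_subset by blast
  define A where "A z = card {y \<in> orb y0. F x0 y = z}" for z
  define B where "B z = card {x \<in> orb x0. F x y0 = z}" for z
  have rowA: "card {y \<in> orb y0. F x y = z} = A z" if "x \<in> orb x0" for x z
    unfolding A_def by (rule card_orbit_fibre[OF _ x0 that y0]) (simp add: F)
  have rowB: "card {x \<in> orb x0. F x y = z} = B z" if "y \<in> orb y0" for y z
    unfolding B_def by (rule card_orbit_fibre[OF _ y0 that x0]) (simp add: F)
  have AB: "u * A z = u' * B z" for z
  proof -
    have "card {(x, y). x \<in> orb x0 \<and> y \<in> orb y0 \<and> F x y = z} = card (orb x0) * A z"
      by (rule card_rel_row) (use fin rowA in auto)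
    moreover have "card {(y, x). y \<in> orb y0 \<and> x \<in> orb x0 \<and> F x y = z} = card (orb y0) * B z"
      by (rule card_rel_row) (use fin rowB in auto)
    moreover have "{(y, x). y \<in> orb y0 \<and> x \<in> orb x0 \<and> F x y = z}
      = prod.swap ` {(x, y). x \<in> orb x0 \<and> y \<in> orb y0 \<and> F x y = z}"
      by (auto simp: image_iff)
    then have "card {(y, x). y \<in> orb y0 \<and> x \<in> orb x0 \<and> F x y = z}
      = card {(x, y). x \<in> orb x0 \<and> y \<in> orb y0 \<and> F x y = z}"
      by (simp add: card_image)
    ultimately show ?thesis using d by simp
  qed
  define Zs where "Zs = (\<lambda>(x, y). F x y) ` (orb x0 \<times> orb y0)"
  have "(\<Sum>y\<in>orb y0. F x0 y) = (\<Sum>z\<in>Zs. \<Sum>y | y \<in> orb y0 \<and> F x0 y = z. F x0 y)"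
    using fin orb_self[OF x0] by (intro sum.group[symmetric]) (auto simp: Zs_def)
  also have "\<dots> = (\<Sum>z\<in>Zs. of_nat (A z) * z)"
    by (intro sum.cong refl) (simp add: A_def)
  finally have a: "(\<Sum>y\<in>orb y0. F x0 y) = (\<Sum>z\<in>Zs. of_nat (A z) * z)" .
  have "(\<Sum>x\<in>orb x0. F x y0) = (\<Sum>z\<in>Zs. \<Sum>x | x \<in> orb x0 \<and> F x y0 = z. F x y0)"
    using fin orb_self[OF y0] by (intro sum.group[symmetric]) (auto simp: Zs_def)
  also have "\<dots> = (\<Sum>z\<in>Zs. of_nat (B z) * z)"
    by (intro sum.cong refl) (simp add: B_def)
  finally have b: "(\<Sum>x\<in>orb x0. F x y0) = (\<Sum>z\<in>Zs. of_nat (B z) * z)" .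
  have "of_nat u * of_nat (A z) = (of_nat u' * of_nat (B z) :: 'k)" for z
    using AB[of z] by (metis of_nat_mult)
  then show ?thesis unfolding a b sum_distrib_left by (simp add: mult.assoc[symmetric])
qed

text \<open>\<open>eq\<close> sums \<open>F\<close> over its second argument, \<open>zero\<close>
  over its first. Passing from one to the other amounts to dividing by an orbit size, which is
  impossible for arbitrary orbits in characteristic \<open>p\<close>; \<open>orbital_sums\<close>
  allows it for an orbit chosen by the \<open>p\<close>-part of its size.\<close>

lemma (in finite_gset) invariant_fixed_vector_zero:
  fixes F :: "'y \<Rightarrow> 'y \<Rightarrow> 'k::field"
  assumes p: "CHAR('k) = p" "p > 0"
    and F: "\<And>g x y. g \<in> carrier G \<Longrightarrow> x \<in> Y \<Longrightarrow> y \<in> Y \<Longrightarrow> F (ac g x) (ac g y) = F x y"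
    and c: "\<And>g x. g \<in> carrier G \<Longrightarrow> x \<in> Y \<Longrightarrow> c (ac g x) = c x"
    and eq: "\<And>x. x \<in> Y \<Longrightarrow> c x = (\<Sum>y\<in>Y. F x y * c y)"
    and zero: "\<And>x y. x \<in> Y \<Longrightarrow> y \<in> Y \<Longrightarrow> (\<Sum>z\<in>orb x. F z y) = 0"
    and x: "x \<in> Y"
  shows "c x = 0"
proof (rule ccontr)
  assume "c x \<noteq> 0"
  have prime: "prime p" using prime_CHAR_semidom[where ?'a = 'k] p by simp
  txt \<open>
    An orbit in the support of \<open>c\<close> whose size has minimal \<open>p\<close>-part: then the row sums of \<open>F\<close> over the
    other orbits in the support are, up to a unit, integer multiples of the vanishing column sums.
  \<close>
  let ?P = "\<lambda>x. x \<in> Y \<and> c x \<noteq> 0"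
  have "?P x" using \<open>c x \<noteq> 0\<close> x by simp
  then obtain x0 where x0: "x0 \<in> Y" "c x0 \<noteq> 0"
    and min: "\<And>y. ?P y \<Longrightarrow> multiplicity p (card (orb x0)) \<le> multiplicity p (card (orb y))"
    using ex_has_least_nat[of ?P x "\<lambda>x. multiplicity p (card (orb x))"] by blast
  let ?v = "multiplicity p (card (orb x0))"
  have pos: "card (orb y) \<noteq> 0" if "y \<in> Y" for y
    using that orb_self[OF that] orb_subset[OF that] finite_Y by (metis card_eq_0_iff empty_iff finite_subset)
  obtain u where u: "card (orb x0) = p ^ ?v * u" "\<not> p dvd u"
    using multiplicity_decompose'[of "card (orb x0)" p] pos[OF x0(1)] prime
    by (metis not_prime_unit)
  \<comment> \<open>Over a single orbit \<open>c\<close> is constant and can be taken out of the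
    sum; an orbit on which \<open>c\<close> vanishes requires no information about
    \<open>F\<close>.\<close>
  have inner: "(\<Sum>y | y \<in> Y \<and> orb y = O'. F x0 y * c y) = 0" if O': "O' \<in> orb ` Y" for O'
  proof -
    obtain y0 where y0: "y0 \<in> Y" "O' = orb y0" using O' by blast
    have eqO: "{y \<in> Y. orb y = O'} = orb y0"
      using y0 orb_eq[OF y0(1)] orb_subset[OF y0(1)] orb_self by blast
    have cO: "c y = c y0" if "y \<in> orb y0" for y using that c y0(1) by (auto simp: orb_def)
    have "(\<Sum>y | y \<in> Y \<and> orb y = O'. F x0 y * c y) = (\<Sum>y\<in>orb y0. F x0 y) * c y0"
      unfolding eqO sum_distrib_right by (intro sum.cong refl) (simp add: cO)
    also have "\<dots> = 0"
    proof (cases "c y0 = 0")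
      case False
      then have "p ^ ?v dvd card (orb y0)" using min[of y0] y0(1) by (intro multiplicity_dvd') simp
      then obtain u' where u': "card (orb y0) = p ^ ?v * u'" by blast
      have "of_nat u * (\<Sum>y\<in>orb y0. F x0 y) = of_nat u' * (\<Sum>z\<in>orb x0. F z y0)"
        using p(2) by (intro orbital_sums[where F = F and d = "p ^ ?v"] F x0(1) y0(1) u(1) u') simp_all
      also have "\<dots> = 0" using zero[OF x0(1) y0(1)] by simp
      finally show ?thesis using u(2) p(1) by (simp add: of_nat_eq_0_iff_char_dvd)
    qed simp
    finally show ?thesis .
  qed
  have "c x0 = (\<Sum>O'\<in>orb ` Y. \<Sum>y | y \<in> Y \<and> orb y = O'. F x0 y * c y)"
    unfolding eq[OF x0(1)] using finite_Y by (intro sum.group[symmetric]) auto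
  also have "\<dots> = 0" using inner by (intro sum.neutral) blast
  finally show False using x0(2) by simp
qed

section \<open>Products of differences on two-part tabloids\<close>

definition perm_act :: "(nat \<Rightarrow> nat) \<Rightarrow> (nat set list \<Rightarrow> 'k) \<Rightarrow> nat set list \<Rightarrow> 'k" where
  "perm_act \<sigma> f = (\<lambda>T. f (map (vimage \<sigma>) T))"

lemma act_young_perm_module: "act (young_perm_module \<mu>) = perm_act"
  by (simp add: young_perm_module_def perm_act_def fun_eq_iff)

lemma act_specht_module: "act (specht_module \<mu>) = perm_act"
  by (simp add: specht_module_def act_young_perm_module)

lemma perm_act_linear:
  "perm_act \<sigma> (f + g) = perm_act \<sigma> f + perm_act \<sigma> g"
  "perm_act \<sigma> (f - g) = perm_act \<sigma> f - (perm_act \<sigma> g :: _ \<Rightarrow> 'k::field)"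
  "perm_act \<sigma> (fscale c g) = fscale c (perm_act \<sigma> g)"
  by (simp_all add: perm_act_def fscale_def fun_eq_iff)

lemma perm_act_comp: "perm_act \<sigma> (perm_act \<tau> f) = perm_act (\<sigma> \<circ> \<tau>) f"
  by (simp add: perm_act_def fun_eq_iff vimage_comp comp_def)

abbreviation swap :: "nat \<Rightarrow> nat \<Rightarrow> nat \<Rightarrow> nat" where
  "swap \<equiv> Transposition.transpose"

lemma perm_act_swap_swap: "perm_act (swap a b) (perm_act (swap a b) f) = f"
  unfolding perm_act_comp by (simp add: perm_act_def fun_eq_iff map_idI)

lemma swap_swap_disjoint:
  assumes "{a, b} \<inter> {c, d} = {}"
  shows "swap a b \<circ> swap c d = swap c d \<circ> swap a b"
  using assms by (intro swap_id_independent) auto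

section \<open>Lists of disjoint pairs\<close>

definition points :: "('a \<times> 'a) list \<Rightarrow> 'a set" where
  "points ps = fst ` set ps \<union> snd ` set ps"

lemma points_simps [simp]:
  "points [] = {}" "points (p # ps) = insert (fst p) (insert (snd p) (points ps))"
  "points (ps @ qs) = points ps \<union> points qs"
  by (auto simp: points_def)

definition disjoint_pairs :: "('a \<times> 'a) list \<Rightarrow> bool" where
  "disjoint_pairs ps \<longleftrightarrow> distinct (map fst ps @ map snd ps)"

lemma disjoint_pairs_simps [simp]:
  "disjoint_pairs []"
  "disjoint_pairs (p # ps) \<longleftrightarrow> fst p \<noteq> snd p \<and> fst p \<notin> points ps \<and> snd p \<notin> points ps \<and> disjoint_pairs ps"
  "disjoint_pairs (ps @ qs) \<longleftrightarrow> disjoint_pairs ps \<and> disjoint_pairs qs \<and> points ps \<inter> points qs = {}"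
  by (auto simp: disjoint_pairs_def points_def)

lemma in_points_pair:
  assumes "a \<in> points ps"
  obtains b where "(a, b) \<in> set ps \<or> (b, a) \<in> set ps"
  using assms by (force simp: points_def)

lemma pair_in_points: "(a, b) \<in> set ps \<Longrightarrow> a \<in> points ps \<and> b \<in> points ps"
  by (force simp: points_def)

lemma disjoint_pairs_neq: "disjoint_pairs ps \<Longrightarrow> (a, b) \<in> set ps \<Longrightarrow> a \<noteq> b"
  by (induction ps) auto

lemma disjoint_pairs_distinct: "disjoint_pairs ps \<Longrightarrow> distinct ps"
  by (simp add: disjoint_pairs_def distinct_map)

lemma disjoint_pairs_eq_or_disjoint:
  "disjoint_pairs ps \<Longrightarrow> (a, b) \<in> set ps \<Longrightarrow> (c, d) \<in> set ps \<Longrightarrow> (a, b) = (c, d) \<or> {a, b} \<inter> {c, d} = {}"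
  by (induction ps) (auto dest: pair_in_points)

text \<open>The listed points correspond position by position, and their complements in
  \<open>A\<close> have equal size, so any bijection of the complements completes the permutation.
  Products over equally many pairs are thereby conjugate under the symmetric group.\<close>

lemma exists_permutation_map_pairs:
  assumes "disjoint_pairs ps" "disjoint_pairs qs" "length ps = length qs" "finite A"
    "points ps \<subseteq> A" "points qs \<subseteq> A"
  obtains \<sigma> where "\<sigma> permutes A" "map (map_prod \<sigma> \<sigma>) ps = qs"
proof -
  let ?xs = "map fst ps @ map snd ps" and ?ys = "map fst qs @ map snd qs"
  have d: "distinct ?xs" "distinct ?ys" "length ?xs = length ?ys"
    and sub: "set ?xs \<subseteq> A" "set ?ys \<subseteq> A"
    using assms by (auto simp: disjoint_pairs_def points_def)
  define h where "h x = ?ys ! (THE i. i < length ?xs \<and> ?xs ! i = x)" for x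
  have h: "h (?xs ! i) = ?ys ! i" if "i < length ?xs" for i
  proof -
    have "(THE i'. i' < length ?xs \<and> ?xs ! i' = ?xs ! i) = i"
      using that nth_eq_iff_index_eq[OF d(1)] by (intro the_equality) blast+
    then show ?thesis by (simp add: h_def)
  qed
  have mh: "map h ?xs = ?ys"
    by (rule nth_equalityI) (use d(3) h in \<open>auto simp del: map_append\<close>)
  have bij1: "bij_betw h (set ?xs) (set ?ys)"
  proof -
    have "inj_on h (set ?xs)"
      using d(2) mh by (metis distinct_map)
    moreover have "h ` set ?xs = set ?ys" using mh by (metis set_map)
    ultimately show ?thesis by (simp add: bij_betw_def)
  qed
  have "card (A - set ?xs) = card (A - set ?ys)"
    using sub d assms(4) by (metis card_Diff_subset distinct_card finite_set)
  then obtain k where k: "bij_betw k (A - set ?xs) (A - set ?ys)"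
    using assms(4) by (meson finite_Diff finite_same_card_bij)
  define \<sigma> where "\<sigma> x = (if x \<in> set ?xs then h x else if x \<in> A then k x else x)" for x
  have b1: "bij_betw \<sigma> (set ?xs) (set ?ys)"
    using bij1 by (rule bij_betw_cong[THEN iffD1, rotated]) (simp add: \<sigma>_def)
  have b2: "bij_betw \<sigma> (A - set ?xs) (A - set ?ys)"
    using k by (rule bij_betw_cong[THEN iffD1, rotated]) (simp add: \<sigma>_def)
  have "bij_betw \<sigma> (set ?xs \<union> (A - set ?xs)) (set ?ys \<union> (A - set ?ys))"
    using b1 b2 by (rule bij_betw_combine) blast
  then have "bij_betw \<sigma> A A" using sub by (simp add: Un_Diff_cancel Un_absorb1)
  then have "\<sigma> permutes A"
    by (rule bij_imp_permutes) (use sub in \<open>auto simp: \<sigma>_def\<close>)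
  moreover have "map \<sigma> ?xs = map h ?xs"
    by (rule map_cong[OF refl]) (simp add: \<sigma>_def)
  then have "map \<sigma> ?xs = ?ys" using mh by (rule trans)
  then have "map \<sigma> (map fst ps) = map fst qs" "map \<sigma> (map snd ps) = map snd qs"
    using assms(3) by (simp_all add: append_eq_append_conv)
  then have "map (map_prod \<sigma> \<sigma>) ps = qs"
    by (intro nth_equalityI) (use assms(3) in \<open>auto simp: list_eq_iff_nth_eq prod_eq_iff\<close>)
  ultimately show ?thesis using that by blast
qed

text \<open>The empty default is the right value for \<open>r = 0\<close>, where the shape is
  \<open>[n]\<close> and a tabloid has a single row.\<close>

definition second_row :: "nat set list \<Rightarrow> nat set" where
  "second_row T = (if length T > 1 then T ! 1 else {})"

lemma second_row_map: "second_row (map (vimage \<sigma>) T) = \<sigma> -` second_row T"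
  by (simp add: second_row_def)

text \<open>The factor contributed by one column: antisymmetric in the two points, and zero when
  \<open>x\<close> contains both or neither of them.\<close>

definition diff_ind :: "nat \<times> nat \<Rightarrow> nat set \<Rightarrow> 'k::field" where
  "diff_ind p x = of_bool (snd p \<in> x) - of_bool (fst p \<in> x)"

lemma diff_ind_swap: "diff_ind (b, a) x = - diff_ind (a, b) x"
  by (simp add: diff_ind_def)

lemma diff_ind_vimage: "diff_ind p (\<sigma> -` x) = diff_ind (map_prod \<sigma> \<sigma> p) x"
  by (simp add: diff_ind_def)

locale two_part_tabloids =
  fixes n r :: nat and ty :: "'k::field itself"
  assumes two_r_le: "2 * r \<le> n" and two_neq_0: "(2 :: 'k) \<noteq> 0"
begin

abbreviation X :: "nat set list set" where "X \<equiv> tabloids (two_part n r)"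
abbreviation G where "G \<equiv> sym_group n"
abbreviation M :: "(nat \<Rightarrow> nat, nat set list, 'k) gmod" where "M \<equiv> young_perm_module (two_part n r)"
abbreviation S :: "(nat \<Rightarrow> nat, nat set list, 'k) gmod" where "S \<equiv> specht_module (two_part n r)"

lemma sum_list_two_part [simp]: "sum_list (two_part n r) = n"
  using two_r_le by (simp add: two_part_def)

lemma young_diagram_two_part: "young_diagram (two_part n r) = {(0, j) | j. j < n - r} \<union> {(1, j) | j. j < r}"
  by (auto simp: young_diagram_def two_part_def less_Suc_eq split: if_splits)

lemma tabloid_of_two_part:
  "tabloid_of (two_part n r) t = (\<lambda>j. t (0, j)) ` {..<n - r} # (if r = 0 then [] else [(\<lambda>j. t (1, j)) ` {..<r}])"
  by (simp add: tabloid_of_def two_part_def upt_rec)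

lemma second_row_tabloid_of: "second_row (tabloid_of (two_part n r) t) = (\<lambda>j. t (1, j)) ` {..<r}"
  by (simp add: second_row_def tabloid_of_two_part)

lemma tableauD:
  assumes "tableau (two_part n r) t"
  shows "inj_on (\<lambda>j. t (1, j)) {..<r}" "inj_on (\<lambda>j. t (0, j)) {..<n - r}"
    "(\<lambda>j. t (0, j)) ` {..<n - r} \<inter> (\<lambda>j. t (1, j)) ` {..<r} = {}"
    "(\<lambda>j. t (0, j)) ` {..<n - r} \<union> (\<lambda>j. t (1, j)) ` {..<r} = {1..n}"
proof -
  have bij: "bij_betw t ({(0, j) | j. j < n - r} \<union> {(1, j) | j. j < r}) {1..n}"
    using assms by (simp add: tableau_def young_diagram_two_part)
  then have inj: "inj_on t ({(0, j) | j. j < n - r} \<union> {(1, j) | j. j < r})" by (rule bij_betw_imp_inj_on)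
  show "inj_on (\<lambda>j. t (1, j)) {..<r}" "inj_on (\<lambda>j. t (0, j)) {..<n - r}"
    by (auto intro!: inj_onI dest: inj_onD[OF inj])
  show "(\<lambda>j. t (0, j)) ` {..<n - r} \<inter> (\<lambda>j. t (1, j)) ` {..<r} = {}"
    by (auto dest: inj_onD[OF inj])
  have "t ` ({(0, j) | j. j < n - r} \<union> {(1, j) | j. j < r}) = {1..n}"
    using bij by (rule bij_betw_imp_surj_on)
  moreover have "t ` ({(0, j) | j. j < n - r} \<union> {(1, j) | j. j < r})
    = (\<lambda>j. t (0, j)) ` {..<n - r} \<union> (\<lambda>j. t (1, j)) ` {..<r}" by auto
  ultimately show "(\<lambda>j. t (0, j)) ` {..<n - r} \<union> (\<lambda>j. t (1, j)) ` {..<r} = {1..n}" by simp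
qed

lemma second_row_subset:
  assumes "T \<in> X"
  shows "second_row T \<subseteq> {1..n}"
proof -
  obtain t where t: "tableau (two_part n r) t" "T = tabloid_of (two_part n r) t"
    using assms by (auto simp: tabloids_def)
  show ?thesis unfolding t(2) second_row_tabloid_of using tableauD(4)[OF t(1)] by blast
qed

lemma card_second_row:
  assumes "T \<in> X"
  shows "card (second_row T) = r"
proof -
  obtain t where t: "tableau (two_part n r) t" "T = tabloid_of (two_part n r) t"
    using assms by (auto simp: tabloids_def)
  show ?thesis unfolding t(2) second_row_tabloid_of using tableauD(1)[OF t(1)] by (simp add: card_image)
qed

lemma finite_second_row: "T \<in> X \<Longrightarrow> finite (second_row T)"
  using second_row_subset finite_subset by blast

text \<open>The rows partition \<open>{1..n}\<close>, so the second determines the first. Functions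
  on tabloids may thus be treated as functions of a set with \<open>r\<close> elements.\<close>

lemma tabloid_eqI:
  assumes "T \<in> X" "T' \<in> X" "second_row T = second_row T'"
  shows "T = T'"
proof -
  have *: "T = (if r = 0 then [{1..n}] else [{1..n} - second_row T, second_row T])" if T: "T \<in> X" for T
  proof -
    obtain t where t: "tableau (two_part n r) t" "T = tabloid_of (two_part n r) t"
      using T by (auto simp: tabloids_def)
    have "(\<lambda>j. t (0, j)) ` {..<n - r} = {1..n} - (\<lambda>j. t (1, j)) ` {..<r}"
      using tableauD(3,4)[OF t(1)] by blast
    then show ?thesis
      unfolding t(2) second_row_tabloid_of tabloid_of_two_part by (simp add: second_row_def)
  qed
  show ?thesis using *[OF assms(1)] *[OF assms(2)] assms(3) by metis
qed

lemma map_vimage_tabloid: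
  assumes "\<sigma> permutes {1..n}" "T \<in> X"
  shows "map (vimage \<sigma>) T \<in> X"
proof -
  obtain t where t: "tableau (two_part n r) t" "T = tabloid_of (two_part n r) t"
    using assms(2) by (auto simp: tabloids_def)
  have "map (vimage \<sigma>) T = map (image (inv_into UNIV \<sigma>)) T"
    using permutes_bij[OF assms(1)] by (simp add: bij_vimage_eq_inv_image)
  also have "\<dots> = tabloid_of (two_part n r) (inv_into UNIV \<sigma> \<circ> t)"
    unfolding t(2) by (rule tabloid_of_comp[symmetric])
  finally show ?thesis
    using tableau_comp[of "inv_into UNIV \<sigma>" "two_part n r" t] t(1) permutes_inv[OF assms(1)]
    by (auto simp: tabloids_def)
qed

lemma map_vimage_tabloid_iff:
  assumes "\<sigma> permutes {1..n}"
  shows "map (vimage \<sigma>) T \<in> X \<longleftrightarrow> T \<in> X"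
proof
  assume "map (vimage \<sigma>) T \<in> X"
  then have "map (vimage (inv_into UNIV \<sigma>)) (map (vimage \<sigma>) T) \<in> X"
    using permutes_inv[OF assms] by (rule map_vimage_tabloid[rotated])
  then show "T \<in> X"
    using permutes_inverses(1)[OF assms] by (simp add: vimage_comp comp_def map_idI)
qed (rule map_vimage_tabloid[OF assms])

lemma vecs_M: "vecs M = {f. \<forall>T. T \<notin> X \<longrightarrow> f T = 0}"
proof
  have sub: "fvs.subspace {f :: nat set list \<Rightarrow> 'k. \<forall>T. T \<notin> X \<longrightarrow> f T = 0}"
    by (auto simp: fvs.subspace_def fscale_def)
  show "vecs M \<subseteq> {f. \<forall>T. T \<notin> X \<longrightarrow> f T = 0}"
    unfolding young_perm_module_def gmod.simps
    by (rule fvs.span_minimal[OF _ sub]) (auto simp: basis_vec_def)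
  show "{f. \<forall>T. T \<notin> X \<longrightarrow> f T = 0} \<subseteq> vecs M"
  proof clarify
    fix f :: "nat set list \<Rightarrow> 'k" assume f: "\<forall>T. T \<notin> X \<longrightarrow> f T = 0"
    have "f = (\<Sum>T\<in>X. fscale (f T) (basis_vec T))"
    proof
      fix T
      have "(\<Sum>T'\<in>X. fscale (f T') (basis_vec T')) T = (\<Sum>T'\<in>X. if T = T' then f T' else 0)"
        unfolding sum_apply_fun by (intro sum.cong refl) (simp add: fscale_def basis_vec_def)
      also have "\<dots> = f T" using f finite_tabloids by simp
      finally show "f T = (\<Sum>T'\<in>X. fscale (f T') (basis_vec T')) T" ..
    qed
    also have "\<dots> \<in> fvs.span (basis_vec ` X)"
      by (intro fvs.span_sum fvs.span_scale fvs.span_base imageI)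
    finally show "f \<in> vecs M" by (simp add: young_perm_module_def)
  qed
qed

lemma perm_act_vecs_M: "\<sigma> permutes {1..n} \<Longrightarrow> f \<in> vecs M \<Longrightarrow> perm_act \<sigma> f \<in> vecs M"
  by (simp add: vecs_M perm_act_def map_vimage_tabloid_iff)

text \<open>Cut off outside \<open>X\<close> in order to lie in the Young module. The list may have
  fewer than \<open>r\<close> entries; these shorter products are what detects proper
  submodules.\<close>

definition pair_prod :: "(nat \<times> nat) list \<Rightarrow> nat set list \<Rightarrow> 'k" where
  "pair_prod ps T = (if T \<in> X then (\<Prod>p\<leftarrow>ps. diff_ind p (second_row T)) else 0)"

lemma pair_prod_vecs_M: "pair_prod ps \<in> vecs M"
  by (simp add: vecs_M pair_prod_def)

lemma perm_act_pair_prod: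
  assumes "\<sigma> permutes {1..n}"
  shows "perm_act \<sigma> (pair_prod ps) = pair_prod (map (map_prod \<sigma> \<sigma>) ps)"
  by (simp add: perm_act_def pair_prod_def fun_eq_iff map_vimage_tabloid_iff[OF assms]
      second_row_map diff_ind_vimage comp_def)

definition valid_pairs :: "(nat \<times> nat) list \<Rightarrow> bool" where
  "valid_pairs ps \<longleftrightarrow> disjoint_pairs ps \<and> points ps \<subseteq> {1..n}"

lemma swap_permutes: "a \<in> {1..n} \<Longrightarrow> b \<in> {1..n} \<Longrightarrow> swap a b permutes {1..n}"
  by (rule permutes_swap_id)

lemma valid_pairs_swap_permutes: "valid_pairs ps \<Longrightarrow> (a, b) \<in> set ps \<Longrightarrow> swap a b permutes {1..n}"
  using pair_in_points[of a b ps] by (intro swap_permutes) (auto simp: valid_pairs_def)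

lemma map_swap_fix:
  assumes "a \<notin> points ps" "b \<notin> points ps"
  shows "map (map_prod (swap a b) (swap a b)) ps = ps"
proof (rule map_idI)
  fix p assume "p \<in> set ps"
  then have "fst p \<in> points ps" "snd p \<in> points ps" by (auto simp: points_def)
  then have "fst p \<noteq> a" "fst p \<noteq> b" "snd p \<noteq> a" "snd p \<noteq> b" using assms by auto
  then show "map_prod (swap a b) (swap a b) p = p"
    by (cases p) simp
qed

lemma pair_prod_flip: "pair_prod ((b, a) # ps) = fscale (-1) (pair_prod ((a, b) # ps))"
  by (simp add: pair_prod_def fun_eq_iff fscale_def diff_ind_swap[of b a])

lemma pair_prod_perm: "mset ps = mset qs \<Longrightarrow> pair_prod ps = pair_prod qs"
proof (rule ext)
  fix T assume "mset ps = mset qs"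
  then have "(\<Prod>p\<leftarrow>ps. diff_ind p (second_row T)) = (\<Prod>p\<leftarrow>qs. diff_ind p (second_row T) :: 'k)"
    by (metis mset_map prod_mset_prod_list)
  then show "pair_prod ps T = pair_prod qs T" by (simp add: pair_prod_def)
qed

lemma pair_prod_alternating:
  assumes "valid_pairs ps" "(a, b) \<in> set ps"
  shows "perm_act (swap a b) (pair_prod ps) = fscale (-1) (pair_prod ps)"
proof -
  obtain xs ys where ps: "ps = xs @ (a, b) # ys" using assms(2) by (meson split_list)
  have eq: "pair_prod ps = pair_prod ((a, b) # xs @ ys)" by (rule pair_prod_perm) (simp add: ps)
  have "a \<notin> points (xs @ ys)" "b \<notin> points (xs @ ys)"
    using assms(1) by (auto simp: valid_pairs_def ps)
  then have "perm_act (swap a b) (pair_prod ((a, b) # xs @ ys)) = pair_prod ((b, a) # xs @ ys)"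
    unfolding perm_act_pair_prod[OF valid_pairs_swap_permutes[OF assms]]
    by (simp add: map_swap_fix del: map_append points_simps)
  also have "\<dots> = fscale (-1) (pair_prod ((a, b) # xs @ ys))" by (rule pair_prod_flip)
  finally show ?thesis unfolding eq .
qed

section \<open>Antisymmetrisation of products\<close>

definition anti :: "nat \<Rightarrow> nat \<Rightarrow> (nat set list \<Rightarrow> 'k) \<Rightarrow> nat set list \<Rightarrow> 'k" where
  "anti a b f = f - perm_act (swap a b) f"

lemma anti_linear: "anti a b (f + g) = anti a b f + anti a b g" "anti a b (fscale c f) = fscale c (anti a b f)"
  by (simp_all add: anti_def perm_act_linear fvs.scale_right_diff_distrib)

text \<open>The factors commute, so the pair containing \<open>a\<close> can be moved to the front;
  the sign \<open>s\<close> records whether it had to be reversed. The prefix \<open>qs\<close>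
  stays intact.\<close>

lemma pair_prod_front:
  assumes "valid_pairs (qs @ ps)" "a \<in> points ps"
  obtains d rest s where "pair_prod (qs @ ps) = fscale s (pair_prod ((a, d) # qs @ rest))"
    "valid_pairs ((a, d) # qs @ rest)" "length ps = Suc (length rest)" "insert a (insert d (points rest)) = points ps"
proof -
  obtain d where d: "(a, d) \<in> set ps \<or> (d, a) \<in> set ps" using assms(2) by (rule in_points_pair)
  then show ?thesis
  proof
    assume "(a, d) \<in> set ps"
    then obtain xs ys where ps: "ps = xs @ (a, d) # ys" by (meson split_list)
    have "pair_prod (qs @ ps) = pair_prod ((a, d) # qs @ xs @ ys)" by (rule pair_prod_perm) (simp add: ps)
    then show ?thesis using assms(1)
      by (intro that[of 1 d "xs @ ys"]) (auto simp: valid_pairs_def ps)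
  next
    assume "(d, a) \<in> set ps"
    then obtain xs ys where ps: "ps = xs @ (d, a) # ys" by (meson split_list)
    have "pair_prod (qs @ ps) = pair_prod ((d, a) # qs @ xs @ ys)" by (rule pair_prod_perm) (simp add: ps)
    also have "\<dots> = fscale (-1) (pair_prod ((a, d) # qs @ xs @ ys))" by (rule pair_prod_flip)
    finally show ?thesis using assms(1)
      by (intro that[of "-1" d "xs @ ys"]) (auto simp: valid_pairs_def ps)
  qed
qed

text \<open>With \<open>A\<close>, \<open>B\<close>, \<open>D\<close>, \<open>E\<close> the
  indicators of the four points, this is the three-term identity
  \<open>(E - B) (D - A) - (E - A) (D - B) = (B - A) (E - D)\<close>. It treats an
  antisymmetrisation whose two points lie in different pairs.\<close>

lemma pair_prod_pluecker:
  "pair_prod ((b, e) # (a, d) # ps) - pair_prod ((a, e) # (b, d) # ps) = pair_prod ((a, b) # (d, e) # ps)"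
proof
  fix T
  have key: "(E - B) * ((D - A) * q) - (E - A) * ((D - B) * q) = (B - A) * ((E - D) * q)" for A B D E q :: 'k
    by (simp add: algebra_simps)
  show "(pair_prod ((b, e) # (a, d) # ps) - pair_prod ((a, e) # (b, d) # ps)) T = pair_prod ((a, b) # (d, e) # ps) T"
    unfolding minus_apply pair_prod_def diff_ind_def list.map prod_list.Cons fst_conv snd_conv key
    by (simp only: key diff_self split: if_split) simp
qed

lemma anti_pair_prod_Cons:
  assumes "a \<in> {1..n}" "b \<in> {1..n}" "a \<notin> points ps" "b \<notin> points ps" "d \<noteq> a" "d \<noteq> b"
  shows "anti a b (pair_prod ((a, d) # ps)) = pair_prod ((a, b) # ps)"
proof -
  have "perm_act (swap a b) (pair_prod ((a, d) # ps)) = pair_prod ((b, d) # ps)"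
    unfolding perm_act_pair_prod[OF swap_permutes[OF assms(1,2)]]
    using assms by (simp add: map_swap_fix)
  then show ?thesis
    by (simp add: anti_def fun_eq_iff pair_prod_def diff_ind_def algebra_simps)
qed

text \<open>Antisymmetrising creates the pair \<open>(a, b)\<close> and keeps the number of pairs,
  unless the result is zero. If neither point occurs in \<open>ps\<close> the result is zero; a
  single occurrence has its partner replaced; a pair made of both points gives a factor 2 up to
  sign; points in two different pairs are recoupled by \<open>pair_prod_pluecker\<close>.\<close>

lemma anti_pair_prod:
  assumes "valid_pairs (qs @ ps)" "a \<in> {1..n}" "b \<in> {1..n}" "a \<noteq> b" "a \<notin> points qs" "b \<notin> points qs"
  shows "\<exists>c rest. anti a b (pair_prod (qs @ ps)) = fscale c (pair_prod ((a, b) # qs @ rest)) \<and>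
    (c \<noteq> 0 \<longrightarrow> valid_pairs ((a, b) # qs @ rest) \<and> length ps = Suc (length rest))"
proof -
  note \<tau> = swap_permutes[OF assms(2,3)]
  \<comment> \<open>Exactly one of the two points occurs. Exchanging the roles of \<open>a\<close>
    and \<open>b\<close> only costs a sign, so one argument serves both cases.\<close>
  have split1: ?thesis
    if a': "a' \<in> points ps" and b': "b' \<notin> points ps" and ab: "(a', b') = (a, b) \<or> (a', b') = (b, a)" for a' b'
  proof -
    have a'b': "a' \<in> {1..n}" "b' \<in> {1..n}" "a' \<notin> points qs" "b' \<notin> points qs" "a' \<noteq> b'"
      using ab assms by auto
    obtain d rest s where f: "pair_prod (qs @ ps) = fscale s (pair_prod ((a', d) # qs @ rest))"
      "valid_pairs ((a', d) # qs @ rest)" "length ps = Suc (length rest)" "insert a' (insert d (points rest)) = points ps"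
      by (rule pair_prod_front[OF assms(1) a'])
    have "b' \<noteq> d" "b' \<notin> points rest" using b' f(4) by auto
    then have *: "anti a' b' (pair_prod (qs @ ps)) = fscale s (pair_prod ((a', b') # qs @ rest))"
      unfolding f(1) anti_linear using f(2) a'b'
      by (subst anti_pair_prod_Cons) (auto simp: valid_pairs_def)
    have v: "valid_pairs ((a', b') # qs @ rest)"
      using f(2) a'b' \<open>b' \<notin> points rest\<close> by (auto simp: valid_pairs_def)
    show ?thesis
    proof (cases "(a', b') = (a, b)")
      case True
      then show ?thesis using * v f(3) by auto
    next
      case False
      then have eq: "a' = b" "b' = a" using ab by auto
      have "anti a b = anti b a" by (simp add: anti_def transpose_commute fun_eq_iff)
      then have "anti a b (pair_prod (qs @ ps)) = fscale (s * -1) (pair_prod ((a, b) # qs @ rest))"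
        using * unfolding eq pair_prod_flip[of b a] by simp
      moreover have "valid_pairs ((a, b) # qs @ rest)" using v unfolding eq by (auto simp: valid_pairs_def)
      ultimately show ?thesis using f(3) by blast
    qed
  qed
  show ?thesis
  proof (cases "a \<in> points ps")
    case a: True
    show ?thesis
    proof (cases "b \<in> points ps")
      case True
      obtain d rest s where f: "pair_prod (qs @ ps) = fscale s (pair_prod ((a, d) # qs @ rest))"
        "valid_pairs ((a, d) # qs @ rest)" "length ps = Suc (length rest)" "insert a (insert d (points rest)) = points ps"
        by (rule pair_prod_front[OF assms(1) a])
      show ?thesis
      proof (cases "d = b")
        case True
        have "perm_act (swap a b) (pair_prod ((a, d) # qs @ rest)) = fscale (-1) (pair_prod ((a, d) # qs @ rest))"
          using True by (intro pair_prod_alternating f(2)) simp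
        then have "anti a b (pair_prod (qs @ ps)) = fscale (2 * s) (pair_prod ((a, b) # qs @ rest))"
          unfolding f(1) anti_linear True by (simp add: anti_def fun_eq_iff fscale_def algebra_simps)
        then show ?thesis using f(2,3) unfolding True by blast
      next
        case False
        then have "b \<in> points rest" using True f(4) assms(4) by auto
        have v': "valid_pairs (((a, d) # qs) @ rest)" using f(2) by simp
        obtain e rest' s' where g: "pair_prod (((a, d) # qs) @ rest) = fscale s' (pair_prod ((b, e) # ((a, d) # qs) @ rest'))"
          "valid_pairs ((b, e) # ((a, d) # qs) @ rest')" "length rest = Suc (length rest')"
          by (rule pair_prod_front[OF v' \<open>b \<in> points rest\<close>])
        have ne: "e \<noteq> a" "e \<noteq> b" "d \<noteq> a" "d \<noteq> b" "a \<notin> points (qs @ rest')" "b \<notin> points (qs @ rest')"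
          using g(2) False assms(4) by (auto simp: valid_pairs_def)
        have "perm_act (swap a b) (pair_prod ((b, e) # ((a, d) # qs) @ rest')) = pair_prod ((a, e) # (b, d) # qs @ rest')"
          unfolding perm_act_pair_prod[OF \<tau>]
          using ne map_swap_fix[of a qs b] map_swap_fix[of a rest' b] by simp
        then have "anti a b (pair_prod ((b, e) # ((a, d) # qs) @ rest')) = pair_prod ((a, b) # (d, e) # qs @ rest')"
          using pair_prod_pluecker[of b e a d "qs @ rest'"] by (simp only: anti_def append_Cons)
        also have "\<dots> = pair_prod ((a, b) # qs @ (d, e) # rest')" by (rule pair_prod_perm) simp
        finally have "anti a b (pair_prod (qs @ ps)) = fscale (s * s') (pair_prod ((a, b) # qs @ (d, e) # rest'))"
          unfolding f(1) using g(1) by (simp add: anti_linear)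
        moreover have "valid_pairs ((a, b) # qs @ (d, e) # rest')"
          using g(2) ne assms by (auto simp: valid_pairs_def)
        ultimately show ?thesis using f(3) g(3)
          by (intro exI[of _ "s * s'"] exI[of _ "(d, e) # rest'"]) simp
      qed
    qed (use a split1[of a b] in simp)
  next
    case a: False
    show ?thesis
    proof (cases "b \<in> points ps")
      case False
      then have "perm_act (swap a b) (pair_prod (qs @ ps)) = pair_prod (qs @ ps)"
        unfolding perm_act_pair_prod[OF \<tau>] using a assms(5,6) by (simp add: map_swap_fix)
      then show ?thesis by (intro exI[of _ 0] exI[of _ "[]"]) (simp add: anti_def)
    qed (use a split1[of b a] in simp)
  qed
qed

fun anti_pairs :: "(nat \<times> nat) list \<Rightarrow> (nat set list \<Rightarrow> 'k) \<Rightarrow> nat set list \<Rightarrow> 'k" where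
  "anti_pairs [] f = f"
| "anti_pairs (q # qs) f = anti (fst q) (snd q) (anti_pairs qs f)"

lemma anti_pairs_linear:
  "anti_pairs qs (f + g) = anti_pairs qs f + anti_pairs qs g"
  "anti_pairs qs (fscale c f) = fscale c (anti_pairs qs f)"
  by (induction qs) (simp_all add: anti_linear)

text \<open>The conserved number of pairs is the point: starting from \<open>r\<close> factors with
  fewer than \<open>r\<close> pairs in \<open>qs\<close>, a nonzero result must have a further pair
  in \<open>rest\<close>.\<close>

lemma anti_pairs_pair_prod:
  assumes "valid_pairs qs" "valid_pairs ps"
  obtains c rest where "anti_pairs qs (pair_prod ps) = fscale c (pair_prod (qs @ rest))"
    "c \<noteq> 0 \<Longrightarrow> valid_pairs (qs @ rest) \<and> length ps = length qs + length rest"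
proof -
  have "\<exists>c rest. anti_pairs qs (pair_prod ps) = fscale c (pair_prod (qs @ rest)) \<and>
    (c \<noteq> 0 \<longrightarrow> valid_pairs (qs @ rest) \<and> length ps = length qs + length rest)"
    using assms(1)
  proof (induction qs)
    case Nil
    show ?case by (rule exI[of _ 1], rule exI[of _ ps]) (simp add: assms(2))
  next
    case (Cons q qs)
    obtain a b where q: "q = (a, b)" by (cases q)
    have ab: "a \<in> {1..n}" "b \<in> {1..n}" "a \<noteq> b" "a \<notin> points qs" "b \<notin> points qs" "valid_pairs qs"
      using Cons.prems by (auto simp: q valid_pairs_def)
    obtain c rest where IH: "anti_pairs qs (pair_prod ps) = fscale c (pair_prod (qs @ rest))"
      "c \<noteq> 0 \<longrightarrow> valid_pairs (qs @ rest) \<and> length ps = length qs + length rest"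
      using Cons.IH ab by blast
    show ?case
    proof (cases "c = 0")
      case True
      then have "anti_pairs (q # qs) (pair_prod ps) = fscale 0 (pair_prod ((q # qs) @ []))"
        using IH(1) by (simp add: anti_def perm_act_def fun_eq_iff fscale_def)
      then show ?thesis by blast
    next
      case False
      then have v: "valid_pairs (qs @ rest)" "length ps = length qs + length rest" using IH(2) by auto
      obtain c' rest' where *: "anti a b (pair_prod (qs @ rest)) = fscale c' (pair_prod ((a, b) # qs @ rest'))"
        "c' \<noteq> 0 \<longrightarrow> valid_pairs ((a, b) # qs @ rest') \<and> length rest = Suc (length rest')"
        using anti_pair_prod[OF v(1) ab(1-5)] by blast
      have "anti_pairs (q # qs) (pair_prod ps) = fscale (c * c') (pair_prod ((q # qs) @ rest'))"
        unfolding anti_pairs.simps IH(1) q fst_conv snd_conv anti_linear *(1) by simp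
      moreover have "c * c' \<noteq> 0 \<longrightarrow> valid_pairs ((q # qs) @ rest') \<and> length ps = length (q # qs) + length rest'"
        using *(2) v(2) by (auto simp: q)
      ultimately show ?thesis by blast
    qed
  qed
  then show ?thesis using that by blast
qed

end

lemma perm_act_uminus: "perm_act \<sigma> (- f) = - perm_act \<sigma> f"
  by (simp add: perm_act_def fun_eq_iff)

context two_part_tabloids begin

section \<open>Functions alternating in a list of pairs\<close>

definition alternating :: "(nat \<times> nat) list \<Rightarrow> (nat set list \<Rightarrow> 'k) \<Rightarrow> bool" where
  "alternating qs f \<longleftrightarrow> (\<forall>(a, b)\<in>set qs. perm_act (swap a b) f = fscale (-1) f)"

definition splits :: "(nat \<times> nat) list \<Rightarrow> nat set \<Rightarrow> bool" where
  "splits qs x \<longleftrightarrow> (\<forall>(a, b)\<in>set qs. (a \<in> x) \<noteq> (b \<in> x))"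

lemma alternatingD: "alternating qs f \<Longrightarrow> (a, b) \<in> set qs \<Longrightarrow> perm_act (swap a b) f = fscale (-1) f"
  by (auto simp: alternating_def)

lemma eq_neg_imp_zero: "x = - x \<Longrightarrow> x = (0 :: 'k)"
  using two_neq_0 by (metis add.right_inverse mult_2 mult_eq_0_iff)

lemma vimage_swap_fix: "(a \<in> x) = (b \<in> x) \<Longrightarrow> swap a b -` x = x"
  by (auto simp: transpose_def split: if_splits)

lemma swap_fixes_tabloid:
  assumes "a \<in> {1..n}" "b \<in> {1..n}" "T \<in> X" "(a \<in> second_row T) = (b \<in> second_row T)"
  shows "map (vimage (swap a b)) T = T"
proof (rule tabloid_eqI)
  show "map (vimage (swap a b)) T \<in> X"
    by (rule map_vimage_tabloid[OF swap_permutes[OF assms(1,2)] assms(3)])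
  show "second_row (map (vimage (swap a b)) T) = second_row T"
    unfolding second_row_map using assms(4) by (rule vimage_swap_fix)
qed (rule assms(3))

text \<open>If the second row of \<open>T\<close> contains both or neither of \<open>a\<close> and
  \<open>b\<close>, their swap fixes \<open>T\<close>; alternation then gives
  \<open>f T = - f T\<close>, so \<open>f T\<close> vanishes because 2 is not zero.\<close>

lemma alternating_support:
  assumes "valid_pairs qs" "alternating qs f" "T \<in> X" "f T \<noteq> 0"
  shows "splits qs (second_row T)"
  unfolding splits_def
proof clarify
  fix a b assume ab: "(a, b) \<in> set qs" and eq: "(a \<in> second_row T) = (b \<in> second_row T)"
  have "a \<in> {1..n}" "b \<in> {1..n}"
    using assms(1) pair_in_points[OF ab] by (auto simp: valid_pairs_def)
  then have "map (vimage (swap a b)) T = T" using assms(3) eq by (rule swap_fixes_tabloid)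
  then have "perm_act (swap a b) f T = f T" by (simp add: perm_act_def)
  moreover have "perm_act (swap a b) f T = - f T"
    using alternatingD[OF assms(2) ab] by (simp add: fscale_apply)
  ultimately have "f T = - f T" by simp
  then show False using eq_neg_imp_zero assms(4) by blast
qed

lemma pair_prod_square:
  assumes "T \<in> X" "splits qs (second_row T)"
  shows "pair_prod qs T * pair_prod qs T = 1"
proof -
  have "(\<Prod>p\<leftarrow>qs. diff_ind p (second_row T)) * (\<Prod>p\<leftarrow>qs. diff_ind p (second_row T)) = (1 :: 'k)"
    using assms(2)
  proof (induction qs)
    case (Cons q qs)
    have "diff_ind q (second_row T) * diff_ind q (second_row T) = (1 :: 'k)"
      using Cons.prems by (cases q) (auto simp: splits_def diff_ind_def)
    moreover have "splits qs (second_row T)" using Cons.prems by (auto simp: splits_def)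
    ultimately show ?case using Cons.IH by (simp add: algebra_simps)
  qed simp
  then show ?thesis using assms(1) by (simp add: pair_prod_def)
qed

lemma alternating_pair_prod: "valid_pairs qs \<Longrightarrow> alternating qs (pair_prod qs)"
  using pair_prod_alternating by (auto simp: alternating_def)

text \<open>Each pair contributes a point to \<open>x\<close>, and disjoint pairs contribute
  different points.\<close>

lemma length_le_card_splits:
  assumes "valid_pairs qs" "finite x" "splits qs x"
  shows "length qs \<le> card x"
proof -
  have d: "disjoint_pairs qs" using assms(1) by (simp add: valid_pairs_def)
  let ?h = "\<lambda>(a, b). if a \<in> x then a else b"
  have "inj_on ?h (set qs)"
  proof (rule inj_onI, clarify)
    fix a b c e assume 1: "(a, b) \<in> set qs" "(c, e) \<in> set qs"
      and 2: "(if a \<in> x then a else b) = (if c \<in> x then c else e)"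
    then have "{a, b} \<inter> {c, e} \<noteq> {}" by (auto split: if_splits)
    then show "a = c \<and> b = e" using disjoint_pairs_eq_or_disjoint[OF d 1] by auto
  qed
  moreover have "?h ` set qs \<subseteq> x" using assms(3) by (auto simp: splits_def)
  ultimately have "card (set qs) \<le> card x" using assms(2) by (rule card_inj_on_le)
  then show ?thesis using disjoint_pairs_distinct[OF d] by (simp add: distinct_card)
qed

text \<open>Transposing \<open>a\<close> and \<open>b\<close> moves \<open>x\<close> closer to \<open>x0\<close>.\<close>

lemma exists_improving_swap:
  assumes "card x0 = card x" "finite x" "finite x0" "x0 \<noteq> x" "splits qs x0" "splits qs x"
  obtains a b where "a \<in> x0" "a \<notin> x" "b \<in> x" "b \<notin> x0"
    "(a, b) \<in> set qs \<or> (b, a) \<in> set qs \<or> (a \<notin> points qs \<and> b \<notin> points qs)"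
proof -
  have "\<not> x0 \<subseteq> x" "\<not> x \<subseteq> x0" using assms(1-4) by (metis card_subset_eq)+
  then obtain a b where ab: "a \<in> x0" "a \<notin> x" "b \<in> x" "b \<notin> x0" by blast
  \<comment> \<open>A point lying in exactly one of \<open>x\<close> and \<open>x0\<close> has its
    partner in exactly the other one, so the pair itself is a swap of the required kind.\<close>
  have partner: "c \<in> x \<longleftrightarrow> c \<notin> x0" "c \<in> x0 \<longleftrightarrow> e \<notin> x0" "c \<in> x \<longleftrightarrow> e \<notin> x"
    if "(c, e) \<in> set qs \<or> (e, c) \<in> set qs" "e \<in> x \<longleftrightarrow> e \<notin> x0" for c e
    using that assms(5,6) unfolding splits_def by blast+
  show ?thesis
  proof (cases "a \<in> points qs")
    case True
    then obtain c where "(a, c) \<in> set qs \<or> (c, a) \<in> set qs" by (rule in_points_pair)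
    then show ?thesis using partner[of c a] ab that[of a c] by blast
  next
    case a: False
    show ?thesis
    proof (cases "b \<in> points qs")
      case True
      then obtain c where "(b, c) \<in> set qs \<or> (c, b) \<in> set qs" by (rule in_points_pair)
      then show ?thesis using partner[of c b] ab that[of c b] by blast
    next
      case False
      then show ?thesis using a ab that[of a b] by blast
    qed
  qed
qed

text \<open>The tabloids whose second row splits \<open>qs\<close> are connected by swaps inside the
  pairs and swaps of outside points. Such a swap multiplies \<open>f\<close> and
  \<open>pair_prod qs\<close> by the same sign, so their product is constant on these tabloids.
  Elsewhere both vanish, and where they need not, \<open>pair_prod qs\<close> has square 1.\<close>

lemma alternating_unique:
  assumes qs: "valid_pairs qs" and f: "f \<in> vecs M" "alternating qs f"
    and sym: "\<And>a b. a \<in> {1..n} - points qs \<Longrightarrow> b \<in> {1..n} - points qs \<Longrightarrow> perm_act (swap a b) f = f"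
  obtains c where "f = fscale c (pair_prod qs)"
proof (cases "f = 0")
  case True
  then show ?thesis by (intro that[of 0]) simp
next
  case False
  then obtain T0 where fT0: "f T0 \<noteq> 0" by (auto simp: fun_eq_iff)
  then have T0: "T0 \<in> X" using f(1) by (auto simp: vecs_M)
  have sp0: "splits qs (second_row T0)" using alternating_support[OF qs f(2) T0 fT0] .
  define c where "c = f T0 * pair_prod qs T0"
  have step: "f T * pair_prod qs T = c" if "T \<in> X" "splits qs (second_row T)" for T
    using that
  proof (induction "card (second_row T0 - second_row T)" arbitrary: T rule: less_induct)
    case less
    let ?y = "second_row T0" and ?x = "second_row T"
    have fin: "finite ?y" "finite ?x" using T0 less.prems finite_second_row by blast+
    have cards: "card ?y = card ?x" using T0 less.prems card_second_row by simp
    show ?case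
    proof (cases "?y = ?x")
      case True
      then show ?thesis using tabloid_eqI[OF T0 less.prems(1) True] by (simp add: c_def)
    next
      case False
      obtain a b where ab: "a \<in> ?y" "a \<notin> ?x" "b \<in> ?x" "b \<notin> ?y"
        and cases: "(a, b) \<in> set qs \<or> (b, a) \<in> set qs \<or> (a \<notin> points qs \<and> b \<notin> points qs)"
        using exists_improving_swap[OF cards fin(2,1) False sp0 less.prems(2)] by metis
      have ab_n: "a \<in> {1..n}" "b \<in> {1..n}"
        using ab T0 less.prems(1) second_row_subset by blast+
      let ?T = "map (vimage (swap a b)) T"
      have T': "?T \<in> X" using swap_permutes[OF ab_n] less.prems(1) by (rule map_vimage_tabloid)
      have x': "second_row ?T = insert a (?x - {b})"
        using ab unfolding second_row_map by (auto simp: transpose_def split: if_splits)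
      have "?y - second_row ?T = (?y - ?x) - {a}" using ab unfolding x' by auto
      then have "card (?y - second_row ?T) < card (?y - ?x)"
        using card_Diff1_less[of "?y - ?x" a] ab fin by (simp only: finite_Diff) blast
      \<comment> \<open>The common sign: 1 for a swap of outside points, -1 for a swap inside a pair
        of \<open>qs\<close>.\<close>
      obtain s where s: "s * s = (1 :: 'k)" "perm_act (swap a b) f = fscale s f"
        "perm_act (swap a b) (pair_prod qs) = fscale s (pair_prod qs)"
      proof (cases "a \<notin> points qs \<and> b \<notin> points qs")
        case True
        then have "perm_act (swap a b) f = f" using sym ab_n by blast
        moreover have "perm_act (swap a b) (pair_prod qs) = pair_prod qs"
          unfolding perm_act_pair_prod[OF swap_permutes[OF ab_n]] using True by (simp add: map_swap_fix)
        ultimately show ?thesis by (intro that[of 1]) simp_all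
      next
        case False
        then have "(a, b) \<in> set qs \<or> (b, a) \<in> set qs" using cases by blast
        then have "perm_act (swap a b) f = fscale (-1) f"
          "perm_act (swap a b) (pair_prod qs) = fscale (-1) (pair_prod qs)"
          using alternatingD[OF f(2)] alternatingD[OF alternating_pair_prod[OF qs]]
          by (metis transpose_commute)+
        then show ?thesis by (intro that[of "-1"]) simp_all
      qed
      have fT: "f ?T = s * f T" "pair_prod qs ?T = s * pair_prod qs T"
        using fun_cong[OF s(2), of T] fun_cong[OF s(3), of T] by (simp_all add: perm_act_def fscale_apply)
      have "splits qs (second_row ?T)"
      proof -
        have "pair_prod qs T \<noteq> 0" using pair_prod_square[OF less.prems] by auto
        then have "pair_prod qs ?T \<noteq> 0" using fT(2) s(1) by auto
        then show ?thesis using alternating_support[OF qs alternating_pair_prod[OF qs] T'] by blast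
      qed
      then have "f ?T * pair_prod qs ?T = c"
        using less.hyps[OF \<open>card (?y - second_row ?T) < card (?y - ?x)\<close> T'] by blast
      moreover have "f ?T * pair_prod qs ?T = (s * s) * (f T * pair_prod qs T)"
        unfolding fT by (simp add: algebra_simps)
      ultimately show ?thesis using s(1) by simp
    qed
  qed
  have "f = fscale c (pair_prod qs)"
  proof
    fix T
    show "f T = fscale c (pair_prod qs) T"
    proof (cases "T \<in> X \<and> splits qs (second_row T)")
      case True
      then have "fscale c (pair_prod qs) T = f T * (pair_prod qs T * pair_prod qs T)"
        using step[of T] by (simp add: fscale_apply)
      then show ?thesis using pair_prod_square True by simp
    next
      case False
      then have "f T = 0"
        using alternating_support[OF qs f(2)] f(1) by (auto simp: vecs_M)
      moreover have "pair_prod qs T = 0"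
        using alternating_support[OF qs alternating_pair_prod[OF qs]] False
        by (cases "T \<in> X") (auto simp: pair_prod_def)
      ultimately show ?thesis by (simp add: fscale_apply)
    qed
  qed
  then show ?thesis by (rule that)
qed

text \<open>With \<open>r\<close> disjoint pairs, a second row that splits them is exhausted by one
  point from each pair. It has no outside points, so outside swaps fix the tabloid, and the symmetry
  demanded by \<open>alternating_unique\<close> is automatic.\<close>

lemma alternating_full_unique:
  assumes qs: "valid_pairs qs" "length qs = r" and f: "f \<in> vecs M" "alternating qs f"
  obtains c where "f = fscale c (pair_prod qs)"
proof (rule alternating_unique[OF qs(1) f])
  fix a b assume ab: "a \<in> {1..n} - points qs" "b \<in> {1..n} - points qs"
  then have ab_n: "a \<in> {1..n}" "b \<in> {1..n}" by auto
  have outside: "e \<notin> second_row T" if T: "T \<in> X" "splits qs (second_row T)" and e: "e \<notin> points qs" for T e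
  proof
    assume "e \<in> second_row T"
    have "splits qs (second_row T - {e})"
      using T(2) e pair_in_points[of _ _ qs] unfolding splits_def by blast
    then have "length qs \<le> card (second_row T - {e})"
      using finite_second_row[OF T(1)] qs(1) by (intro length_le_card_splits) simp_all
    then show False
      using \<open>e \<in> second_row T\<close> finite_second_row[OF T(1)] card_second_row[OF T(1)] qs(2)
        card_Diff1_less[of "second_row T" e] by simp
  qed
  have fixT: "map (vimage (swap a b)) T = T" if "T \<in> X" "splits qs (second_row T)" for T
    using that outside ab by (intro swap_fixes_tabloid ab_n) auto
  show "perm_act (swap a b) f = f"
  proof
    fix T
    let ?T = "map (vimage (swap a b)) T"
    show "perm_act (swap a b) f T = f T"
    proof (cases "f T = 0 \<and> f ?T = 0")
      case False
      have T: "T \<in> X"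
        using False f(1) map_vimage_tabloid_iff[OF swap_permutes[OF ab_n]] by (auto simp: vecs_M)
      then have T': "?T \<in> X" using swap_permutes[OF ab_n] by (rule map_vimage_tabloid[rotated])
      have tt: "map (vimage (swap a b)) ?T = T"
        by (simp add: vimage_def map_idI)
      have "?T = T"
      proof (cases "f T = 0")
        case True
        then have "splits qs (second_row ?T)" using False alternating_support[OF qs(1) f(2) T'] by blast
        then have "map (vimage (swap a b)) ?T = ?T" by (rule fixT[OF T'])
        then show ?thesis using tt by (rule trans[OF sym])
      next
        case False
        then show ?thesis using fixT[OF T] alternating_support[OF qs(1) f(2) T] by blast
      qed
      then show ?thesis by (simp add: perm_act_def)
    qed (simp add: perm_act_def)
  qed
qed

lemma perm_act_swap_disjoint_commute:
  assumes "{a, b} \<inter> {c, d} = {}"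
  shows "perm_act (swap a b) (perm_act (swap c d) f) = perm_act (swap c d) (perm_act (swap a b) f)"
  unfolding perm_act_comp swap_swap_disjoint[OF assms] ..

text \<open>Swaps of disjoint pairs commute, so a new antisymmetrisation does not destroy the
  earlier ones.\<close>

lemma alternating_anti:
  assumes "valid_pairs ((a, b) # qs)" "alternating qs f"
  shows "alternating ((a, b) # qs) (anti a b f)"
proof -
  have "perm_act (swap a b) (anti a b f) = fscale (-1) (anti a b f)"
    by (simp add: anti_def perm_act_linear perm_act_swap_swap fun_eq_iff fscale_apply)
  moreover have "perm_act (swap c d) (anti a b f) = fscale (-1) (anti a b f)" if "(c, d) \<in> set qs" for c d
  proof -
    have "{c, d} \<inter> {a, b} = {}"
      using assms(1) pair_in_points[OF that] by (auto simp: valid_pairs_def)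
    then have "perm_act (swap c d) (perm_act (swap a b) f) = fscale (-1) (perm_act (swap a b) f)"
      using alternatingD[OF assms(2) that] by (simp add: perm_act_swap_disjoint_commute perm_act_uminus)
    then show ?thesis
      using alternatingD[OF assms(2) that] unfolding anti_def perm_act_linear
      by (simp add: fvs.scale_right_diff_distrib)
  qed
  ultimately show ?thesis by (auto simp: alternating_def)
qed

lemma alternating_anti_pairs: "valid_pairs qs \<Longrightarrow> alternating qs (anti_pairs qs f)"
proof (induction qs)
  case (Cons q qs)
  obtain a b where q: "q = (a, b)" by (cases q)
  have "valid_pairs qs" using Cons.prems by (simp add: valid_pairs_def)
  then show ?case using Cons alternating_anti[of a b qs] by (simp add: q)
qed (simp add: alternating_def)

text \<open>Every antisymmetrisation doubles an alternating function. Together with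
  \<open>alternating_anti_pairs\<close>, for valid \<open>qs\<close>, the operator divided by
  \<open>2 ^ length qs\<close> is a projection onto the functions alternating in
  \<open>qs\<close>.\<close>

lemma anti_pairs_alternating:
  assumes "alternating qs f"
  shows "anti_pairs qs f = fscale (2 ^ length qs) f"
  using assms
proof (induction qs)
  case (Cons q qs)
  obtain a b where q: "q = (a, b)" by (cases q)
  have "alternating qs f" "perm_act (swap a b) f = fscale (-1) f"
    using Cons.prems by (auto simp: alternating_def q)
  then show ?case using Cons.IH
    by (simp add: q anti_linear) (simp add: anti_def fun_eq_iff fscale_apply algebra_simps)
qed simp

lemma anti_pairs_closed:
  assumes "fvs.subspace W" "\<And>\<sigma> f. \<sigma> permutes {1..n} \<Longrightarrow> f \<in> W \<Longrightarrow> perm_act \<sigma> f \<in> W"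
    "valid_pairs qs" "f \<in> W"
  shows "anti_pairs qs f \<in> W"
  using assms(3)
proof (induction qs)
  case (Cons q qs)
  then have "anti_pairs qs f \<in> W" "fst q \<in> {1..n}" "snd q \<in> {1..n}" by (auto simp: valid_pairs_def)
  then show ?case
    unfolding anti_pairs.simps anti_def
    by (intro fvs.subspace_diff[OF assms(1)] assms(2) swap_permutes)
qed (simp add: assms(4))

section \<open>Polytabloids as products over columns\<close>

definition column_pairs :: "(nat \<times> nat \<Rightarrow> nat) \<Rightarrow> (nat \<times> nat) list" where
  "column_pairs t = map (\<lambda>i. (t (0, i), t (1, i))) [0..<r]"

lemma valid_column_pairs:
  assumes "tableau (two_part n r) t"
  shows "valid_pairs (column_pairs t)" "length (column_pairs t) = r"
proof -
  have le: "r \<le> n - r" using two_r_le by simp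
  have i0: "inj_on (\<lambda>j. t (0, j)) {..<r}" using tableauD(2)[OF assms] le by (auto intro: inj_on_subset)
  have neq: "t (0, i) \<noteq> t (1, j)" if "i < r" "j < r" for i j
  proof -
    have "t (0, i) \<in> (\<lambda>j. t (0, j)) ` {..<n - r}" "t (1, j) \<in> (\<lambda>j. t (1, j)) ` {..<r}"
      using that le by auto
    then show ?thesis using tableauD(3)[OF assms] by (metis disjoint_iff)
  qed
  have "distinct (map fst (column_pairs t) @ map snd (column_pairs t))"
    using tableauD(1)[OF assms] i0 neq
    by (auto simp: column_pairs_def distinct_map comp_def atLeast0LessThan)
  moreover have "points (column_pairs t) \<subseteq> {1..n}"
    using tableauD(4)[OF assms] le by (auto simp: column_pairs_def points_def)
  ultimately show "valid_pairs (column_pairs t)" by (simp add: valid_pairs_def disjoint_pairs_def)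
qed (simp add: column_pairs_def)

lemma column_pairs_comp: "map (map_prod \<sigma> \<sigma>) (column_pairs t) = column_pairs (\<sigma> \<circ> t)"
  by (simp add: column_pairs_def)

text \<open>A polytabloid alternates in its \<open>r\<close> columns of length two, so uniqueness
  leaves only a constant to be found; evaluation at the tabloid of \<open>t\<close> shows that it is
  1.\<close>

lemma polytabloid_eq:
  assumes t: "tableau (two_part n r) t"
  shows "polytabloid (two_part n r) t = (pair_prod (column_pairs t) :: _ \<Rightarrow> 'k)"
proof -
  let ?\<mu> = "two_part n r"
  let ?C = "column_stabilizer ?\<mu> t"
  let ?e = "polytabloid ?\<mu> t :: nat set list \<Rightarrow> 'k"
  let ?q = "column_pairs t"
  let ?col = "\<lambda>j. {t (i, j) | i. (i, j) \<in> young_diagram ?\<mu>}"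
  have C: "?C = {\<pi>. \<pi> permutes {1..n} \<and> (\<forall>j. \<pi> ` ?col j = ?col j)}"
    by (simp add: column_stabilizer_def)
  have le: "r \<le> n - r" using two_r_le by simp
  have col: "?col j = (if j < r then {t (0, j), t (1, j)} else if j < n - r then {t (0, j)} else {})" for j
    using le by (auto simp: young_diagram_two_part)
  have finC: "finite ?C" unfolding C by (rule finite_subset[OF _ finite_permutations[of "{1..n}"]]) auto
  have val: "?e T = (\<Sum>\<pi>\<in>?C. if T = tabloid_of ?\<mu> (\<pi> \<circ> t) then of_int (sign \<pi>) else 0)" for T
    unfolding polytabloid_def sum_apply_fun
    by (intro sum.cong refl) (simp add: fscale_apply basis_vec_def)
  have inM: "?e \<in> vecs M" by (rule polytabloid_in_young_perm_module[OF t])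
  note v = valid_column_pairs[OF t]
  have "alternating ?q ?e"
    unfolding alternating_def
  proof clarify
    fix a b assume ab: "(a, b) \<in> set ?q"
    then obtain i where i: "i < r" "a = t (0, i)" "b = t (1, i)" by (auto simp: column_pairs_def)
    have perm: "swap a b permutes {1..n}" by (rule valid_pairs_swap_permutes[OF v(1) ab])
    have ne: "a \<noteq> b" using disjoint_pairs_neq[OF _ ab] v(1) by (auto simp: valid_pairs_def)
    have colfix: "swap a b ` ?col j = ?col j" for j
    proof (cases "j = i")
      case True
      then show ?thesis using i unfolding col by auto
    next
      case False
      have "e \<noteq> a \<and> e \<noteq> b" if "e \<in> ?col j" for e
      proof -
        have "t (0, j) \<noteq> a" if "j < n - r" using inj_onD[OF tableauD(2)[OF t], of j i] that i le False by auto
        moreover have "t (0, j) \<noteq> b" if "j < n - r" using tableauD(3)[OF t] that i by auto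
        moreover have "t (1, j) \<noteq> a" if "j < r"
        proof -
          have "i < n - r" using i(1) le by simp
          then show ?thesis using tableauD(3)[OF t] that i by auto
        qed
        moreover have "t (1, j) \<noteq> b" if "j < r" using inj_onD[OF tableauD(1)[OF t], of j i] that i False by auto
        ultimately show ?thesis using \<open>e \<in> ?col j\<close> le unfolding col by (auto split: if_splits)
      qed
      then have "swap a b e = e" if "e \<in> ?col j" for e using that by simp
      then show ?thesis by simp
    qed
    have closed: "swap a b \<circ> \<pi> \<in> ?C" if "\<pi> \<in> ?C" for \<pi>
    proof -
      have pj: "\<pi> ` ?col j = ?col j" for j using that unfolding C by blast
      have "(swap a b \<circ> \<pi>) ` ?col j = ?col j" for j by (simp only: image_comp[symmetric] pj colfix)
      moreover have "swap a b \<circ> \<pi> permutes {1..n}"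
        using that perm unfolding C by (blast intro: permutes_compose)
      ultimately show ?thesis unfolding C by blast
    qed
    \<comment> \<open>Composition with the swap permutes the column stabiliser and, as used below,
      reverses every sign.\<close>
    have bij: "bij_betw (\<lambda>\<pi>. swap a b \<circ> \<pi>) ?C ?C"
      by (rule bij_betw_byWitness[where f' = "\<lambda>\<pi>. swap a b \<circ> \<pi>"])
        (use closed in \<open>auto simp: comp_assoc[symmetric]\<close>)
    show "perm_act (swap a b) ?e = fscale (-1) ?e"
    proof
      fix T
      have "perm_act (swap a b) ?e T
        = (\<Sum>\<pi>\<in>?C. if map (vimage (swap a b)) T = tabloid_of ?\<mu> (\<pi> \<circ> t) then of_int (sign \<pi>) else 0)"
        by (simp add: perm_act_def val)
      also have "\<dots> = (\<Sum>\<pi>\<in>?C. if map (vimage (swap a b)) T = tabloid_of ?\<mu> (swap a b \<circ> \<pi> \<circ> t)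
          then of_int (sign (swap a b \<circ> \<pi>)) else 0)"
        by (rule sum.reindex_bij_betw[OF bij, symmetric])
      also have "\<dots> = (\<Sum>\<pi>\<in>?C. - (if T = tabloid_of ?\<mu> (\<pi> \<circ> t) then of_int (sign \<pi>) else 0))"
      proof (intro sum.cong refl)
        fix \<pi> assume "\<pi> \<in> ?C"
        then have "permutation \<pi>" unfolding C using permutation_permutes by blast
        then have sgn: "sign (swap a b \<circ> \<pi>) = - sign \<pi>"
          using ne by (simp add: sign_compose permutation_swap_id sign_swap_id)
        have "map (vimage (swap a b)) T = map (image (swap a b)) U \<longleftrightarrow> T = U" for U
        proof -
          have "bij (swap a b)" by simp
          then have "map (vimage (swap a b)) T = map (image (swap a b)) T"
            by (simp add: bij_vimage_eq_inv_image inv_transpose_eq)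
          moreover have "inj (image (swap a b))" by (rule injI) (simp add: inj_image_eq_iff)
          then have "inj (map (image (swap a b)))" by (rule inj_mapI)
          ultimately show ?thesis by (metis injD)
        qed
        then have "map (vimage (swap a b)) T = tabloid_of ?\<mu> (swap a b \<circ> \<pi> \<circ> t) \<longleftrightarrow> T = tabloid_of ?\<mu> (\<pi> \<circ> t)"
          unfolding comp_assoc tabloid_of_comp[of _ "swap a b"] .
        then show "(if map (vimage (swap a b)) T = tabloid_of ?\<mu> (swap a b \<circ> \<pi> \<circ> t)
            then of_int (sign (swap a b \<circ> \<pi>)) else 0) = - (if T = tabloid_of ?\<mu> (\<pi> \<circ> t) then of_int (sign \<pi>) else (0 :: 'k))"
          by (simp add: sgn)
      qed
      also have "\<dots> = fscale (-1) ?e T" by (simp add: val fscale_apply sum_negf)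
      finally show "perm_act (swap a b) ?e T = fscale (-1) ?e T" .
    qed
  qed
  then obtain c where c: "?e = fscale c (pair_prod ?q)" using alternating_full_unique[OF v inM] by blast
  \<comment> \<open>At this tabloid every factor of the product is 1, and in the polytabloid only
    the identity contributes: a column permutation that also preserves the second row fixes every
    point.\<close>
  let ?T = "tabloid_of ?\<mu> t"
  have T: "?T \<in> X" using t by (auto simp: tabloids_def)
  have row: "second_row ?T = (\<lambda>j. t (1, j)) ` {..<r}" by (rule second_row_tabloid_of)
  have t0: "t (0, j) \<notin> second_row ?T" if "j < n - r" for j
    using tableauD(3)[OF t] that unfolding row by blast
  have "pair_prod ?q ?T = 1"
  proof -
    have "diff_ind p (second_row ?T) = (1 :: 'k)" if p: "p \<in> set ?q" for p
    proof -
      obtain i where i: "i < r" "p = (t (0, i), t (1, i))" using p by (auto simp: column_pairs_def)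
      have "t (1, i) \<in> second_row ?T" unfolding row using i(1) by blast
      then show ?thesis using t0[of i] i le by (simp add: diff_ind_def)
    qed
    then have "map (\<lambda>p. diff_ind p (second_row ?T)) ?q = map (\<lambda>p. 1 :: 'k) ?q" by simp
    then have "(\<Prod>p\<leftarrow>?q. diff_ind p (second_row ?T)) = (\<Prod>p\<leftarrow>?q. 1 :: 'k)" by (simp only:)
    then show ?thesis using T by (simp add: pair_prod_def map_replicate_const)
  qed
  moreover have "?e ?T = 1"
  proof -
    have "\<pi> = id" if \<pi>: "\<pi> \<in> ?C" and eq: "?T = tabloid_of ?\<mu> (\<pi> \<circ> t)" for \<pi>
    proof -
      have perm: "\<pi> permutes {1..n}" and cj: "\<pi> ` ?col j = ?col j" for j using \<pi> unfolding C by auto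
      have rows: "(\<lambda>j. \<pi> (t (1, j))) ` {..<r} = second_row ?T"
        using arg_cong[OF eq, of second_row] by (simp add: second_row_tabloid_of)
      have c2: "\<pi> (t (0, j)) \<in> {t (0, j), t (1, j)}" "\<pi> (t (1, j)) \<in> {t (0, j), t (1, j)}" if "j < r" for j
      proof -
        have "\<pi> ` {t (0, j), t (1, j)} = {t (0, j), t (1, j)}"
          using cj[of j] unfolding col by (simp only: that if_True)
        then show "\<pi> (t (0, j)) \<in> {t (0, j), t (1, j)}" "\<pi> (t (1, j)) \<in> {t (0, j), t (1, j)}"
          by (metis imageI insertI1 insertI2)+
      qed
      have p1: "\<pi> (t (1, j)) = t (1, j)" if j: "j < r" for j
      proof -
        have "\<pi> (t (1, j)) \<in> second_row ?T"
          unfolding rows[symmetric] by (rule image_eqI[of _ _ j]) (simp_all add: j)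
        moreover have "t (0, j) \<notin> second_row ?T" using j le by (intro t0) simp
        ultimately show ?thesis using c2(2)[OF j] by (metis insertE singletonD)
      qed
      have p0: "\<pi> (t (0, j)) = t (0, j)" if j: "j < n - r" for j
      proof (cases "j < r")
        case True
        have "t (1, j) \<in> second_row ?T" unfolding row using True by blast
        then have "t (0, j) \<noteq> t (1, j)" using t0[OF j] by metis
        then have "\<pi> (t (0, j)) \<noteq> \<pi> (t (1, j))" using permutes_inj[OF perm] by (simp add: inj_eq)
        then show ?thesis using c2(1)[OF True] p1[OF True] by (metis insertE singletonD)
      next
        case False
        have "\<pi> ` {t (0, j)} = {t (0, j)}"
          using cj[of j] unfolding col by (simp only: False j if_True if_False)
        then show ?thesis by simp
      qed
      show ?thesis
      proof
        fix x show "\<pi> x = id x"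
        proof (cases "x \<in> {1..n}")
          case True
          then show ?thesis using p0 p1 unfolding tableauD(4)[OF t, symmetric] by auto
        next
          case False
          then show ?thesis using perm by (simp add: permutes_not_in)
        qed
      qed
    qed
    note uniq = this
    have idC: "id \<in> ?C" unfolding C by (simp add: permutes_id)
    have "(if ?T = tabloid_of ?\<mu> (\<pi> \<circ> t) then of_int (sign \<pi>) else 0) = (if \<pi> = id then 1 else (0 :: 'k))"
      if \<pi>: "\<pi> \<in> ?C" for \<pi>
    proof (cases "\<pi> = id")
      case False
      then have "?T \<noteq> tabloid_of ?\<mu> (\<pi> \<circ> t)" using uniq[OF \<pi>] by blast
      then show ?thesis using False by (simp only: if_False)
    qed (simp add: sign_id)
    then have "?e ?T = (\<Sum>\<pi>\<in>?C. if \<pi> = id then 1 else 0)" unfolding val by (intro sum.cong refl)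
    also have "\<dots> = 1" using finC idC by simp
    finally show ?thesis .
  qed
  ultimately have "c = 1" using c by (simp add: fscale_apply)
  then show ?thesis using c by simp
qed

end

section \<open>Two-part Specht modules\<close>

interpretation fvs_pair: vector_space_pair
  "fscale :: 'k::field \<Rightarrow> ('i \<Rightarrow> 'k) \<Rightarrow> 'i \<Rightarrow> 'k" "fscale :: 'k::field \<Rightarrow> ('j \<Rightarrow> 'k) \<Rightarrow> 'j \<Rightarrow> 'k" ..

section \<open>The standard bilinear form\<close>

definition bform :: "'x set \<Rightarrow> ('x \<Rightarrow> 'k::field) \<Rightarrow> ('x \<Rightarrow> 'k) \<Rightarrow> 'k" where
  "bform A f g = (\<Sum>x\<in>A. f x * g x)"

lemma bform_linear:
  "bform A (f + g) h = bform A f h + bform A g h" "bform A (fscale c f) h = c * bform A f h"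
  "bform A h (f + g) = bform A h f + bform A h g" "bform A h (fscale c f) = c * bform A h f"
  "bform A (f - g) h = bform A f h - bform A g h" "bform A 0 h = 0" "bform A h 0 = 0"
  by (simp_all add: bform_def fscale_apply algebra_simps sum.distrib sum_distrib_left sum_subtractf)

lemma bform_sum: "bform A (\<Sum>i\<in>I. F i) h = (\<Sum>i\<in>I. bform A (F i) h)"
  unfolding bform_def sum_apply_fun sum_distrib_right by (rule sum.swap)

text \<open>Riesz representation by a dimension count: pairing with the members of a basis
  \<open>C\<close> of \<open>V\<close> embeds \<open>V\<close> in the functions supported on
  \<open>C\<close>. That space is spanned by at most \<open>card C\<close> vectors, so the embedding
  is onto.\<close>

lemma nondegenerate_form_represents:
  fixes V :: "('x \<Rightarrow> 'k::field) set"
  assumes V: "fvs.subspace V" "V \<subseteq> fvs.span B" "finite B"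
    and nondeg: "\<And>v. v \<in> V \<Longrightarrow> (\<And>s. s \<in> V \<Longrightarrow> bform A v s = 0) \<Longrightarrow> v = 0"
    and \<phi>: "\<And>s s'. s \<in> V \<Longrightarrow> s' \<in> V \<Longrightarrow> \<phi> (s + s') = \<phi> s + \<phi> s'"
      "\<And>c s. s \<in> V \<Longrightarrow> \<phi> (fscale c s) = c * \<phi> s"
  obtains v where "v \<in> V" "\<And>s. s \<in> V \<Longrightarrow> bform A v s = \<phi> s"
proof -
  obtain C where C: "C \<subseteq> V" "fvs.independent C" "V \<subseteq> fvs.span C"
    using fvs.maximal_independent_subset by blast
  have VC: "V = fvs.span C" using C V(1) by (metis fvs.span_minimal subset_antisym)
  have finC: "finite C" using fvs.independent_span_bound[OF V(3) C(2)] C(1) V(2) by auto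
  have ext: "\<chi> s = \<chi>' s" if "s \<in> V" "\<And>b. b \<in> C \<Longrightarrow> \<chi> b = \<chi>' b"
    "\<And>s s'. s \<in> V \<Longrightarrow> s' \<in> V \<Longrightarrow> \<chi> (s + s') = \<chi> s + \<chi> s'" "\<And>c s. s \<in> V \<Longrightarrow> \<chi> (fscale c s) = c * \<chi> s"
    "\<And>s s'. s \<in> V \<Longrightarrow> s' \<in> V \<Longrightarrow> \<chi>' (s + s') = \<chi>' s + \<chi>' s'" "\<And>c s. s \<in> V \<Longrightarrow> \<chi>' (fscale c s) = c * \<chi>' s"
    for \<chi> \<chi>' :: "('x \<Rightarrow> 'k) \<Rightarrow> 'k" and s
  proof -
    have V0: "0 \<in> V" using V(1) by (rule fvs.subspace_0)
    have "fvs.subspace {s \<in> V. \<chi> s = \<chi>' s}"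
    proof (rule fvs.subspaceI)
      have "\<chi> (fscale 0 0) = 0 * \<chi> 0" "\<chi>' (fscale 0 0) = 0 * \<chi>' 0" by (rule that(4,6)[OF V0])+
      then show "0 \<in> {s \<in> V. \<chi> s = \<chi>' s}" using V0 by simp
    qed (simp_all add: that(3-6) fvs.subspace_add[OF V(1)] fvs.subspace_scale[OF V(1)])
    then have "fvs.span C \<subseteq> {s \<in> V. \<chi> s = \<chi>' s}"
      by (intro fvs.span_minimal) (use that(2) C(1) in auto)
    then show ?thesis using that(1) VC by blast
  qed
  define L where "L v = (\<lambda>b. if b \<in> C then bform A v b else 0)" for v
  have L: "Vector_Spaces.linear fscale fscale L"
    by (simp add: Vector_Spaces.linear_iff fvs.vector_space_axioms L_def fun_eq_iff bform_linear fscale_apply)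
  have inj: "inj_on L V"
  proof (rule inj_onI)
    fix v w assume v: "v \<in> V" and w: "w \<in> V" and eq: "L v = L w"
    have zero: "bform A (v - w) b = 0" if "b \<in> C" for b
      using fun_cong[OF eq, of b] that unfolding bform_linear by (simp add: L_def)
    have "bform A (v - w) s = 0" if "s \<in> V" for s
    proof (rule ext[of s "bform A (v - w)" "\<lambda>_. 0", OF that zero])
      show "bform A (v - w) (s + s') = bform A (v - w) s + bform A (v - w) s'" for s s'
        by (rule bform_linear(3))
      show "bform A (v - w) (fscale c s) = c * bform A (v - w) s" for c s
        by (rule bform_linear(4))
    qed simp_all
    then have "v - w = 0" by (rule nondeg[OF fvs.subspace_diff[OF V(1) v w]])
    then show "v = w" by simp
  qed
  have ind: "fvs.independent (L ` C)"
    using fvs_pair.linear_independent_injective_image[OF L C(2)] inj VC by simp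
  let ?E = "basis_vec ` C :: (('x \<Rightarrow> 'k) \<Rightarrow> 'k) set"
  have supp: "h \<in> fvs.span ?E" if "\<And>b. b \<notin> C \<Longrightarrow> h b = 0" for h :: "('x \<Rightarrow> 'k) \<Rightarrow> 'k"
  proof -
    have "h = (\<Sum>b\<in>C. fscale (h b) (basis_vec b))"
    proof
      fix b
      have "(\<Sum>b'\<in>C. fscale (h b') (basis_vec b')) b = (\<Sum>b'\<in>C. if b = b' then h b' else 0)"
        unfolding sum_apply_fun by (intro sum.cong refl) (simp add: fscale_def basis_vec_def)
      then show "h b = (\<Sum>b\<in>C. fscale (h b) (basis_vec b)) b" using that[of b] finC by simp
    qed
    also have "\<dots> \<in> fvs.span ?E"
      by (intro fvs.span_sum fvs.span_scale fvs.span_base imageI)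
    finally show ?thesis .
  qed
  have LE: "L ` C \<subseteq> fvs.span ?E" using supp by (auto simp: L_def)
  have cardL: "card (L ` C) = card C"
    using inj C(1) by (metis card_image inj_on_subset)
  define \<psi> where "\<psi> = (\<lambda>b. if b \<in> C then \<phi> b else 0)"
  have \<psi>: "\<psi> \<in> fvs.span ?E" by (rule supp) (simp add: \<psi>_def)
  have "\<psi> \<in> fvs.span (L ` C)"
  proof (rule ccontr)
    assume n: "\<psi> \<notin> fvs.span (L ` C)"
    then have "fvs.independent (insert \<psi> (L ` C))" using ind by (intro fvs.independent_insertI)
    moreover have "insert \<psi> (L ` C) \<subseteq> fvs.span ?E" using LE \<psi> by blast
    ultimately have "card (insert \<psi> (L ` C)) \<le> card ?E"
      using fvs.independent_span_bound[of ?E] finC by blast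
    moreover have "\<psi> \<notin> L ` C" using n fvs.span_base by blast
    ultimately have "Suc (card C) \<le> card ?E" using finC cardL by simp
    moreover have "card ?E \<le> card C" using finC by (rule card_image_le)
    ultimately show False by simp
  qed
  then have "\<psi> \<in> L ` V" using fvs_pair.linear_span_image[OF L, of C] VC by simp
  then obtain v where v: "v \<in> V" "\<psi> = L v" by blast
  have "bform A v s = \<phi> s" if "s \<in> V" for s
  proof (rule ext[OF that])
    show "bform A v b = \<phi> b" if "b \<in> C" for b
      using fun_cong[OF v(2), of b] that by (simp add: \<psi>_def L_def)
    show "bform A v (s + s') = bform A v s + bform A v s'" for s s' by (rule bform_linear(3))
    show "bform A v (fscale c s) = c * bform A v s" for c s by (rule bform_linear(4))
  qed (fact \<phi>)+
  then show ?thesis using that v(1) by blast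
qed

context two_part_tabloids begin

abbreviation polys :: "(nat set list \<Rightarrow> 'k) set" where
  "polys \<equiv> (\<lambda>t. pair_prod (column_pairs t)) ` {t. tableau (two_part n r) t}"

lemma carrier_G: "carrier G = {\<sigma>. \<sigma> permutes {1..n}}"
  by (rule sym_group_simps(1))

lemma perm_act_polys:
  assumes "\<sigma> permutes {1..n}" "f \<in> polys"
  shows "perm_act \<sigma> f \<in> polys"
proof -
  obtain t where t: "tableau (two_part n r) t" "f = pair_prod (column_pairs t)" using assms(2) by blast
  have "perm_act \<sigma> f = pair_prod (column_pairs (\<sigma> \<circ> t))"
    unfolding t(2) perm_act_pair_prod[OF assms(1)] column_pairs_comp ..
  moreover have "tableau (two_part n r) (\<sigma> \<circ> t)" using tableau_comp[of \<sigma> "two_part n r" t] assms(1) t(1) by simp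
  ultimately show ?thesis by blast
qed

lemma perm_act_span_polys:
  assumes "\<sigma> permutes {1..n}" "f \<in> fvs.span polys"
  shows "perm_act \<sigma> f \<in> fvs.span polys"
proof -
  have sub: "fvs.subspace {f :: nat set list \<Rightarrow> 'k. perm_act \<sigma> f \<in> fvs.span polys}"
  proof (rule fvs.subspaceI)
    have "perm_act \<sigma> (0 :: nat set list \<Rightarrow> 'k) = 0" by (simp add: perm_act_def fun_eq_iff)
    then show "0 \<in> {f :: nat set list \<Rightarrow> 'k. perm_act \<sigma> f \<in> fvs.span polys}" by (simp add: fvs.span_zero)
  qed (simp_all add: perm_act_linear fvs.span_add fvs.span_scale)
  then have "fvs.span polys \<subseteq> {f. perm_act \<sigma> f \<in> fvs.span polys}"
    by (intro fvs.span_minimal[OF _ sub] subsetI CollectI fvs.span_base perm_act_polys assms(1))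
  then show ?thesis using assms(2) by blast
qed

text \<open>The symmetric group permutes the polytabloids, so their linear span is already a
  submodule.\<close>

lemma vecs_S: "vecs S = fvs.span polys"
proof -
  have eq: "polytabloid (two_part n r) ` {t. tableau (two_part n r) t} = polys"
    by (rule image_cong[OF refl]) (simp add: polytabloid_eq)
  have sM: "fvs.subspace (vecs M)" by (simp add: young_perm_module_def fvs.subspace_span)
  have "submodule G M (fvs.span polys)"
    unfolding submodule_def act_young_perm_module carrier_G
  proof (intro conjI ballI)
    show "fvs.span polys \<subseteq> vecs M" by (rule fvs.span_minimal[OF _ sM]) (auto simp: pair_prod_vecs_M)
    show "perm_act g w \<in> fvs.span polys" if "g \<in> {\<sigma>. \<sigma> permutes {1..n}}" "w \<in> fvs.span polys" for g w
      using that by (simp add: perm_act_span_polys)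
  qed (rule fvs.subspace_span)
  then have "submodule_generated G M polys \<subseteq> fvs.span polys"
    unfolding submodule_generated_def by (intro Inter_lower CollectI conjI fvs.span_superset)
  moreover have "fvs.span polys \<subseteq> submodule_generated G M polys"
    unfolding submodule_generated_def
  proof (rule Inter_greatest)
    fix W assume "W \<in> {W. submodule G M W \<and> polys \<subseteq> W}"
    then have "fvs.subspace W" "polys \<subseteq> W" by (simp_all add: submodule_def)
    then show "fvs.span polys \<subseteq> W" by (intro fvs.span_minimal)
  qed
  ultimately show ?thesis by (simp add: specht_module_def eq)
qed

sublocale S: fg_module G S
  using fg_module_specht_module[of "two_part n r"] by simp

lemma vecs_S_subset_M: "vecs S \<subseteq> vecs M"
proof -
  have "fvs.subspace (vecs M)" by (simp add: young_perm_module_def fvs.subspace_span)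
  then show ?thesis unfolding vecs_S
    using pair_prod_vecs_M by (intro fvs.span_minimal) auto
qed

lemma pair_prod_orbit:
  assumes "valid_pairs ps" "valid_pairs qs" "length ps = length qs"
  obtains \<sigma> where "\<sigma> permutes {1..n}" "pair_prod qs = perm_act \<sigma> (pair_prod ps)"
proof -
  obtain \<sigma> where "\<sigma> permutes {1..n}" "map (map_prod \<sigma> \<sigma>) ps = qs"
    using exists_permutation_map_pairs[of ps qs "{1..n}"] assms by (auto simp: valid_pairs_def)
  then show ?thesis using that perm_act_pair_prod by metis
qed

text \<open>The image of a polytabloid alternates in the same \<open>r\<close> pairs and is
  therefore a multiple of it. The group carries this polytabloid to every other one, so the factor
  is the same for all generators.\<close>

lemma scalar_endomorphisms_S: "scalar_endomorphisms G S"
  unfolding scalar_endomorphisms_def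
proof (intro allI impI)
  fix \<phi> assume \<phi>: "gmod_hom G S S \<phi>"
  note \<phi>D = gmod_homD[OF \<phi>, unfolded act_specht_module carrier_G]
  show "\<exists>c. \<forall>v\<in>vecs S. \<phi> v = fscale c v"
  proof (cases "{t. tableau (two_part n r) t} = {}")
    case True
    then have "vecs S = {0}" by (simp add: vecs_S)
    then show ?thesis using gmod_hom_zero[OF \<phi> S.zero_vecs] by simp
  next
    case False
    then obtain t0 where t0: "tableau (two_part n r) t0" by blast
    let ?q = "column_pairs t0"
    note v = valid_column_pairs[OF t0]
    have e0: "pair_prod ?q \<in> vecs S" unfolding vecs_S using t0 by (intro fvs.span_base) blast
    have "alternating ?q (\<phi> (pair_prod ?q))"
      unfolding alternating_def
    proof clarify
      fix a b assume ab: "(a, b) \<in> set ?q"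
      have "perm_act (swap a b) (\<phi> (pair_prod ?q)) = \<phi> (perm_act (swap a b) (pair_prod ?q))"
        using \<phi>D(4)[of "swap a b" "pair_prod ?q"] valid_pairs_swap_permutes[OF v(1) ab] e0 by simp
      also have "\<dots> = fscale (-1) (\<phi> (pair_prod ?q))"
        unfolding pair_prod_alternating[OF v(1) ab] using \<phi>D(3)[OF e0] .
      finally show "perm_act (swap a b) (\<phi> (pair_prod ?q)) = fscale (-1) (\<phi> (pair_prod ?q))" .
    qed
    moreover have "\<phi> (pair_prod ?q) \<in> vecs M" using \<phi>D(1)[OF e0] vecs_S_subset_M by blast
    ultimately obtain c where c: "\<phi> (pair_prod ?q) = fscale c (pair_prod ?q)"
      using alternating_full_unique[OF v] by blast
    have "fvs.subspace {v \<in> vecs S. \<phi> v = fscale c v}"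
      by (rule fvs.subspaceI)
        (auto simp: S.zero_vecs S.add_vecs S.scale_vecs \<phi>D(2,3) gmod_hom_zero[OF \<phi> S.zero_vecs]
          fvs.scale_right_distrib mult.commute)
    moreover have "polys \<subseteq> {v \<in> vecs S. \<phi> v = fscale c v}"
    proof clarify
      fix t assume t: "tableau (two_part n r) t"
      note v' = valid_column_pairs[OF t]
      obtain \<sigma> where \<sigma>: "\<sigma> permutes {1..n}" "pair_prod (column_pairs t) = perm_act \<sigma> (pair_prod ?q)"
        using pair_prod_orbit[OF v(1) v'(1)] v(2) v'(2) by metis
      have "\<phi> (pair_prod (column_pairs t)) = perm_act \<sigma> (\<phi> (pair_prod ?q))"
        unfolding \<sigma>(2) using \<phi>D(4)[of \<sigma> "pair_prod ?q"] \<sigma>(1) e0 by simp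
      also have "\<dots> = fscale c (pair_prod (column_pairs t))" unfolding c perm_act_linear \<sigma>(2) ..
      finally show "pair_prod (column_pairs t) \<in> vecs S \<and> \<phi> (pair_prod (column_pairs t)) = fscale c (pair_prod (column_pairs t))"
        using t unfolding vecs_S by (auto intro: fvs.span_base)
    qed
    ultimately have "vecs S \<subseteq> {v \<in> vecs S. \<phi> v = fscale c v}"
      unfolding vecs_S by (intro fvs.span_minimal)
    then show ?thesis by blast
  qed
qed

text \<open>Take a nonzero \<open>f\<close> in \<open>W\<close> alternating in a list
  \<open>qs\<close> that is as long as possible. By maximality, antisymmetrising in one more
  disjoint pair gives zero, so \<open>f\<close> is symmetric in the outside points and
  \<open>alternating_unique\<close> identifies it.\<close>

lemma submodule_contains_pair_prod:
  assumes W: "submodule G S W" "W \<noteq> {0}"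
  obtains qs where "valid_pairs qs" "length qs \<le> r" "pair_prod qs \<in> W" "pair_prod qs \<noteq> 0"
proof -
  have WS: "W \<subseteq> vecs S" "fvs.subspace W"
    and Wact: "\<And>\<sigma> f. \<sigma> permutes {1..n} \<Longrightarrow> f \<in> W \<Longrightarrow> perm_act \<sigma> f \<in> W"
    using W(1) by (auto simp: submodule_def act_specht_module carrier_G)
  have WM: "W \<subseteq> vecs M" using WS(1) vecs_S_subset_M by blast
  define P where "P = (\<lambda>(qs, f). valid_pairs qs \<and> f \<in> W \<and> f \<noteq> 0 \<and> alternating qs f)"
  obtain f0 where f0: "f0 \<in> W" "f0 \<noteq> 0" using W(2) fvs.subspace_0[OF WS(2)] by blast
  have P0: "P ([], f0)" using f0 by (simp add: P_def valid_pairs_def alternating_def)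
  have bound: "\<forall>y. P y \<longrightarrow> length (fst y) \<le> r"
  proof clarify
    fix qs f assume "P (qs, f)"
    then have qs: "valid_pairs qs" "f \<in> W" "f \<noteq> 0" "alternating qs f" by (simp_all add: P_def)
    then obtain T where T: "f T \<noteq> 0" by (auto simp: fun_eq_iff)
    then have "T \<in> X" using qs(2) WM by (auto simp: vecs_M)
    then show "length (fst (qs, f)) \<le> r"
      using length_le_card_splits[OF qs(1) finite_second_row alternating_support[OF qs(1,4) _ T]] card_second_row
      by simp
  qed
  obtain qf where "P qf" and max: "\<And>y. P y \<Longrightarrow> length (fst y) \<le> length (fst qf)"
    using ex_has_greatest_nat[of P "([], f0)" "\<lambda>y. length (fst y)" "Suc r"] P0 bound by (metis less_Suc_eq_le)
  obtain qs f where qf: "qf = (qs, f)" by (cases qf)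
  have qs: "valid_pairs qs" "f \<in> W" "f \<noteq> 0" "alternating qs f"
    using \<open>P qf\<close> by (simp_all add: qf P_def)
  have "perm_act (swap a b) f = f" if a: "a \<in> {1..n} - points qs" and b: "b \<in> {1..n} - points qs" for a b
  proof (cases "a = b")
    case False
    have v: "valid_pairs ((a, b) # qs)" using qs(1) a b False by (auto simp: valid_pairs_def)
    have "anti a b f \<in> W"
      unfolding anti_def using a b qs(2) by (intro fvs.subspace_diff[OF WS(2)] Wact swap_permutes) auto
    moreover have "alternating ((a, b) # qs) (anti a b f)" using v qs(4) by (rule alternating_anti)
    ultimately have "anti a b f = 0"
      using max[of "((a, b) # qs, anti a b f)"] v by (auto simp: P_def qf)
    then show ?thesis by (simp add: anti_def)
  qed (simp add: perm_act_def)
  then obtain c where c: "f = fscale c (pair_prod qs)"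
    using alternating_unique[OF qs(1) _ qs(4)] qs(2) WM by blast
  have c0: "c \<noteq> 0" "pair_prod qs \<noteq> 0" using c qs(3) by auto
  have "pair_prod qs = fscale (1 / c) f" using c c0 by simp
  then have "pair_prod qs \<in> W" using qs(2) WS(2) by (metis fvs.subspace_scale)
  then show ?thesis using that qs(1) c0(2) bound \<open>P qf\<close> qf by auto
qed

text \<open>A product of full length \<open>r\<close> would bring all polytabloids into the proper
  submodule, since the symmetric group is transitive on products of \<open>r\<close> disjoint
  pairs.\<close>

lemma not_simple_contains_pair_prod:
  assumes "vecs S \<noteq> {0}" "\<not> simple_module G S"
  obtains qs where "valid_pairs qs" "length qs < r" "pair_prod qs \<in> vecs S" "pair_prod qs \<noteq> 0"
proof -
  obtain W where W: "submodule G S W" "W \<noteq> {0}" "W \<noteq> vecs S"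
    using assms S.fg_module_axioms by (auto simp: simple_module_def)
  obtain qs where qs: "valid_pairs qs" "length qs \<le> r" "pair_prod qs \<in> W" "pair_prod qs \<noteq> 0"
    using submodule_contains_pair_prod[OF W(1,2)] by blast
  have WS: "W \<subseteq> vecs S" "fvs.subspace W"
    and Wact: "\<And>\<sigma> f. \<sigma> permutes {1..n} \<Longrightarrow> f \<in> W \<Longrightarrow> perm_act \<sigma> f \<in> W"
    using W(1) by (auto simp: submodule_def act_specht_module carrier_G)
  have "length qs \<noteq> r"
  proof
    assume r: "length qs = r"
    have "polys \<subseteq> W"
    proof clarify
      fix t assume t: "tableau (two_part n r) t"
      note v = valid_column_pairs[OF t]
      obtain \<sigma> where "\<sigma> permutes {1..n}" "pair_prod (column_pairs t) = perm_act \<sigma> (pair_prod qs)"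
        using pair_prod_orbit[OF qs(1) v(1)] v(2) r by metis
      then show "pair_prod (column_pairs t) \<in> W" using Wact qs(3) by simp
    qed
    then have "vecs S \<subseteq> W" unfolding vecs_S using WS(2) by (rule fvs.span_minimal)
    then show False using W(3) WS(1) by blast
  qed
  then show ?thesis using that qs WS(1) by auto
qed

text \<open>All coordinates \<open>f y (pair_prod qs)\<close> are shown to vanish by
  \<open>invariant_fixed_vector_zero\<close>, applied to the group \<open>H\<close> acting on
  \<open>Y\<close>; then \<open>resolution\<close> makes the vector itself zero.\<close>

lemma pair_prod_not_permutation_summand:
  assumes p: "CHAR('k) > 0"
    and ps: "permutation_summand G S Y ac v f"
    and qs: "valid_pairs qs" "length qs < r" "pair_prod qs \<in> vecs S"
  shows "pair_prod qs = 0"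
proof -
  interpret Y: permutation_summand G S Y ac v f by (rule ps)
  let ?w = "pair_prod qs"
  define H where "H = {\<sigma>. \<sigma> permutes ({1..n} - points qs)}"
  have HG: "\<sigma> \<in> H \<Longrightarrow> \<sigma> permutes {1..n}" for \<sigma>
    unfolding H_def using permutes_subset[of \<sigma> "{1..n} - points qs" "{1..n}"] by blast
  have sub: "subgroup H G"
  proof (rule S.subgroupI)
    show "H \<subseteq> carrier G" using HG by (auto simp: carrier_G)
    have "id \<in> H" by (simp add: H_def permutes_id)
    then show "H \<noteq> {}" by blast
    show "inv\<^bsub>G\<^esub> \<sigma> \<in> H" if "\<sigma> \<in> H" for \<sigma>
    proof -
      have "inv_into UNIV \<sigma> permutes ({1..n} - points qs)"
        using that permutes_inv by (simp add: H_def)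
      moreover have "inv\<^bsub>G\<^esub> \<sigma> = inv_into UNIV \<sigma>"
        using sym_group_inv_equality[of \<sigma> n] HG[OF that] by (simp add: carrier_G)
      ultimately show ?thesis by (simp add: H_def)
    qed
    show "\<sigma> \<otimes>\<^bsub>G\<^esub> \<tau> \<in> H" if "\<sigma> \<in> H" "\<tau> \<in> H" for \<sigma> \<tau>
      using that permutes_compose by (simp add: H_def sym_group_simps)
  qed
  let ?H = "G\<lparr>carrier := H\<rparr>"
  have HsubG: "H \<subseteq> carrier G" using HG by (auto simp: carrier_G)
  interpret H: finite_gset ?H Y ac
  proof (intro finite_gset.intro finite_gset_axioms.intro)
    show "group ?H" by (rule subgroup.subgroup_is_group[OF sub S.is_group])
  qed (use HsubG in \<open>auto simp: Y.finite_Y Y.ac_closed Y.ac_one[simplified] Y.ac_mult subset_iff\<close>)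
  have fixes_qs: "map (map_prod \<sigma> \<sigma>) qs = qs" if "\<sigma> \<in> H" for \<sigma>
  proof (rule map_idI)
    fix p assume "p \<in> set qs"
    then have "fst p \<in> points qs" "snd p \<in> points qs" by (auto simp: points_def)
    then show "map_prod \<sigma> \<sigma> p = p"
      using that by (cases p) (simp add: H_def permutes_not_in)
  qed
  have anti_closed: "anti_pairs qs s \<in> vecs S" if "s \<in> vecs S" for s
    using that qs(1) perm_act_span_polys unfolding vecs_S
    by (intro anti_pairs_closed) (simp_all add: fvs.subspace_span)
  have anti_zero: "anti_pairs qs 0 = 0" using anti_pairs_linear(2)[of qs 0 0] by simp
  have anti_sum: "anti_pairs qs (\<Sum>i\<in>I. F i) = (\<Sum>i\<in>I. anti_pairs qs (F i))" for I :: "'b set" and F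
  proof (induction I rule: infinite_finite_induct)
    case (insert i I)
    then show ?case by (simp only: sum.insert[OF insert.hyps] anti_pairs_linear)
  next
    case (infinite A)
    then show ?case using anti_zero by (simp only: sum.infinite[OF infinite])
  next
    case empty
    show ?case using anti_zero by (simp only: sum.empty)
  qed
  \<comment> \<open>The elements of \<open>H\<close> fix every point of \<open>qs\<close>, hence
    commute with the swaps of these pairs.\<close>
  have anti_commute: "anti_pairs qs (perm_act \<sigma> s) = perm_act \<sigma> (anti_pairs qs s)" if \<sigma>: "\<sigma> \<in> H" for \<sigma> s
  proof -
    have "\<forall>p\<in>set qs. \<sigma> (fst p) = fst p \<and> \<sigma> (snd p) = snd p"
      using \<sigma> by (auto simp: H_def points_def intro!: permutes_not_in[of \<sigma>])
    then show ?thesis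
    proof (induction qs)
      case (Cons q qs)
      have sw: "swap (fst q) (snd q) \<circ> \<sigma> = \<sigma> \<circ> swap (fst q) (snd q)"
      proof
        fix x
        have "inj \<sigma>" using HG[OF \<sigma>] by (rule permutes_inj)
        then have "\<sigma> x = fst q \<longleftrightarrow> x = fst q" "\<sigma> x = snd q \<longleftrightarrow> x = snd q"
          using Cons.prems by (metis injD list.set_intros(1))+
        then show "(swap (fst q) (snd q) \<circ> \<sigma>) x = (\<sigma> \<circ> swap (fst q) (snd q)) x"
          using Cons.prems by (simp add: transpose_def)
      qed
      have IH: "anti_pairs qs (perm_act \<sigma> s) = perm_act \<sigma> (anti_pairs qs s)"
        using Cons by simp
      show ?case unfolding anti_pairs.simps anti_def IH perm_act_linear perm_act_comp sw ..
    qed simp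
  qed
  let ?c = "1 / 2 ^ length qs :: 'k"
  \<comment> \<open>The matrix of the projection attached to \<open>qs\<close>, expressed by the
    coordinates \<open>f\<close> and the generators \<open>v\<close>; the constant \<open>?c\<close>
    makes it idempotent as an operator on \<open>S\<close>.\<close>
  define F where "F x y = ?c * f x (anti_pairs qs (v y))" for x y
  have vS: "anti_pairs qs (v y) \<in> vecs S" if "y \<in> Y" for y using that by (intro anti_closed Y.v_closed)
  \<comment> \<open>The orbit sum is an \<open>H\<close>-invariant functional. An antisymmetrised
    polytabloid is zero or contains a further pair outside \<open>qs\<close>; the swap of that pair
    lies in \<open>H\<close> and negates the vector, so the functional kills it.\<close>
  have zero: "(\<Sum>z\<in>H.orb x. f z (anti_pairs qs s)) = 0" if x: "x \<in> Y" and s: "s \<in> vecs S" for x s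
  proof -
    let ?\<phi> = "\<lambda>s. \<Sum>z\<in>H.orb x. f z s"
    have orbY: "z \<in> Y" if "z \<in> H.orb x" for z using H.orb_subset[OF x] that by blast
    have \<phi>_add: "?\<phi> (s + s') = ?\<phi> s + ?\<phi> s'" if "s \<in> vecs S" "s' \<in> vecs S" for s s'
      unfolding sum.distrib[symmetric] using that by (intro sum.cong refl Y.f_add orbY)
    have \<phi>_scale: "?\<phi> (fscale c s) = c * ?\<phi> s" if "s \<in> vecs S" for c s
      unfolding sum_distrib_left using that by (intro sum.cong refl Y.f_scale orbY)
    have \<phi>_act: "?\<phi> (perm_act \<sigma> s) = ?\<phi> s" if \<sigma>: "\<sigma> \<in> H" and s: "s \<in> vecs S" for \<sigma> s
    proof -
      have "?\<phi> (perm_act \<sigma> s) = (\<Sum>z\<in>H.orb x. f (ac \<sigma> z) (perm_act \<sigma> s))"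
        using H.bij_betw_ac_orb[OF x, of \<sigma>] \<sigma> by (intro sum.reindex_bij_betw[symmetric]) simp
      also have "\<dots> = ?\<phi> s"
        using \<sigma> HsubG s Y.f_ac orbY by (intro sum.cong refl) (auto simp: act_specht_module)
      finally show ?thesis .
    qed
    have "fvs.subspace {s \<in> vecs S. ?\<phi> (anti_pairs qs s) = 0}"
    proof (rule fvs.subspaceI)
      have "?\<phi> 0 = 0" using \<phi>_scale[OF S.zero_vecs, of 0] by simp
      then show "0 \<in> {s \<in> vecs S. ?\<phi> (anti_pairs qs s) = 0}"
        using S.zero_vecs by (simp add: anti_zero)
    qed (simp_all add: anti_pairs_linear S.add_vecs S.scale_vecs \<phi>_add \<phi>_scale anti_closed)
    moreover have "polys \<subseteq> {s \<in> vecs S. ?\<phi> (anti_pairs qs s) = 0}"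
    proof clarify
      fix t assume t: "tableau (two_part n r) t"
      note cp = valid_column_pairs[OF t]
      have e: "pair_prod (column_pairs t) \<in> vecs S" unfolding vecs_S using t by (intro fvs.span_base) blast
      let ?u = "anti_pairs qs (pair_prod (column_pairs t))"
      obtain c rest where u: "?u = fscale c (pair_prod (qs @ rest))"
        "c \<noteq> 0 \<Longrightarrow> valid_pairs (qs @ rest) \<and> length (column_pairs t) = length qs + length rest"
        using anti_pairs_pair_prod[OF qs(1) cp(1)] by metis
      have "?\<phi> ?u = 0"
      proof (cases "c = 0")
        case True
        then show ?thesis using \<phi>_scale[OF S.zero_vecs, of 0] by (simp add: u(1))
      next
        case False
        then have v: "valid_pairs (qs @ rest)" and "rest \<noteq> []" using u(2) cp(2) qs(2) by auto
        then obtain a b rest' where rest: "rest = (a, b) # rest'" by (cases rest) auto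
        then have ab: "(a, b) \<in> set (qs @ rest)" by simp
        have "swap a b \<in> H"
          using v unfolding rest H_def by (auto simp: valid_pairs_def intro!: permutes_swap_id)
        then have "?\<phi> (perm_act (swap a b) ?u) = ?\<phi> ?u" by (rule \<phi>_act[OF _ anti_closed[OF e]])
        moreover have "perm_act (swap a b) ?u = fscale (-1) ?u"
          unfolding u(1) perm_act_linear pair_prod_alternating[OF v ab] by simp
        moreover have "?\<phi> (fscale (-1) ?u) = - ?\<phi> ?u"
          using \<phi>_scale[OF anti_closed[OF e], of "-1"] by simp
        ultimately have "?\<phi> ?u = - ?\<phi> ?u" by simp
        then show ?thesis by (rule eq_neg_imp_zero)
      qed
      then show "pair_prod (column_pairs t) \<in> vecs S \<and> ?\<phi> ?u = 0" using e by blast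
    qed
    ultimately have "vecs S \<subseteq> {s \<in> vecs S. ?\<phi> (anti_pairs qs s) = 0}"
      unfolding vecs_S by (intro fvs.span_minimal)
    then show ?thesis using s by blast
  qed
  have wH: "perm_act \<sigma> ?w = ?w" if "\<sigma> \<in> H" for \<sigma>
    unfolding perm_act_pair_prod[OF HG[OF that]] fixes_qs[OF that] ..
  have w2: "anti_pairs qs ?w = fscale (2 ^ length qs) ?w"
    by (rule anti_pairs_alternating[OF alternating_pair_prod[OF qs(1)]])
  have two: "(2 :: 'k) ^ length qs \<noteq> 0" using two_neq_0 by simp
  have "f x ?w = 0" if x: "x \<in> Y" for x
  proof (rule H.invariant_fixed_vector_zero[where F = F and c = "\<lambda>x. f x ?w" and p = "CHAR('k)"])
    show "F (ac g x) (ac g y) = F x y" if "g \<in> carrier ?H" "x \<in> Y" "y \<in> Y" for g x y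
    proof -
      have g: "g \<in> H" "g \<in> carrier G" using that HsubG by auto
      have "anti_pairs qs (v (ac g y)) = perm_act g (anti_pairs qs (v y))"
        using Y.v_ac[OF g(2) that(3)] anti_commute[OF g(1)] by (simp add: act_specht_module)
      then show ?thesis
        using Y.f_ac[OF g(2) that(2) vS[OF that(3)]] by (simp add: F_def act_specht_module)
    qed
    show "f (ac g x) ?w = f x ?w" if "g \<in> carrier ?H" "x \<in> Y" for g x
    proof -
      have g: "g \<in> H" "g \<in> carrier G" using that HsubG by auto
      show ?thesis using Y.f_ac[OF g(2) that(2) qs(3)] wH[OF g(1)] by (simp add: act_specht_module)
    qed
    show "(\<Sum>z\<in>H.orb x. F z y) = 0" if "x \<in> Y" "y \<in> Y" for x y
      unfolding F_def sum_distrib_left[symmetric] using zero[OF that(1) Y.v_closed[OF that(2)]] by simp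
    fix x assume x: "x \<in> Y"
    \<comment> \<open>Up to the factor \<open>2 ^ length qs\<close> the antisymmetrisation fixes
      \<open>?w\<close>. Expanding \<open>?w\<close> by \<open>resolution\<close> and applying
      \<open>f x\<close> turns this into the fixed vector equation for \<open>F\<close>.\<close>
    have "anti_pairs qs ?w = anti_pairs qs (\<Sum>y\<in>Y. fscale (f y ?w) (v y))"
      using Y.resolution[OF qs(3)] by simp
    also have "\<dots> = (\<Sum>y\<in>Y. fscale (f y ?w) (anti_pairs qs (v y)))"
      unfolding anti_sum anti_pairs_linear ..
    finally have "f x (fscale (2 ^ length qs) ?w) = f x (\<Sum>y\<in>Y. fscale (f y ?w) (anti_pairs qs (v y)))"
      unfolding w2 by simp
    also have "\<dots> = (\<Sum>y\<in>Y. f x (fscale (f y ?w) (anti_pairs qs (v y))))"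
      by (intro Y.f_sum x S.scale_vecs vS)
    also have "\<dots> = (\<Sum>y\<in>Y. f y ?w * f x (anti_pairs qs (v y)))"
      by (intro sum.cong refl Y.f_scale x vS)
    finally have "2 ^ length qs * f x ?w = (\<Sum>y\<in>Y. f y ?w * f x (anti_pairs qs (v y)))"
      using Y.f_scale[OF x qs(3)] by simp
    then have "f x ?w = ?c * (\<Sum>y\<in>Y. f y ?w * f x (anti_pairs qs (v y)))"
      using two by (simp add: field_simps)
    then show "f x ?w = (\<Sum>y\<in>Y. F x y * f y ?w)"
      unfolding sum_distrib_left F_def by (simp add: mult_ac)
  qed (use p x in simp_all)
  then have "(\<Sum>y\<in>Y. fscale (f y ?w) (v y)) = 0" by (intro sum.neutral) simp
  then show ?thesis using Y.resolution[OF qs(3)] by simp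
qed

lemma bform_perm_act:
  assumes "\<sigma> permutes {1..n}"
  shows "bform X (perm_act \<sigma> f) (perm_act \<sigma> g) = bform X f (g :: _ \<Rightarrow> 'k)"
proof -
  have "bij_betw (map (vimage \<sigma>)) X X"
  proof (rule bij_betw_byWitness[where f' = "map (vimage (inv_into UNIV \<sigma>))"])
    have inv: "inv_into UNIV \<sigma> permutes {1..n}" using assms by (rule permutes_inv)
    show "map (vimage \<sigma>) ` X \<subseteq> X" "map (vimage (inv_into UNIV \<sigma>)) ` X \<subseteq> X"
      using map_vimage_tabloid[OF assms] map_vimage_tabloid[OF inv] by auto
    have "\<sigma> \<circ> inv_into UNIV \<sigma> = id" "inv_into UNIV \<sigma> \<circ> \<sigma> = id"
      using permutes_inv_o[OF assms] by auto
    then show "\<forall>T\<in>X. map (vimage (inv_into UNIV \<sigma>)) (map (vimage \<sigma>) T) = T"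
      "\<forall>T\<in>X. map (vimage \<sigma>) (map (vimage (inv_into UNIV \<sigma>)) T) = T"
      by (simp_all add: vimage_comp map_idI)
  qed
  then show ?thesis
    unfolding bform_def perm_act_def by (rule sum.reindex_bij_betw[where g = "\<lambda>T. f T * g T"])
qed

text \<open>Each swap is an isometry and negates \<open>g\<close>, so subtracting the swapped
  function doubles the value of the form.\<close>

lemma bform_anti_pairs:
  assumes "valid_pairs qs" "alternating qs g"
  shows "bform X (anti_pairs qs f) g = 2 ^ length qs * bform X f g"
  using assms
proof (induction qs)
  case (Cons q qs)
  obtain a b where q: "q = (a, b)" by (cases q)
  have v: "valid_pairs qs" "alternating qs g" "perm_act (swap a b) g = fscale (-1) g"
    using Cons.prems by (auto simp: q valid_pairs_def alternating_def)
  have perm: "swap a b permutes {1..n}" using Cons.prems(1) by (rule valid_pairs_swap_permutes) (simp add: q)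
  have "bform X (perm_act (swap a b) h) g = - bform X h g" for h
  proof -
    have "g = perm_act (swap a b) (fscale (-1) g)" using v(3) perm_act_swap_swap[of a b g] by simp
    then have "bform X (perm_act (swap a b) h) g = bform X (perm_act (swap a b) h) (perm_act (swap a b) (fscale (-1) g))"
      by simp
    also have "\<dots> = bform X h (fscale (-1) g)" by (rule bform_perm_act[OF perm])
    finally show ?thesis unfolding bform_linear by simp
  qed
  then show ?case
    unfolding q anti_pairs.simps fst_conv snd_conv anti_def bform_linear
    using Cons.IH[OF v(1,2)] by simp
qed simp

text \<open>Nonvanishing without evaluating the sum: antisymmetrising the basis vector of the
  tabloid of \<open>t\<close> gives a multiple of the product, and by adjointness its pairing with
  the product is \<open>2 ^ r\<close> times a nonzero value.\<close>

lemma bform_pair_prod_self: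
  assumes t: "tableau (two_part n r) t"
  shows "bform X (pair_prod (column_pairs t)) (pair_prod (column_pairs t)) \<noteq> 0"
proof -
  let ?q = "column_pairs t" and ?T = "tabloid_of (two_part n r) t"
  note v = valid_column_pairs[OF t]
  have T: "?T \<in> X" using t by (auto simp: tabloids_def)
  have le: "r \<le> n - r" using two_r_le by simp
  have "splits ?q (second_row ?T)"
    unfolding splits_def
  proof clarify
    fix a b assume "(a, b) \<in> set ?q" and eq: "(a \<in> second_row ?T) = (b \<in> second_row ?T)"
    then obtain i where i: "i < r" "a = t (0, i)" "b = t (1, i)" by (auto simp: column_pairs_def)
    have "a \<in> (\<lambda>j. t (0, j)) ` {..<n - r}" unfolding i(2) using i(1) le by (intro imageI) simp
    then have "a \<notin> second_row ?T" using tableauD(3)[OF t] unfolding second_row_tabloid_of by blast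
    moreover have "b \<in> second_row ?T" unfolding second_row_tabloid_of i(3) using i(1) by (intro imageI) simp
    ultimately show False using eq by blast
  qed
  then have ne: "pair_prod ?q ?T \<noteq> 0" using pair_prod_square[OF T] by fastforce
  have bM: "basis_vec ?T \<in> vecs M" using T by (auto simp: vecs_M basis_vec_def)
  have "anti_pairs ?q (basis_vec ?T) \<in> vecs M"
    using v(1) bM perm_act_vecs_M
    by (intro anti_pairs_closed) (simp_all add: young_perm_module_def fvs.subspace_span)
  then obtain c where c: "anti_pairs ?q (basis_vec ?T) = fscale c (pair_prod ?q)"
    using alternating_full_unique[OF v _ alternating_anti_pairs[OF v(1)]] by blast
  have "bform X (basis_vec ?T) (pair_prod ?q) = pair_prod ?q ?T"
    using T finite_tabloids by (simp add: bform_def basis_vec_def if_distrib[of "\<lambda>x. x * _"] cong: if_cong)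
  then have "bform X (anti_pairs ?q (basis_vec ?T)) (pair_prod ?q) \<noteq> 0"
    using bform_anti_pairs[OF v(1) alternating_pair_prod[OF v(1)]] ne two_neq_0 by simp
  then show ?thesis unfolding c bform_linear by auto
qed

text \<open>The radical of the form on \<open>S\<close> is a submodule that misses the polytabloids,
  hence zero. The coordinates describe the inclusion of \<open>S\<close> in the Young module, and
  \<open>v T\<close> represents evaluation at \<open>T\<close>: it is the orthogonal projection to
  \<open>S\<close> of the basis vector of \<open>T\<close>.\<close>

lemma simple_permutation_summand:
  assumes simple: "simple_module G S"
  obtains v where "permutation_summand G S X (\<lambda>\<sigma>. map (image \<sigma>)) v (\<lambda>T s. s T)"
proof -
  have nontriv: "vecs S \<noteq> {0}" using simple by (simp add: simple_module_def)
  let ?R = "{s \<in> vecs S. \<forall>s'\<in>vecs S. bform X s s' = 0}"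
  have Sact: "\<And>\<sigma> s. \<sigma> permutes {1..n} \<Longrightarrow> s \<in> vecs S \<Longrightarrow> perm_act \<sigma> s \<in> vecs S"
    using perm_act_span_polys by (simp add: vecs_S)
  have invp: "inv_into UNIV \<sigma> permutes {1..n}" "perm_act \<sigma> (perm_act (inv_into UNIV \<sigma>) s) = s"
    "perm_act (inv_into UNIV \<sigma>) (perm_act \<sigma> s) = s"
    if "\<sigma> permutes {1..n}" for \<sigma> and s :: "nat set list \<Rightarrow> 'k"
    using permutes_inv[OF that] permutes_inv_o[OF that]
    by (simp_all add: perm_act_comp) (simp_all add: perm_act_def map_idI)
  have adj: "bform X (perm_act \<sigma> s) s' = bform X s (perm_act (inv_into UNIV \<sigma>) s')"
    if "\<sigma> permutes {1..n}" for \<sigma> and s s' :: "nat set list \<Rightarrow> 'k"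
    using bform_perm_act[OF that, of s "perm_act (inv_into UNIV \<sigma>) s'"] invp(2)[OF that] by simp
  have "fvs.subspace ?R"
    by (rule fvs.subspaceI) (auto simp: bform_linear S.zero_vecs S.add_vecs S.scale_vecs)
  then have "submodule G S ?R"
    unfolding submodule_def act_specht_module carrier_G
    using adj invp(1) Sact by auto
  then have "?R = {0} \<or> ?R = vecs S" using simple by (simp add: simple_module_def)
  moreover have "?R \<noteq> vecs S"
  proof -
    obtain t where t: "tableau (two_part n r) t"
      using nontriv unfolding vecs_S by (metis (no_types, lifting) Collect_empty_eq fvs.span_empty image_empty)
    then have "pair_prod (column_pairs t) \<in> vecs S" unfolding vecs_S by (intro fvs.span_base) blast
    then show ?thesis using bform_pair_prod_self[OF t] by blast
  qed
  ultimately have R: "?R = {0}" by blast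
  have nondeg: "s = 0" if "s \<in> vecs S" "\<And>s'. s' \<in> vecs S \<Longrightarrow> bform X s s' = 0" for s
    using that R by blast
  obtain B where B: "finite B" "vecs S = fvs.span B" using S.finite_dim by blast
  have "\<exists>v. v \<in> vecs S \<and> (\<forall>s\<in>vecs S. bform X v s = s T)" for T
  proof -
    have "vecs S \<subseteq> fvs.span B" using B(2) by simp
    note rep = nondegenerate_form_represents[where A = X and \<phi> = "\<lambda>s. s T", OF S.subspace_vecs this B(1)]
    show ?thesis by (rule rep) (use nondeg in \<open>auto simp: fscale_apply\<close>)
  qed
  then obtain v where v: "\<And>T. v T \<in> vecs S" "\<And>T s. s \<in> vecs S \<Longrightarrow> bform X (v T) s = s T"
    by metis
  have eqI: "s = s'" if "s \<in> vecs S" "s' \<in> vecs S" "\<And>u. u \<in> vecs S \<Longrightarrow> bform X s u = bform X s' u" for s s'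
    using nondeg[of "s - s'"] that by (simp add: bform_linear S.diff_vecs)
  have img: "map (image \<sigma>) T = map (vimage (inv_into UNIV \<sigma>)) T" if "\<sigma> permutes {1..n}" for \<sigma> T
    using permutes_bij[OF permutes_inv[OF that]] permutes_inv_inv[OF that] by (simp add: bij_vimage_eq_inv_image)
  have "permutation_summand G S X (\<lambda>\<sigma>. map (image \<sigma>)) v (\<lambda>T s. s T)"
  proof unfold_locales
    show "finite X" by (rule finite_tabloids)
    show "map (image \<one>\<^bsub>G\<^esub>) T = T" if "T \<in> X" for T by (simp add: sym_group_simps map_idI)
    show "map (image (\<sigma> \<otimes>\<^bsub>G\<^esub> \<tau>)) T = map (image \<sigma>) (map (image \<tau>) T)" for \<sigma> \<tau> T
      by (simp add: sym_group_simps image_comp)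
    show "v T \<in> vecs S" for T by (rule v)
    show "(s + s') T = s T + s' T" "fscale c s T = c * s T" for s s' T and c :: 'k
      by (simp_all add: fscale_apply)
  next
    fix \<sigma> T assume "\<sigma> \<in> carrier G" and T: "T \<in> X"
    then have \<sigma>: "\<sigma> permutes {1..n}" by (simp add: carrier_G)
    show "map (image \<sigma>) T \<in> X" unfolding img[OF \<sigma>] by (rule map_vimage_tabloid[OF permutes_inv[OF \<sigma>] T])
    have val: "s (map (image \<sigma>) T) = perm_act (inv_into UNIV \<sigma>) s T" for s :: "nat set list \<Rightarrow> 'k"
      unfolding img[OF \<sigma>] perm_act_def ..
    show "v (map (image \<sigma>) T) = act S \<sigma> (v T)"
      unfolding act_specht_module
    proof (rule eqI)
      fix u assume u: "u \<in> vecs S"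
      show "bform X (v (map (image \<sigma>) T)) u = bform X (perm_act \<sigma> (v T)) u"
        unfolding adj[OF \<sigma>] v(2)[OF u] v(2)[OF Sact[OF invp(1)[OF \<sigma>] u]] by (rule val)
    qed (use v(1) Sact \<sigma> in auto)
    fix s assume "s \<in> vecs S"
    show "act S \<sigma> s (map (image \<sigma>) T) = s T"
      unfolding act_specht_module val invp(3)[OF \<sigma>] ..
  next
    fix s assume s: "s \<in> vecs S"
    \<comment> \<open>Paired with any \<open>u\<close> in \<open>S\<close>, both sides give the sum
      of \<open>s T * u T\<close> over all tabloids.\<close>
    show "(\<Sum>T\<in>X. fscale (s T) (v T)) = s"
    proof (rule eqI)
      fix u assume u: "u \<in> vecs S"
      show "bform X (\<Sum>T\<in>X. fscale (s T) (v T)) u = bform X s u"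
        unfolding bform_sum bform_linear v(2)[OF u] by (simp add: bform_def)
    qed (use v(1) s in \<open>auto intro!: S.sum_vecs S.scale_vecs\<close>)
  qed
  then show ?thesis by (rule that)
qed

end

theorem theorem2:
  fixes p n r :: nat
  assumes "CHAR('k::alg_closed_field) = p"
    and "p > 2"
    and "n > 0"
    and "2 * r \<le> n"
  shows "trivial_source_module (sym_group n)
      (specht_module (two_part n r) :: (nat \<Rightarrow> nat, nat set list, 'k) gmod)
    \<longleftrightarrow> two_part n r \<in> JM TYPE('k) n"
proof -
  have "(2 :: 'k) \<noteq> 0"
  proof
    assume "(2 :: 'k) = 0"
    then have "of_nat 2 = (0 :: 'k)" by simp
    then have "p dvd 2" using assms(1) of_nat_eq_0_iff_char_dvd[where ?'a = 'k] by blast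
    then show False using assms(2) by (auto dest: dvd_imp_le)
  qed
  then interpret two_part_tabloids n r "TYPE('k)"
    using assms(4) by unfold_locales
  have part: "is_partition n (two_part n r)"
    using assms(3,4) by (auto simp: is_partition_def two_part_def)
  have "trivial_source_module G S \<longleftrightarrow> simple_module G S"
  proof
    assume ts: "trivial_source_module G S"
    then have nontriv: "vecs S \<noteq> {0}"
      by (simp add: trivial_source_module_def indecomposable_module_def)
    obtain Y :: "(nat \<Rightarrow> nat) set set" and ac v f where ps: "permutation_summand G S Y ac v f"
      using S.trivial_source_permutation_summand[OF scalar_endomorphisms_S ts] by metis
    show "simple_module G S"
    proof (rule ccontr)
      assume "\<not> simple_module G S"
      then obtain qs where "valid_pairs qs" "length qs < r" "pair_prod qs \<in> vecs S" "pair_prod qs \<noteq> 0"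
        using not_simple_contains_pair_prod[OF nontriv] by blast
      then show False using pair_prod_not_permutation_summand[OF _ ps] assms(1,2) by simp
    qed
  next
    assume simple: "simple_module G S"
    then have nontriv: "vecs S \<noteq> {0}" by (simp add: simple_module_def)
    obtain v where "permutation_summand G S X (\<lambda>\<sigma>. map (image \<sigma>)) v (\<lambda>T s. s T)"
      using simple_permutation_summand[OF simple] .
    then show "trivial_source_module G S"
      by (rule permutation_summand.trivial_source[OF _ scalar_endomorphisms_S nontriv])
  qed
  then show ?thesis using part by (simp add: JM_def)
qed

end
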